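(* Let $\mathcal{E}$ be a topos with a local state classifier $\{\xi_X\colon X\to\Xi\}_{X\in\mathrm{ob}(\mathcal{E})}$ (for example, an arbitrary Grothendieck topos). Then the following three concepts correspond bijectively: (1) hyperconnected quotients of $\mathcal{E}$; (2) internal filters of $\Xi$; (3) internal semilattice homomorphisms $\Xi\to\Omega$, where $\Omega$ is the subobject classifier of $\mathcal{E}$.
   Context: "Topos" means elementary topos. Local state classifier: for a category $\mathcal{C}$, let $\mathcal{C}_{\mathrm{mono}}$ be the subcategory with the same objects and all monomorphisms of $\mathcal{C}$. A local state classifier of $\mathcal{C}$ is a colimit $\Xi$ (if it exists) of the (possibly large) inclusion functor $\mathcal{C}_{\mathrm{mono}}\to\mathcal{C}$, with colimit cocone $\{\xi_X\colon X\to\Xi\}_{X\in\mathrm{ob}(\mathcal{C})}$. Thus $\xi_X=\xi_Y\circ\iota$ for every monomorphism $\iota\colon X\to Y$, and the family is universal with this property. Hyperconnected quotient: a geometric morphism $f\colon\mathcal{E}\to\mathcal{F}$ is hyperconnected if $f^*$ is full and faithful and its essential image is closed under subobjects in $\mathcal{E}$ (equivalently: $f^*$ is full and faithful with essential image closed under quotients in $\mathcal{E}$; equivalently, the unit and counit of $f^*\dashv f_*$ are both monic). A hyperconnected quotient of $\mathcal{E}$ is a hyperconnected geometric morphism from $\mathcal{E}$; two of them are identified when the essential images of their inverse image functors (replete full subcategories of $\mathcal{E}$) coincide. Internal semilattice: an object $A$ with morphisms $\top\colon\mathbf{1}\to A$, $\wedge\colon A\times A\to A$ satisfying $x\wedge\top=\top\wedge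 x=x$, associativity, commutativity and $x\wedge x=x$; homomorphisms preserve $\top$ and $\wedge$. An internal filter of $A$ is a subobject $m\colon F\rightarrowtail A$ such that $\top$ factors through $m$; $\wedge\circ(m\times m)$ factors through $m$; and $F$ is upward closed: for all $T$, $u\colon T\to F$, $x\colon T\to A$ with $\wedge\circ\langle m u,x\rangle=m u$, the morphism $x$ factors through $m$. Semilattice structure on $\Xi$: since $\mathcal{E}$ is cartesian closed, $\{\xi_X\times\xi_Y\colon X\times Y\to\Xi\times\Xi\}_{X,Y}$ is a colimit cocone of the functor $\mathcal{E}_{\mathrm{mono}}\times\mathcal{E}_{\mathrm{mono}}\to\mathcal{E}$, $(X,Y)\mapsto X\times Y$. Put $\top=\xi_{\mathbf{1}}\colon\mathbf{1}\to\Xi$ and let $\wedge\colon\Xi\times\Xi\to\Xi$ be the unique morphism with $\wedge\circ(\xi_X\times\xi_Y)=\xi_{X\times Y}$ for all $X,Y$. The object $\Omega$ has its usual semilattice structure ($\top=\mathrm{true}$, $\wedge$ the characteristic morphism of $\mathrm{true}\times\mathrm{true}$). The correspondences meant: an internal filter $k\colon F\rightarrowtail\Xi$ corresponds to its characteristic morphism $\Xi\to\Omega$, and to the hyperconnected quotient given by the full subcategory of those $X\in\mathrm{ob}(\mathcal{E})$ for which $\xi_X$ factors through $k$. *)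

theory Defs
  imports Main
begin

section \<open>Categories\<close>

text \<open>
  \<open>g \<cdot>\<^bsub>C\<^esub> f\<close> is ``\<open>g\<close> after \<open>f\<close>''.  The record fields are total functions whose values outside
  the carriers \<open>Ob C\<close>, \<open>Ar C\<close> (and on non-composable pairs) are arbitrary and never used.
\<close>

record ('o, 'm) cat =
  Ob :: "'o set"
  Ar :: "'m set"
  Dom :: "'m \<Rightarrow> 'o"
  Cod :: "'m \<Rightarrow> 'o"
  Ident :: "'o \<Rightarrow> 'm"
  Comp :: "'m \<Rightarrow> 'm \<Rightarrow> 'm" (infixl "\<cdot>\<index>" 70)

definition Hom :: "('o, 'm) cat \<Rightarrow> 'o \<Rightarrow> 'o \<Rightarrow> 'm set" where
  "Hom C X Y = {f \<in> Ar C. Dom C f = X \<and> Cod C f = Y}"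

locale category =
  fixes C :: "('o, 'm) cat" (structure)
  assumes dom_in_Ob: "f \<in> Ar C \<Longrightarrow> Dom C f \<in> Ob C"
    and cod_in_Ob: "f \<in> Ar C \<Longrightarrow> Cod C f \<in> Ob C"
    and ident_in_Hom: "X \<in> Ob C \<Longrightarrow> Ident C X \<in> Hom C X X"
    and comp_in_Hom: "f \<in> Hom C X Y \<Longrightarrow> g \<in> Hom C Y Z \<Longrightarrow> g \<cdot> f \<in> Hom C X Z"
    and comp_ident_right: "f \<in> Hom C X Y \<Longrightarrow> f \<cdot> Ident C X = f"
    and comp_ident_left: "f \<in> Hom C X Y \<Longrightarrow> Ident C Y \<cdot> f = f"
    and comp_assoc:
      "f \<in> Hom C W X \<Longrightarrow> g \<in> Hom C X Y \<Longrightarrow> h \<in> Hom C Y Z \<Longrightarrow> (h \<cdot> g) \<cdot> f = h \<cdot> (g \<cdot> f)"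

definition monic :: "('o, 'm) cat \<Rightarrow> 'm \<Rightarrow> bool" where
  "monic C m \<longleftrightarrow> m \<in> Ar C \<and>
     (\<forall>X \<in> Ob C. \<forall>f \<in> Hom C X (Dom C m). \<forall>g \<in> Hom C X (Dom C m).
        m \<cdot>\<^bsub>C\<^esub> f = m \<cdot>\<^bsub>C\<^esub> g \<longrightarrow> f = g)"

definition isomorphic :: "('o, 'm) cat \<Rightarrow> 'o \<Rightarrow> 'o \<Rightarrow> bool" where
  "isomorphic C X Y \<longleftrightarrow>
     (\<exists>f \<in> Hom C X Y. \<exists>g \<in> Hom C Y X. g \<cdot>\<^bsub>C\<^esub> f = Ident C X \<and> f \<cdot>\<^bsub>C\<^esub> g = Ident C Y)"

definition factors_through :: "('o, 'm) cat \<Rightarrow> 'm \<Rightarrow> 'm \<Rightarrow> bool" where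
  "factors_through C f m \<longleftrightarrow> (\<exists>h \<in> Hom C (Dom C f) (Dom C m). m \<cdot>\<^bsub>C\<^esub> h = f)"

text \<open>Two monomorphisms represent the same subobject when they are related as follows.\<close>

definition subobject_rel :: "('o, 'm) cat \<Rightarrow> ('m \<times> 'm) set" where
  "subobject_rel C = {(m, n). monic C m \<and> monic C n \<and> Cod C m = Cod C n \<and>
     factors_through C m n \<and> factors_through C n m}"


section \<open>Functors and adjunctions\<close>

record ('o, 'm, 'p, 'n) cfunctor =
  OMap :: "'o \<Rightarrow> 'p"
  AMap :: "'m \<Rightarrow> 'n"

locale is_functor = source: category C + target: category D
  for C :: "('o, 'm) cat" and D :: "('p, 'n) cat" and F :: "('o, 'm, 'p, 'n) cfunctor" +
  assumes OMap_in_Ob: "X \<in> Ob C \<Longrightarrow> OMap F X \<in> Ob D"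
    and AMap_in_Hom: "f \<in> Hom C X Y \<Longrightarrow> AMap F f \<in> Hom D (OMap F X) (OMap F Y)"
    and AMap_ident: "X \<in> Ob C \<Longrightarrow> AMap F (Ident C X) = Ident D (OMap F X)"
    and AMap_comp:
      "f \<in> Hom C X Y \<Longrightarrow> g \<in> Hom C Y Z \<Longrightarrow> AMap F (g \<cdot>\<^bsub>C\<^esub> f) = AMap F g \<cdot>\<^bsub>D\<^esub> AMap F f"

definition full :: "('o, 'm) cat \<Rightarrow> ('p, 'n) cat \<Rightarrow> ('o, 'm, 'p, 'n) cfunctor \<Rightarrow> bool" where
  "full C D F \<longleftrightarrow> (\<forall>X \<in> Ob C. \<forall>Y \<in> Ob C. \<forall>g \<in> Hom D (OMap F X) (OMap F Y).
     \<exists>f \<in> Hom C X Y. AMap F f = g)"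

definition faithful :: "('o, 'm) cat \<Rightarrow> ('o, 'm, 'p, 'n) cfunctor \<Rightarrow> bool" where
  "faithful C F \<longleftrightarrow> (\<forall>X \<in> Ob C. \<forall>Y \<in> Ob C. inj_on (AMap F) (Hom C X Y))"

text \<open>The objects of the essential image, which is a replete full subcategory when \<open>F\<close> is full.\<close>

definition ess_image :: "('o, 'm) cat \<Rightarrow> ('p, 'n) cat \<Rightarrow> ('o, 'm, 'p, 'n) cfunctor \<Rightarrow> 'p set" where
  "ess_image C D F = {Y \<in> Ob D. \<exists>X \<in> Ob C. isomorphic D (OMap F X) Y}"

text \<open>\<open>L : C \<rightarrow> D\<close> is left adjoint to \<open>R : D \<rightarrow> C\<close> with unit \<open>\<eta>\<close> and counit \<open>\<epsilon>\<close>.\<close>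

definition adjunction ::
  "('o, 'm) cat \<Rightarrow> ('p, 'n) cat \<Rightarrow> ('o, 'm, 'p, 'n) cfunctor \<Rightarrow> ('p, 'n, 'o, 'm) cfunctor \<Rightarrow>
   ('o \<Rightarrow> 'm) \<Rightarrow> ('p \<Rightarrow> 'n) \<Rightarrow> bool" where
  "adjunction C D L R \<eta> \<epsilon> \<longleftrightarrow>
     is_functor C D L \<and> is_functor D C R \<and>
     (\<forall>X \<in> Ob C. \<eta> X \<in> Hom C X (OMap R (OMap L X))) \<and>
     (\<forall>f \<in> Ar C. \<eta> (Cod C f) \<cdot>\<^bsub>C\<^esub> f = AMap R (AMap L f) \<cdot>\<^bsub>C\<^esub> \<eta> (Dom C f)) \<and>
     (\<forall>Y \<in> Ob D. \<epsilon> Y \<in> Hom D (OMap L (OMap R Y)) Y) \<and>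
     (\<forall>g \<in> Ar D. \<epsilon> (Cod D g) \<cdot>\<^bsub>D\<^esub> AMap L (AMap R g) = g \<cdot>\<^bsub>D\<^esub> \<epsilon> (Dom D g)) \<and>
     (\<forall>X \<in> Ob C. \<epsilon> (OMap L X) \<cdot>\<^bsub>D\<^esub> AMap L (\<eta> X) = Ident D (OMap L X)) \<and>
     (\<forall>Y \<in> Ob D. AMap R (\<epsilon> Y) \<cdot>\<^bsub>C\<^esub> \<eta> (OMap R Y) = Ident C (OMap R Y))"


section \<open>Limits and colimits\<close>

definition is_cocone ::
  "('j, 'k) cat \<Rightarrow> ('o, 'm) cat \<Rightarrow> ('j, 'k, 'o, 'm) cfunctor \<Rightarrow> 'o \<Rightarrow> ('j \<Rightarrow> 'm) \<Rightarrow> bool" where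
  "is_cocone J C F c \<kappa> \<longleftrightarrow> c \<in> Ob C \<and>
     (\<forall>j \<in> Ob J. \<kappa> j \<in> Hom C (OMap F j) c) \<and>
     (\<forall>u \<in> Ar J. \<kappa> (Cod J u) \<cdot>\<^bsub>C\<^esub> AMap F u = \<kappa> (Dom J u))"

definition is_colimit ::
  "('j, 'k) cat \<Rightarrow> ('o, 'm) cat \<Rightarrow> ('j, 'k, 'o, 'm) cfunctor \<Rightarrow> 'o \<Rightarrow> ('j \<Rightarrow> 'm) \<Rightarrow> bool" where
  "is_colimit J C F c \<kappa> \<longleftrightarrow> is_cocone J C F c \<kappa> \<and>
     (\<forall>d \<mu>. is_cocone J C F d \<mu> \<longrightarrow>
        (\<exists>!h. h \<in> Hom C c d \<and> (\<forall>j \<in> Ob J. h \<cdot>\<^bsub>C\<^esub> \<kappa> j = \<mu> j)))"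

definition is_terminal :: "('o, 'm) cat \<Rightarrow> 'o \<Rightarrow> bool" where
  "is_terminal C t \<longleftrightarrow> t \<in> Ob C \<and> (\<forall>X \<in> Ob C. \<exists>!f. f \<in> Hom C X t)"

definition is_product :: "('o, 'm) cat \<Rightarrow> 'o \<Rightarrow> 'o \<Rightarrow> 'o \<Rightarrow> 'm \<Rightarrow> 'm \<Rightarrow> bool" where
  "is_product C X Y P p q \<longleftrightarrow> P \<in> Ob C \<and> p \<in> Hom C P X \<and> q \<in> Hom C P Y \<and>
     (\<forall>T \<in> Ob C. \<forall>x \<in> Hom C T X. \<forall>y \<in> Hom C T Y.
        \<exists>!u. u \<in> Hom C T P \<and> p \<cdot>\<^bsub>C\<^esub> u = x \<and> q \<cdot>\<^bsub>C\<^esub> u = y)"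

text \<open>\<open>is_pullback C P p q f g\<close>: the square \<open>f \<cdot> p = g \<cdot> q\<close> with corner \<open>P\<close> is a pullback.\<close>

definition is_pullback :: "('o, 'm) cat \<Rightarrow> 'o \<Rightarrow> 'm \<Rightarrow> 'm \<Rightarrow> 'm \<Rightarrow> 'm \<Rightarrow> bool" where
  "is_pullback C P p q f g \<longleftrightarrow>
     f \<in> Ar C \<and> g \<in> Ar C \<and> Cod C f = Cod C g \<and>
     P \<in> Ob C \<and> p \<in> Hom C P (Dom C f) \<and> q \<in> Hom C P (Dom C g) \<and> f \<cdot>\<^bsub>C\<^esub> p = g \<cdot>\<^bsub>C\<^esub> q \<and>
     (\<forall>T \<in> Ob C. \<forall>x \<in> Hom C T (Dom C f). \<forall>y \<in> Hom C T (Dom C g).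
        f \<cdot>\<^bsub>C\<^esub> x = g \<cdot>\<^bsub>C\<^esub> y \<longrightarrow> (\<exists>!u. u \<in> Hom C T P \<and> p \<cdot>\<^bsub>C\<^esub> u = x \<and> q \<cdot>\<^bsub>C\<^esub> u = y))"

text \<open>Finite completeness and left exactness are stated through terminal objects and pullbacks.\<close>

definition finitely_complete :: "('o, 'm) cat \<Rightarrow> bool" where
  "finitely_complete C \<longleftrightarrow> (\<exists>t. is_terminal C t) \<and>
     (\<forall>f \<in> Ar C. \<forall>g \<in> Ar C. Cod C f = Cod C g \<longrightarrow> (\<exists>P p q. is_pullback C P p q f g))"

definition left_exact :: "('o, 'm) cat \<Rightarrow> ('p, 'n) cat \<Rightarrow> ('o, 'm, 'p, 'n) cfunctor \<Rightarrow> bool" where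
  "left_exact C D F \<longleftrightarrow>
     (\<forall>t. is_terminal C t \<longrightarrow> is_terminal D (OMap F t)) \<and>
     (\<forall>P p q f g. is_pullback C P p q f g \<longrightarrow>
        is_pullback D (OMap F P) (AMap F p) (AMap F q) (AMap F f) (AMap F g))"


section \<open>Elementary toposes\<close>

text \<open>
  \<open>ev : P \<rightarrow> B\<close> with \<open>P = X \<times> A\<close> (projections \<open>p\<close>, \<open>q\<close>) makes \<open>X\<close> an exponential of \<open>B\<close> by \<open>A\<close>.
  The morphism \<open>u\<close> in the definition is \<open>h \<times> id\<^sub>A : Z \<times> A \<rightarrow> X \<times> A\<close>.
\<close>

definition is_exponential ::
  "('o, 'm) cat \<Rightarrow> 'o \<Rightarrow> 'o \<Rightarrow> 'o \<Rightarrow> 'o \<Rightarrow> 'm \<Rightarrow> 'm \<Rightarrow> 'm \<Rightarrow> bool" where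
  "is_exponential C A B X P p q ev \<longleftrightarrow>
     X \<in> Ob C \<and> is_product C X A P p q \<and> ev \<in> Hom C P B \<and>
     (\<forall>Z \<in> Ob C. \<forall>Q r s. is_product C Z A Q r s \<longrightarrow> (\<forall>g \<in> Hom C Q B.
        \<exists>!h. h \<in> Hom C Z X \<and>
          (\<exists>u \<in> Hom C Q P. p \<cdot>\<^bsub>C\<^esub> u = h \<cdot>\<^bsub>C\<^esub> r \<and> q \<cdot>\<^bsub>C\<^esub> u = s \<and> ev \<cdot>\<^bsub>C\<^esub> u = g)))"

definition has_exponentials :: "('o, 'm) cat \<Rightarrow> bool" where
  "has_exponentials C \<longleftrightarrow>
     (\<forall>A \<in> Ob C. \<forall>B \<in> Ob C. \<exists>X P p q ev. is_exponential C A B X P p q ev)"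

text \<open>The unique morphism from \<open>X\<close> to a terminal object \<open>t\<close>.\<close>

definition to_terminal :: "('o, 'm) cat \<Rightarrow> 'o \<Rightarrow> 'o \<Rightarrow> 'm" where
  "to_terminal C t X = (THE f. f \<in> Hom C X t)"

definition is_characteristic :: "('o, 'm) cat \<Rightarrow> 'o \<Rightarrow> 'o \<Rightarrow> 'm \<Rightarrow> 'm \<Rightarrow> 'm \<Rightarrow> bool" where
  "is_characteristic C t \<Omega> tru m \<chi> \<longleftrightarrow> \<chi> \<in> Hom C (Cod C m) \<Omega> \<and>
     is_pullback C (Dom C m) m (to_terminal C t (Dom C m)) \<chi> tru"

definition subobject_classifier :: "('o, 'm) cat \<Rightarrow> 'o \<Rightarrow> 'o \<Rightarrow> 'm \<Rightarrow> bool" where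
  "subobject_classifier C t \<Omega> tru \<longleftrightarrow>
     is_terminal C t \<and> \<Omega> \<in> Ob C \<and> tru \<in> Hom C t \<Omega> \<and>
     (\<forall>m. monic C m \<longrightarrow> (\<exists>!\<chi>. is_characteristic C t \<Omega> tru m \<chi>))"

definition characteristic :: "('o, 'm) cat \<Rightarrow> 'o \<Rightarrow> 'o \<Rightarrow> 'm \<Rightarrow> 'm \<Rightarrow> 'm" where
  "characteristic C t \<Omega> tru m = (THE \<chi>. is_characteristic C t \<Omega> tru m \<chi>)"

definition elementary_topos :: "('o, 'm) cat \<Rightarrow> bool" where
  "elementary_topos C \<longleftrightarrow> category C \<and> finitely_complete C \<and> has_exponentials C \<and>
     (\<exists>t \<Omega> tru. subobject_classifier C t \<Omega> tru)"


section \<open>Hyperconnected quotients\<close>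

text \<open>
  A geometric morphism out of a topos with object type \<open>'o\<close> and morphism type \<open>'m\<close>, bundled with
  its codomain, inverse image, direct image, and the unit and counit of the adjunction.
\<close>

record ('o, 'm, 'p, 'n) geom =
  Codomain :: "('p, 'n) cat"
  Inverse_Image :: "('p, 'n, 'o, 'm) cfunctor"
  Direct_Image :: "('o, 'm, 'p, 'n) cfunctor"
  Unit :: "'p \<Rightarrow> 'n"
  Counit :: "'o \<Rightarrow> 'm"

definition geometric_morphism :: "('o, 'm) cat \<Rightarrow> ('o, 'm, 'p, 'n) geom \<Rightarrow> bool" where
  "geometric_morphism E f \<longleftrightarrow> elementary_topos E \<and> elementary_topos (Codomain f) \<and>
     adjunction (Codomain f) E (Inverse_Image f) (Direct_Image f) (Unit f) (Counit f) \<and>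
     left_exact (Codomain f) E (Inverse_Image f)"

definition inv_image_objects :: "('o, 'm) cat \<Rightarrow> ('o, 'm, 'p, 'n) geom \<Rightarrow> 'o set" where
  "inv_image_objects E f = ess_image (Codomain f) E (Inverse_Image f)"

definition hyperconnected :: "('o, 'm) cat \<Rightarrow> ('o, 'm, 'p, 'n) geom \<Rightarrow> bool" where
  "hyperconnected E f \<longleftrightarrow> geometric_morphism E f \<and>
     full (Codomain f) E (Inverse_Image f) \<and> faithful (Codomain f) (Inverse_Image f) \<and>
     (\<forall>m. monic E m \<and> Cod E m \<in> inv_image_objects E f \<longrightarrow> Dom E m \<in> inv_image_objects E f)"

text \<open>
  HOL cannot collect codomain toposes of all types in one set, so the codomain has the object and
  morphism types of \<open>E\<close>.  No quotient is lost: the codomain of a hyperconnected geometric morphism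
  is equivalent to a full subcategory of \<open>E\<close>.
\<close>

definition hyperconnected_quotients :: "('o, 'm) cat \<Rightarrow> ('o, 'm, 'o, 'm) geom set set" where
  "hyperconnected_quotients E = {f. hyperconnected E f} //
     {(f, g). hyperconnected E f \<and> hyperconnected E g \<and>
        inv_image_objects E f = inv_image_objects E g}"


section \<open>Internal semilattices and filters\<close>

text \<open>A chosen terminal object and chosen binary products.\<close>

record ('o, 'm) cartesian =
  One :: 'o
  Prod :: "'o \<Rightarrow> 'o \<Rightarrow> 'o"
  Fst :: "'o \<Rightarrow> 'o \<Rightarrow> 'm"
  Snd :: "'o \<Rightarrow> 'o \<Rightarrow> 'm"

definition cartesian_structure :: "('o, 'm) cat \<Rightarrow> ('o, 'm) cartesian \<Rightarrow> bool" where
  "cartesian_structure C K \<longleftrightarrow> is_terminal C (One K) \<and>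
     (\<forall>X \<in> Ob C. \<forall>Y \<in> Ob C. is_product C X Y (Prod K X Y) (Fst K X Y) (Snd K X Y))"

definition pairing :: "('o, 'm) cat \<Rightarrow> ('o, 'm) cartesian \<Rightarrow> 'm \<Rightarrow> 'm \<Rightarrow> 'm" where
  "pairing C K x y = (THE u. u \<in> Hom C (Dom C x) (Prod K (Cod C x) (Cod C y)) \<and>
     Fst K (Cod C x) (Cod C y) \<cdot>\<^bsub>C\<^esub> u = x \<and> Snd K (Cod C x) (Cod C y) \<cdot>\<^bsub>C\<^esub> u = y)"

definition prod_map :: "('o, 'm) cat \<Rightarrow> ('o, 'm) cartesian \<Rightarrow> 'm \<Rightarrow> 'm \<Rightarrow> 'm" where
  "prod_map C K f g =
     pairing C K (f \<cdot>\<^bsub>C\<^esub> Fst K (Dom C f) (Dom C g)) (g \<cdot>\<^bsub>C\<^esub> Snd K (Dom C f) (Dom C g))"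

record ('o, 'm) semilat =
  Carrier :: 'o
  Top :: 'm
  Meet :: 'm

text \<open>The laws are stated on generalized elements \<open>x, y, z : X \<rightarrow> A\<close>.\<close>

definition internal_semilattice ::
  "('o, 'm) cat \<Rightarrow> ('o, 'm) cartesian \<Rightarrow> ('o, 'm) semilat \<Rightarrow> bool" where
  "internal_semilattice C K A \<longleftrightarrow>
     Carrier A \<in> Ob C \<and>
     Top A \<in> Hom C (One K) (Carrier A) \<and>
     Meet A \<in> Hom C (Prod K (Carrier A) (Carrier A)) (Carrier A) \<and>
     (\<forall>X \<in> Ob C.
        let H = Hom C X (Carrier A);
            top = Top A \<cdot>\<^bsub>C\<^esub> to_terminal C (One K) X;
            meet = (\<lambda>x y. Meet A \<cdot>\<^bsub>C\<^esub> pairing C K x y)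
        in (\<forall>x \<in> H. meet x top = x \<and> meet top x = x) \<and>
           (\<forall>x \<in> H. \<forall>y \<in> H. \<forall>z \<in> H. meet (meet x y) z = meet x (meet y z)) \<and>
           (\<forall>x \<in> H. \<forall>y \<in> H. meet x y = meet y x) \<and>
           (\<forall>x \<in> H. meet x x = x))"

definition semilattice_homs ::
  "('o, 'm) cat \<Rightarrow> ('o, 'm) cartesian \<Rightarrow> ('o, 'm) semilat \<Rightarrow> ('o, 'm) semilat \<Rightarrow> 'm set" where
  "semilattice_homs C K A B = {h.
     internal_semilattice C K A \<and> internal_semilattice C K B \<and>
     h \<in> Hom C (Carrier A) (Carrier B) \<and>
     h \<cdot>\<^bsub>C\<^esub> Top A = Top B \<and>
     h \<cdot>\<^bsub>C\<^esub> Meet A = Meet B \<cdot>\<^bsub>C\<^esub> prod_map C K h h}"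

definition internal_filter ::
  "('o, 'm) cat \<Rightarrow> ('o, 'm) cartesian \<Rightarrow> ('o, 'm) semilat \<Rightarrow> 'm \<Rightarrow> bool" where
  "internal_filter C K A m \<longleftrightarrow>
     internal_semilattice C K A \<and>
     monic C m \<and> Cod C m = Carrier A \<and>
     factors_through C (Top A) m \<and>
     factors_through C (Meet A \<cdot>\<^bsub>C\<^esub> prod_map C K m m) m \<and>
     (\<forall>T \<in> Ob C. \<forall>u \<in> Hom C T (Dom C m). \<forall>x \<in> Hom C T (Carrier A).
        Meet A \<cdot>\<^bsub>C\<^esub> pairing C K (m \<cdot>\<^bsub>C\<^esub> u) x = m \<cdot>\<^bsub>C\<^esub> u \<longrightarrow> factors_through C x m)"

definition internal_filters ::
  "('o, 'm) cat \<Rightarrow> ('o, 'm) cartesian \<Rightarrow> ('o, 'm) semilat \<Rightarrow> 'm set set" where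
  "internal_filters C K A = {m. internal_filter C K A m} // subobject_rel C"

definition Omega_semilattice ::
  "('o, 'm) cat \<Rightarrow> ('o, 'm) cartesian \<Rightarrow> 'o \<Rightarrow> 'm \<Rightarrow> ('o, 'm) semilat" where
  "Omega_semilattice C K \<Omega> tru = \<lparr>Carrier = \<Omega>, Top = tru,
     Meet = characteristic C (One K) \<Omega> tru (prod_map C K tru tru)\<rparr>"


section \<open>The local state classifier\<close>

definition mono_subcategory :: "('o, 'm) cat \<Rightarrow> ('o, 'm) cat" where
  "mono_subcategory C = C\<lparr>Ar := {m. monic C m}\<rparr>"

definition inclusion_functor :: "('o, 'm, 'o, 'm) cfunctor" where
  "inclusion_functor = \<lparr>OMap = (\<lambda>X. X), AMap = (\<lambda>f. f)\<rparr>"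

definition local_state_classifier :: "('o, 'm) cat \<Rightarrow> 'o \<Rightarrow> ('o \<Rightarrow> 'm) \<Rightarrow> bool" where
  "local_state_classifier C \<Xi> \<xi> \<longleftrightarrow>
     is_colimit (mono_subcategory C) C inclusion_functor \<Xi> \<xi>"

definition Xi_semilattice ::
  "('o, 'm) cat \<Rightarrow> ('o, 'm) cartesian \<Rightarrow> 'o \<Rightarrow> ('o \<Rightarrow> 'm) \<Rightarrow> ('o, 'm) semilat" where
  "Xi_semilattice C K \<Xi> \<xi> = \<lparr>Carrier = \<Xi>, Top = \<xi> (One K),
     Meet = (THE w. w \<in> Hom C (Prod K \<Xi> \<Xi>) \<Xi> \<and>
       (\<forall>X \<in> Ob C. \<forall>Y \<in> Ob C. w \<cdot>\<^bsub>C\<^esub> prod_map C K (\<xi> X) (\<xi> Y) = \<xi> (Prod K X Y)))\<rparr>"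

end

theory Submission
  imports Defs
begin

text \<open>
  The correspondence rests on describing all three notions in terms of generalized elements and of
  classes of objects.

  A morphism into \<open>\<Omega>\<close> is determined by the elements that it sends to \<open>true\<close> (\<open>omega_eqI\<close>), and the
  meet of \<open>\<Omega>\<close> is true at a pair exactly when both components are true.  A subobject \<open>k\<close> of a
  semilattice is a filter precisely when \<open>x \<and> y \<in> k\<close> is equivalent to \<open>x \<in> k\<close> and \<open>y \<in> k\<close>, and
  contains the top element.  So filters and homomorphisms into \<open>\<Omega>\<close> correspond through
  characteristic morphisms, for any internal semilattice (\<open>characteristic_of_filter_is_hom\<close>,
  \<open>hom_classifies_filter\<close>).  That \<open>\<Xi>\<close> is a semilattice follows from cartesian closedness, by which
  the maps \<open>\<xi> X \<times> \<xi> Y\<close> and their threefold analogues are jointly epic, and from the invariance of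
  \<open>\<xi>\<close> under monomorphisms (\<open>Xi_is_semilattice\<close>).

  A hyperconnected quotient is known by the objects in the essential image \<open>Q\<close> of its inverse image
  functor.  The possible \<open>Q\<close> are the classes closed under subobjects and finite products for which
  every object \<open>Y\<close> has a subobject in \<open>Q\<close> through which all maps from \<open>Q\<close> to \<open>Y\<close> factor; the locale
  \<open>hyperconnected_class\<close> collects these conditions.  Such a class is a topos as a full subcategory:
  finite limits are those of \<open>E\<close>, while exponentials and the subobject classifier are coreflections
  of those of \<open>E\<close> (\<open>hyperconnected_geom\<close>).  Conversely, the counit of a hyperconnected morphism
  provides the required subobjects; it is monic because its kernel pair lies in \<open>Q\<close>, where the two
  projections must agree by the uniqueness of transposes (\<open>hyperconnected_class_inv_image\<close>).

  Finally, a filter \<open>k\<close> of \<open>\<Xi>\<close> gives the class of those \<open>X\<close> for which \<open>\<xi> X\<close> lies in \<open>k\<close>.  The key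
  observation is that \<open>\<xi> X \<le> \<xi> Y \<cdot> f\<close> for every \<open>f : X \<rightarrow> Y\<close>, because the graph of \<open>f\<close> is a
  monomorphism \<open>X \<rightarrow> X \<times> Y\<close>; upward closure then makes \<open>f\<close> factor through the inverse image of \<open>k\<close>
  along \<open>\<xi> Y\<close>, which is therefore the coreflection of \<open>Y\<close> (\<open>hyperconnected_class_of_filter\<close>).  In the
  other direction the characteristic morphisms of the coreflections, taken over all objects, form a cocone, and so
  define a homomorphism \<open>\<Xi> \<rightarrow> \<Omega>\<close>, that is, a filter (\<open>filter_of_hyperconnected_class\<close>).
\<close>

section \<open>Arrows, monomorphisms, pullbacks and products\<close>

lemma ex1_same: "\<exists>!x. P x \<Longrightarrow> P x \<Longrightarrow> P y \<Longrightarrow> x = y"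
  by blast

lemma terminal_arrow_exists:
  assumes "is_terminal C t" "X \<in> Ob C"
  obtains f where "f \<in> Hom C X t"
proof -
  have "\<exists>!f. f \<in> Hom C X t" using assms by (simp add: is_terminal_def)
  then show ?thesis using that by (elim ex1E)
qed

text \<open>
  Both bijections of the theorem start from internal filters up to equality of subobjects, so both
  are obtained in the same way: from a complete invariant \<open>\<phi>\<close> of the equivalence classes.
\<close>

lemma bij_betw_quotient:
  assumes rel: "\<And>k. k \<in> P \<Longrightarrow> (k, k) \<in> r"
    and inv: "\<And>k l. \<lbrakk>k \<in> P; (k, l) \<in> r\<rbrakk> \<Longrightarrow> \<phi> l = \<phi> k"
    and inj: "\<And>k l. \<lbrakk>k \<in> P; l \<in> P; \<phi> k = \<phi> l\<rbrakk> \<Longrightarrow> r `` {k} = r `` {l}"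
    and im: "\<phi> ` P = B"
  obtains \<Phi> where "bij_betw \<Phi> (P // r) B" "\<And>k. k \<in> P \<Longrightarrow> \<Phi> (r `` {k}) = \<phi> k"
proof -
  define \<Phi> where "\<Phi> c = \<phi> (SOME k. k \<in> c)" for c
  have val: "\<Phi> (r `` {k}) = \<phi> k" if "k \<in> P" for k
  proof -
    have "(SOME l. l \<in> r `` {k}) \<in> r `` {k}" 
      by (rule someI[of "\<lambda>l. l \<in> r `` {k}" k]) (simp add: rel[OF that])
    then have "(k, SOME l. l \<in> r `` {k}) \<in> r" by simp
    then show ?thesis unfolding \<Phi>_def by (rule inv[OF that])
  qed
  have quot: "P // r = (\<lambda>k. r `` {k}) ` P" by (auto simp: quotient_def)
  have "inj_on \<Phi> (P // r)"
    unfolding quot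
  proof (rule inj_onI)
    fix c d assume "c \<in> (\<lambda>k. r `` {k}) ` P" "d \<in> (\<lambda>k. r `` {k}) ` P" and eq: "\<Phi> c = \<Phi> d"
    then obtain k l where kl: "k \<in> P" "l \<in> P" "c = r `` {k}" "d = r `` {l}" by (elim imageE)
    have "\<phi> k = \<phi> l" using eq unfolding kl(3,4) val[OF kl(1)] val[OF kl(2)] .
    then show "c = d" unfolding kl(3,4) by (rule inj[OF kl(1,2)])
  qed
  moreover have "\<Phi> ` (P // r) = B"
    unfolding quot im[symmetric] image_image by (intro image_cong refl val)
  ultimately have "bij_betw \<Phi> (P // r) B" by (simp add: bij_betw_def)
  then show ?thesis using val that by blast
qed

context category
begin

text \<open>
  Membership in hom-sets is unfolded into the three facts \<open>f \<in> Ar C\<close>, \<open>Dom C f = X\<close>, \<open>Cod C f = Y\<close>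
  throughout.  In this form the typing conditions of associativity contain no variables that are
  absent from the rewritten term, so that the simplifier can compute with composites.
\<close>

lemma comp_arrow [simp]:
  assumes "f \<in> Ar C" "g \<in> Ar C" "Dom C g = Cod C f"
  shows "g \<cdot> f \<in> Ar C" "Dom C (g \<cdot> f) = Dom C f" "Cod C (g \<cdot> f) = Cod C g"
  using comp_in_Hom[of f "Dom C f" "Cod C f" g "Cod C g"] assms by (auto simp: Hom_def)

lemma ident_arrow [simp]:
  assumes "X \<in> Ob C"
  shows "Ident C X \<in> Ar C" "Dom C (Ident C X) = X" "Cod C (Ident C X) = X"
  using ident_in_Hom[OF assms] by (auto simp: Hom_def)

lemma comp_ident [simp]:
  assumes "f \<in> Ar C"
  shows "Dom C f = X \<Longrightarrow> f \<cdot> Ident C X = f" "Cod C f = X \<Longrightarrow> Ident C X \<cdot> f = f"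
  using comp_ident_right[of f "Dom C f" "Cod C f"] comp_ident_left[of f "Dom C f" "Cod C f"] assms
  by (auto simp: Hom_def)

lemma comp_assoc_arrow [simp]:
  assumes "f \<in> Ar C" "g \<in> Ar C" "h \<in> Ar C" "Dom C g = Cod C f" "Dom C h = Cod C g"
  shows "(h \<cdot> g) \<cdot> f = h \<cdot> (g \<cdot> f)"
  using comp_assoc[of f "Dom C f" "Cod C f" g "Cod C g" h "Cod C h"] assms by (auto simp: Hom_def)

lemma arrow_ends [simp]:
  assumes "f \<in> Ar C"
  shows "Dom C f \<in> Ob C" "Cod C f \<in> Ob C"
  using assms by (auto intro: dom_in_Ob cod_in_Ob)

lemma monic_arrow: "monic C m \<Longrightarrow> m \<in> Ar C"
  by (simp add: monic_def)

lemma monic_cancel: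
  assumes "monic C m" "f \<in> Ar C" "g \<in> Ar C" "Cod C f = Dom C m" "Cod C g = Dom C m"
    "Dom C f = Dom C g" "m \<cdot> f = m \<cdot> g"
  shows "f = g"
  using assms unfolding monic_def Hom_def by force

lemma monicI:
  assumes "m \<in> Ar C"
    "\<And>f g. \<lbrakk>f \<in> Ar C; g \<in> Ar C; Cod C f = Dom C m; Cod C g = Dom C m; Dom C f = Dom C g;
        m \<cdot> f = m \<cdot> g\<rbrakk> \<Longrightarrow> f = g"
  shows "monic C m"
  using assms unfolding monic_def Hom_def by auto

lemma factors_throughE:
  assumes "factors_through C f m"
  obtains h where "h \<in> Ar C" "Dom C h = Dom C f" "Cod C h = Dom C m" "m \<cdot> h = f"
  using assms unfolding factors_through_def Hom_def by auto

lemma factors_throughI: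
  assumes "h \<in> Ar C" "Dom C h = Dom C f" "Cod C h = Dom C m" "m \<cdot> h = f"
  shows "factors_through C f m"
  using assms unfolding factors_through_def Hom_def by auto

lemma factors_through_precomp:
  assumes "factors_through C f m" "m \<in> Ar C" "f \<in> Ar C" "g \<in> Ar C" "Dom C f = Cod C g"
  shows "factors_through C (f \<cdot> g) m"
proof -
  obtain h where h: "h \<in> Ar C" "Dom C h = Dom C f" "Cod C h = Dom C m" "m \<cdot> h = f"
    using assms(1) by (rule factors_throughE)
  have "m \<cdot> (h \<cdot> g) = f \<cdot> g"
    unfolding h(4)[symmetric] using h(1-3) assms by simp
  then show ?thesis
    using h assms by (intro factors_throughI[of "h \<cdot> g"]) auto
qed

lemma factors_through_trans:
  assumes "factors_through C f m" "factors_through C m n" "m \<in> Ar C" "n \<in> Ar C"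
  shows "factors_through C f n"
proof -
  obtain h where h: "h \<in> Ar C" "Dom C h = Dom C f" "Cod C h = Dom C m" "m \<cdot> h = f"
    using assms(1) by (rule factors_throughE)
  show ?thesis
    unfolding h(4)[symmetric] using factors_through_precomp assms h by auto
qed

lemma factors_through_self: "m \<in> Ar C \<Longrightarrow> factors_through C m m"
  by (rule factors_throughI[of "Ident C (Dom C m)"]) auto

text \<open>
  Since composites are normalized to the right, an equation between two composites does not apply
  inside a longer one.  This rule extends such an equation by a further morphism.
\<close>

lemma comp_eq_precomp:
  assumes "a \<cdot> b = c \<cdot> d" "a \<in> Ar C" "b \<in> Ar C" "c \<in> Ar C" "d \<in> Ar C" "u \<in> Ar C"
    "Dom C a = Cod C b" "Dom C c = Cod C d" "Dom C b = Cod C u" "Dom C d = Cod C u"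
  shows "a \<cdot> (b \<cdot> u) = c \<cdot> (d \<cdot> u)"
  using assms comp_assoc_arrow by metis

lemma pullback_arrows:
  assumes "is_pullback C P p q f g"
  shows "f \<in> Ar C" "g \<in> Ar C" "Cod C f = Cod C g" "P \<in> Ob C" "p \<in> Ar C" "q \<in> Ar C"
    "Dom C p = P" "Dom C q = P" "Cod C p = Dom C f" "Cod C q = Dom C g" "f \<cdot> p = g \<cdot> q"
  using assms by (auto simp: is_pullback_def Hom_def)

lemma pullback_ex1:
  assumes "is_pullback C P p q f g" "x \<in> Ar C" "y \<in> Ar C" "Dom C x = Dom C y"
    "Cod C x = Dom C f" "Cod C y = Dom C g" "f \<cdot> x = g \<cdot> y" "Dom C y = T"
  shows "\<exists>!u. u \<in> Hom C T P \<and> p \<cdot> u = x \<and> q \<cdot> u = y"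
proof -
  have "T \<in> Ob C" "x \<in> Hom C T (Dom C f)" "y \<in> Hom C T (Dom C g)"
    using assms(2-8) by (auto simp: Hom_def)
  note mem = this
  have all: "\<forall>T \<in> Ob C. \<forall>x \<in> Hom C T (Dom C f). \<forall>y \<in> Hom C T (Dom C g).
      f \<cdot> x = g \<cdot> y \<longrightarrow> (\<exists>!u. u \<in> Hom C T P \<and> p \<cdot> u = x \<and> q \<cdot> u = y)"
    using assms(1) unfolding is_pullback_def by (elim conjE)
  show ?thesis
    by (rule bspec[OF bspec[OF bspec[OF all mem(1)] mem(2)] mem(3), THEN mp]) (rule assms(7))
qed

lemma pullback_lift:
  assumes "is_pullback C P p q f g" "x \<in> Ar C" "y \<in> Ar C" "Dom C x = Dom C y"
    "Cod C x = Dom C f" "Cod C y = Dom C g" "f \<cdot> x = g \<cdot> y"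
  obtains u where "u \<in> Ar C" "Dom C u = Dom C x" "Cod C u = P" "p \<cdot> u = x" "q \<cdot> u = y"
proof -
  obtain u where "u \<in> Hom C (Dom C y) P" "p \<cdot> u = x" "q \<cdot> u = y"
    using pullback_ex1[OF assms refl] by (elim ex1E conjE)
  then show ?thesis using that[of u] assms(4) by (simp add: Hom_def)
qed

lemma pullback_unique:
  assumes "is_pullback C P p q f g" "u \<in> Ar C" "v \<in> Ar C" "Dom C u = Dom C v"
    "Cod C u = P" "Cod C v = P" "p \<cdot> u = p \<cdot> v" "q \<cdot> u = q \<cdot> v"
  shows "u = v"
proof -
  note pb = pullback_arrows[OF assms(1)]
  have eq: "f \<cdot> (p \<cdot> u) = g \<cdot> (q \<cdot> u)"
    by (rule comp_eq_precomp) (use pb assms(2-6) in auto)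
  have "\<exists>!w. w \<in> Hom C (Dom C u) P \<and> p \<cdot> w = p \<cdot> u \<and> q \<cdot> w = q \<cdot> u"
    using eq assms(2-6) pb(1-10) by (intro pullback_ex1[OF assms(1)]) simp_all
  then show ?thesis
    by (rule ex1_same) (use assms(2-8) in \<open>simp_all add: Hom_def\<close>)
qed

lemma is_pullbackI:
  assumes "f \<in> Ar C" "g \<in> Ar C" "Cod C f = Cod C g" "p \<in> Ar C" "q \<in> Ar C"
    "Dom C p = P" "Dom C q = P" "Cod C p = Dom C f" "Cod C q = Dom C g" "f \<cdot> p = g \<cdot> q"
    and lift: "\<And>x y. \<lbrakk>x \<in> Ar C; y \<in> Ar C; Dom C x = Dom C y; Cod C x = Dom C f; Cod C y = Dom C g;
      f \<cdot> x = g \<cdot> y\<rbrakk> \<Longrightarrow> \<exists>u. u \<in> Ar C \<and> Dom C u = Dom C x \<and> Cod C u = P \<and> p \<cdot> u = x \<and> q \<cdot> u = y"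
    and unique: "\<And>u v. \<lbrakk>u \<in> Ar C; v \<in> Ar C; Dom C u = Dom C v; Cod C u = P; Cod C v = P;
      p \<cdot> u = p \<cdot> v; q \<cdot> u = q \<cdot> v\<rbrakk> \<Longrightarrow> u = v"
  shows "is_pullback C P p q f g"
proof -
  have ex1: "\<exists>!u. u \<in> Hom C T P \<and> p \<cdot> u = x \<and> q \<cdot> u = y"
    if xy: "x \<in> Hom C T (Dom C f)" "y \<in> Hom C T (Dom C g)" "f \<cdot> x = g \<cdot> y" for T x y
  proof -
    have "\<exists>u. u \<in> Ar C \<and> Dom C u = Dom C x \<and> Cod C u = P \<and> p \<cdot> u = x \<and> q \<cdot> u = y"
      by (rule lift) (use xy in \<open>simp_all add: Hom_def\<close>)
    then obtain u where "u \<in> Hom C T P \<and> p \<cdot> u = x \<and> q \<cdot> u = y"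
      using xy by (auto simp: Hom_def)
    moreover from this have "v = u" if "v \<in> Hom C T P \<and> p \<cdot> v = x \<and> q \<cdot> v = y" for v
      using unique[of v u] that xy by (auto simp: Hom_def)
    ultimately show ?thesis by (rule ex1I)
  qed
  have "P \<in> Ob C" "p \<in> Hom C P (Dom C f)" "q \<in> Hom C P (Dom C g)"
    using assms(4-9) arrow_ends(1)[OF assms(4)] by (auto simp: Hom_def)
  then show ?thesis
    unfolding is_pullback_def using assms(1-3,10) by (intro conjI ballI impI) (assumption | (rule ex1; assumption))+
qed

lemma pullback_monic:
  assumes "is_pullback C P p q f m" "monic C m"
  shows "monic C p"
proof (rule monicI)
  note pb = pullback_arrows[OF assms(1)]
  show "p \<in> Ar C" by fact
  fix u v
  assume uv: "u \<in> Ar C" "v \<in> Ar C" "Cod C u = Dom C p" "Cod C v = Dom C p"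
    "Dom C u = Dom C v" "p \<cdot> u = p \<cdot> v"
  have "m \<cdot> (q \<cdot> w) = f \<cdot> (p \<cdot> w)" if "w \<in> Ar C" "Cod C w = Dom C p" for w
    by (rule comp_eq_precomp) (use that pb in auto)
  then have "q \<cdot> u = q \<cdot> v"
    using monic_cancel[OF assms(2), of "q \<cdot> u" "q \<cdot> v"] uv pb by simp
  then show "u = v"
    using pullback_unique[OF assms(1)] uv pb by simp
qed

lemma product_arrows:
  assumes "is_product C X Y P p q"
  shows "P \<in> Ob C" "p \<in> Ar C" "q \<in> Ar C" "Dom C p = P" "Dom C q = P" "Cod C p = X" "Cod C q = Y"
  using assms by (auto simp: is_product_def Hom_def)

lemma product_ex1:
  assumes "is_product C X Y P p q" "x \<in> Ar C" "y \<in> Ar C" "Dom C x = T" "Dom C y = T" "Cod C x = X" "Cod C y = Y"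
  shows "\<exists>!u. u \<in> Hom C T P \<and> p \<cdot> u = x \<and> q \<cdot> u = y"
proof -
  have mem: "T \<in> Ob C" "x \<in> Hom C T X" "y \<in> Hom C T Y"
    using assms(2-) by (auto simp: Hom_def)
  have all: "\<forall>T \<in> Ob C. \<forall>x \<in> Hom C T X. \<forall>y \<in> Hom C T Y. \<exists>!u. u \<in> Hom C T P \<and> p \<cdot> u = x \<and> q \<cdot> u = y"
    using assms(1) unfolding is_product_def by (elim conjE)
  show ?thesis by (rule bspec[OF bspec[OF bspec[OF all mem(1)] mem(2)] mem(3)])
qed

lemma product_lift:
  assumes "is_product C X Y P p q" "x \<in> Ar C" "y \<in> Ar C" "Dom C x = T" "Dom C y = T" "Cod C x = X" "Cod C y = Y"
  obtains u where "u \<in> Ar C" "Dom C u = T" "Cod C u = P" "p \<cdot> u = x" "q \<cdot> u = y"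
proof -
  obtain u where "u \<in> Hom C T P" "p \<cdot> u = x" "q \<cdot> u = y"
    using product_ex1[OF assms] by (elim ex1E conjE)
  then show ?thesis using that[of u] by (simp add: Hom_def)
qed

lemma product_unique:
  assumes "is_product C X Y P p q" "u \<in> Ar C" "v \<in> Ar C" "Dom C u = Dom C v"
    "Cod C u = P" "Cod C v = P" "p \<cdot> u = p \<cdot> v" "q \<cdot> u = q \<cdot> v"
  shows "u = v"
proof -
  note pr = product_arrows[OF assms(1)]
  have "\<exists>!w. w \<in> Hom C (Dom C u) P \<and> p \<cdot> w = p \<cdot> u \<and> q \<cdot> w = q \<cdot> u"
    by (rule product_ex1[OF assms(1)]) (use assms(2-6) pr in simp_all)
  then show ?thesis
    by (rule ex1_same) (use assms(2-8) in \<open>simp_all add: Hom_def\<close>)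
qed

lemma split_monic:
  assumes "m \<in> Ar C" "r \<in> Ar C" "Dom C r = Cod C m" "r \<cdot> m = Ident C (Dom C m)"
  shows "monic C m"
proof (rule monicI[OF assms(1)])
  fix f g
  assume fg: "f \<in> Ar C" "g \<in> Ar C" "Cod C f = Dom C m" "Cod C g = Dom C m" "Dom C f = Dom C g"
    "m \<cdot> f = m \<cdot> g"
  have retract: "r \<cdot> (m \<cdot> h) = h" if "h \<in> Ar C" "Cod C h = Dom C m" for h
  proof -
    have "r \<cdot> (m \<cdot> h) = (r \<cdot> m) \<cdot> h" using that assms(1-3) by simp
    also have "\<dots> = h" unfolding assms(4) using that by simp
    finally show ?thesis .
  qed
  have "f = r \<cdot> (m \<cdot> f)" using retract[of f] fg by simp
  also have "\<dots> = g" unfolding fg(6) using retract[of g] fg by simp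
  finally show "f = g" .
qed

text \<open>
  The equations \<open>e \<cdot> f \<cdot> x = e \<cdot> g \<cdot> y\<close> and \<open>f \<cdot> x = g \<cdot> y\<close> say the same thing when \<open>e\<close> is monic, so the two
  squares have the same cones.  This lets a truth-value object be replaced by a subobject of it.
\<close>

lemma pullback_postcomp_monic:
  assumes e: "monic C e" and f: "f \<in> Ar C" "Cod C f = Dom C e" and g: "g \<in> Ar C" "Cod C g = Dom C e"
  shows "is_pullback C P p q (e \<cdot> f) (e \<cdot> g) \<longleftrightarrow> is_pullback C P p q f g"
proof -
  note [simp] = monic_arrow[OF e] f g
  have cancel: "(e \<cdot> f) \<cdot> x = (e \<cdot> g) \<cdot> y \<longleftrightarrow> f \<cdot> x = g \<cdot> y"
    if "x \<in> Hom C T (Dom C f)" "y \<in> Hom C T (Dom C g)" for T x y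
    using monic_cancel[OF e, of "f \<cdot> x" "g \<cdot> y"] that by (auto simp: Hom_def)
  show ?thesis
  proof
    assume pb: "is_pullback C P p q (e \<cdot> f) (e \<cdot> g)"
    note ar = pullback_arrows[OF pb, simplified]
    show "is_pullback C P p q f g"
    proof (rule is_pullbackI)
      show "f \<cdot> p = g \<cdot> q"
        using cancel[of p P q] ar pullback_arrows(11)[OF pb] by (simp add: Hom_def)
      fix x y
      assume xy: "x \<in> Ar C" "y \<in> Ar C" "Dom C x = Dom C y" "Cod C x = Dom C f" "Cod C y = Dom C g"
        "f \<cdot> x = g \<cdot> y"
      have "(e \<cdot> f) \<cdot> x = (e \<cdot> g) \<cdot> y" using cancel[of x "Dom C y" y] xy by (simp add: Hom_def)
      then obtain u where "u \<in> Ar C" "Dom C u = Dom C x" "Cod C u = P" "p \<cdot> u = x" "q \<cdot> u = y"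
        by (rule pullback_lift[OF pb xy(1-3), rotated 2]) (use xy in simp_all)
      then show "\<exists>u. u \<in> Ar C \<and> Dom C u = Dom C x \<and> Cod C u = P \<and> p \<cdot> u = x \<and> q \<cdot> u = y"
        by (intro exI[of _ u] conjI)
    next
      fix u v
      assume "u \<in> Ar C" "v \<in> Ar C" "Dom C u = Dom C v" "Cod C u = P" "Cod C v = P"
        "p \<cdot> u = p \<cdot> v" "q \<cdot> u = q \<cdot> v"
      then show "u = v" by (rule pullback_unique[OF pb])
    qed (use ar in simp_all)
  next
    assume pb: "is_pullback C P p q f g"
    note ar = pullback_arrows[OF pb]
    show "is_pullback C P p q (e \<cdot> f) (e \<cdot> g)"
    proof (rule is_pullbackI)
      show "(e \<cdot> f) \<cdot> p = (e \<cdot> g) \<cdot> q"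
        using cancel[of p P q] ar by (simp add: Hom_def)
      fix x y
      assume xy: "x \<in> Ar C" "y \<in> Ar C" "Dom C x = Dom C y" "Cod C x = Dom C (e \<cdot> f)" "Cod C y = Dom C (e \<cdot> g)"
        "(e \<cdot> f) \<cdot> x = (e \<cdot> g) \<cdot> y"
      have "f \<cdot> x = g \<cdot> y" using cancel[of x "Dom C y" y] xy by (simp add: Hom_def)
      then obtain u where "u \<in> Ar C" "Dom C u = Dom C x" "Cod C u = P" "p \<cdot> u = x" "q \<cdot> u = y"
        by (rule pullback_lift[OF pb xy(1-3), rotated 2]) (use xy in simp_all)
      then show "\<exists>u. u \<in> Ar C \<and> Dom C u = Dom C x \<and> Cod C u = P \<and> p \<cdot> u = x \<and> q \<cdot> u = y"
        by (intro exI[of _ u] conjI)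
    next
      fix u v
      assume "u \<in> Ar C" "v \<in> Ar C" "Dom C u = Dom C v" "Cod C u = P" "Cod C v = P"
        "p \<cdot> u = p \<cdot> v" "q \<cdot> u = q \<cdot> v"
      then show "u = v" by (rule pullback_unique[OF pb])
    qed (use ar in simp_all)
  qed
qed

lemma monic_if_comp_monic:
  assumes hu: "monic C (h \<cdot> u)" and h: "h \<in> Ar C" and u: "u \<in> Ar C" "Dom C h = Cod C u"
  shows "monic C u"
proof (rule monicI[OF u(1)])
  fix f g
  assume fg: "f \<in> Ar C" "g \<in> Ar C" "Cod C f = Dom C u" "Cod C g = Dom C u" "Dom C f = Dom C g" "u \<cdot> f = u \<cdot> g"
  then have "(h \<cdot> u) \<cdot> f = (h \<cdot> u) \<cdot> g" using h u by simp
  then show "f = g" by (intro monic_cancel[OF hu, of f g]) (use fg h u in simp_all)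
qed

lemma terminal_unique:
  assumes "is_terminal C t" "f \<in> Ar C" "g \<in> Ar C" "Dom C f = Dom C g" "Cod C f = t" "Cod C g = t"
  shows "f = g"
proof -
  have "\<exists>!h. h \<in> Hom C (Dom C f) t" using assms(1,2) by (simp add: is_terminal_def)
  then show ?thesis by (rule ex1_same) (use assms in \<open>simp_all add: Hom_def\<close>)
qed

end

section \<open>Chosen finite products\<close>

locale cartesian_category = category E for E :: "('o, 'm) cat" (structure) +
  fixes K :: "('o, 'm) cartesian"
  assumes cartesian: "cartesian_structure E K"
begin

abbreviation bang :: "'o \<Rightarrow> 'm" where
  "bang X \<equiv> to_terminal E (One K) X"

abbreviation tuple :: "'m \<Rightarrow> 'm \<Rightarrow> 'm" ("\<langle>_, _\<rangle>") where
  "\<langle>x, y\<rangle> \<equiv> pairing E K x y"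

abbreviation product_map :: "'m \<Rightarrow> 'm \<Rightarrow> 'm" (infixr "\<otimes>" 75) where
  "f \<otimes> g \<equiv> prod_map E K f g"

lemma One_Ob [simp]: "One K \<in> Ob E"
  using cartesian by (auto simp: cartesian_structure_def is_terminal_def)

lemma ex1_to_One: "X \<in> Ob E \<Longrightarrow> \<exists>!f. f \<in> Hom E X (One K)"
  using cartesian by (auto simp: cartesian_structure_def is_terminal_def)

lemma bang_arrow [simp]:
  assumes "X \<in> Ob E"
  shows "bang X \<in> Ar E" "Dom E (bang X) = X" "Cod E (bang X) = One K"
  using theI'[OF ex1_to_One[OF assms]] by (auto simp: to_terminal_def Hom_def)

lemma to_One_unique:
  "\<lbrakk>f \<in> Ar E; g \<in> Ar E; Cod E f = One K; Cod E g = One K; Dom E f = Dom E g\<rbrakk> \<Longrightarrow> f = g"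
  using ex1_to_One[of "Dom E f"] unfolding Hom_def by auto

lemma bang_comp [simp]: "\<lbrakk>f \<in> Ar E; Cod E f = X\<rbrakk> \<Longrightarrow> bang X \<cdot> f = bang (Dom E f)"
  by (rule to_One_unique) auto

lemma from_One_monic: "\<lbrakk>f \<in> Ar E; Dom E f = One K\<rbrakk> \<Longrightarrow> monic E f"
  by (rule monicI) (auto intro: to_One_unique)

lemma Prod_is_product:
  "\<lbrakk>X \<in> Ob E; Y \<in> Ob E\<rbrakk> \<Longrightarrow> is_product E X Y (Prod K X Y) (Fst K X Y) (Snd K X Y)"
  using cartesian by (auto simp: cartesian_structure_def)

lemma projections [simp]:
  assumes "X \<in> Ob E" "Y \<in> Ob E"
  shows "Prod K X Y \<in> Ob E"
    "Fst K X Y \<in> Ar E" "Dom E (Fst K X Y) = Prod K X Y" "Cod E (Fst K X Y) = X"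
    "Snd K X Y \<in> Ar E" "Dom E (Snd K X Y) = Prod K X Y" "Cod E (Snd K X Y) = Y"
  using Prod_is_product[OF assms] by (auto simp: is_product_def Hom_def)

lemma ex1_tuple:
  assumes "x \<in> Ar E" "y \<in> Ar E" "Dom E x = Dom E y"
  shows "\<exists>!u. u \<in> Hom E (Dom E x) (Prod K (Cod E x) (Cod E y)) \<and>
     Fst K (Cod E x) (Cod E y) \<cdot> u = x \<and> Snd K (Cod E x) (Cod E y) \<cdot> u = y"
  using Prod_is_product[of "Cod E x" "Cod E y"] assms by (auto simp: is_product_def Hom_def)

lemma tuple_arrow [simp]:
  assumes "x \<in> Ar E" "y \<in> Ar E" "Dom E x = Dom E y"
  shows "\<langle>x, y\<rangle> \<in> Ar E" "Dom E \<langle>x, y\<rangle> = Dom E y" "Cod E \<langle>x, y\<rangle> = Prod K (Cod E x) (Cod E y)"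
  using theI'[OF ex1_tuple[OF assms]] assms by (auto simp: pairing_def Hom_def)

lemma tuple_projections [simp]:
  assumes "x \<in> Ar E" "y \<in> Ar E" "Dom E x = Dom E y" "Cod E x = X" "Cod E y = Y"
  shows "Fst K X Y \<cdot> \<langle>x, y\<rangle> = x" "Snd K X Y \<cdot> \<langle>x, y\<rangle> = y"
  using theI'[OF ex1_tuple[OF assms(1-3)]] assms by (auto simp: pairing_def Hom_def)

lemma tuple_eqI:
  assumes "X \<in> Ob E" "Y \<in> Ob E" "u \<in> Ar E" "v \<in> Ar E" "Dom E u = Dom E v"
    "Cod E u = Prod K X Y" "Cod E v = Prod K X Y"
    "Fst K X Y \<cdot> u = Fst K X Y \<cdot> v" "Snd K X Y \<cdot> u = Snd K X Y \<cdot> v"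
  shows "u = v"
proof -
  have "\<exists>!w. w \<in> Hom E (Dom E u) (Prod K X Y) \<and>
      Fst K X Y \<cdot> w = Fst K X Y \<cdot> u \<and> Snd K X Y \<cdot> w = Snd K X Y \<cdot> u"
    using ex1_tuple[of "Fst K X Y \<cdot> u" "Snd K X Y \<cdot> u"] assms by simp
  then show ?thesis
    by (rule ex1_same) (use assms in \<open>simp_all add: Hom_def\<close>)
qed

lemma tuple_comp [simp]:
  assumes "x \<in> Ar E" "y \<in> Ar E" "Dom E x = Dom E y" "f \<in> Ar E" "Cod E f = Dom E y"
  shows "\<langle>x, y\<rangle> \<cdot> f = \<langle>x \<cdot> f, y \<cdot> f\<rangle>"
  by (rule tuple_eqI[of "Cod E x" "Cod E y"])
    (use assms in \<open>simp_all flip: comp_assoc_arrow\<close>)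

lemma tuple_eta:
  assumes "X \<in> Ob E" "Y \<in> Ob E" "u \<in> Ar E" "Cod E u = Prod K X Y"
  shows "u = \<langle>Fst K X Y \<cdot> u, Snd K X Y \<cdot> u\<rangle>"
  by (rule tuple_eqI[of X Y]) (use assms in simp_all)

lemma tuple_projections_ident: "\<lbrakk>X \<in> Ob E; Y \<in> Ob E\<rbrakk> \<Longrightarrow> \<langle>Fst K X Y, Snd K X Y\<rangle> = Ident E (Prod K X Y)"
  by (rule tuple_eqI[of X Y]) simp_all

lemma tuple_inject:
  assumes "\<langle>x, y\<rangle> = \<langle>x', y'\<rangle>" "x \<in> Ar E" "y \<in> Ar E" "Dom E x = Dom E y"
    "x' \<in> Ar E" "y' \<in> Ar E" "Dom E x' = Dom E y'" "Cod E x = Cod E x'" "Cod E y = Cod E y'"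
  shows "x = x' \<and> y = y'"
  using tuple_projections[of x y "Cod E x" "Cod E y"] tuple_projections[of x' y' "Cod E x" "Cod E y"]
    assms by metis

lemma prod_map_arrow [simp]:
  assumes "f \<in> Ar E" "g \<in> Ar E"
  shows "f \<otimes> g \<in> Ar E" "Dom E (f \<otimes> g) = Prod K (Dom E f) (Dom E g)"
    "Cod E (f \<otimes> g) = Prod K (Cod E f) (Cod E g)"
  using assms by (simp_all add: prod_map_def)

lemma prod_map_tuple [simp]:
  assumes "f \<in> Ar E" "g \<in> Ar E" "x \<in> Ar E" "y \<in> Ar E" "Dom E x = Dom E y"
    "Cod E x = Dom E f" "Cod E y = Dom E g"
  shows "(f \<otimes> g) \<cdot> \<langle>x, y\<rangle> = \<langle>f \<cdot> x, g \<cdot> y\<rangle>"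
  using assms by (simp add: prod_map_def)

lemma prod_map_comp [simp]:
  assumes "f \<in> Ar E" "g \<in> Ar E" "h \<in> Ar E" "k \<in> Ar E" "Cod E h = Dom E f" "Cod E k = Dom E g"
  shows "(f \<otimes> g) \<cdot> (h \<otimes> k) = (f \<cdot> h) \<otimes> (g \<cdot> k)"
  using assms by (simp add: prod_map_def)

lemma prod_map_monic:
  assumes "monic E f" "monic E g"
  shows "monic E (f \<otimes> g)"
proof (rule monicI)
  note ar [simp] = monic_arrow[OF assms(1)] monic_arrow[OF assms(2)]
  let ?p = "Fst K (Dom E f) (Dom E g)" and ?q = "Snd K (Dom E f) (Dom E g)"
  show "f \<otimes> g \<in> Ar E" by simp
  fix u v
  assume uv: "u \<in> Ar E" "v \<in> Ar E" "Cod E u = Dom E (f \<otimes> g)" "Cod E v = Dom E (f \<otimes> g)"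
    "Dom E u = Dom E v" "(f \<otimes> g) \<cdot> u = (f \<otimes> g) \<cdot> v"
  have "\<langle>f \<cdot> (?p \<cdot> u), g \<cdot> (?q \<cdot> u)\<rangle> = \<langle>f \<cdot> (?p \<cdot> v), g \<cdot> (?q \<cdot> v)\<rangle>"
    using uv by (simp add: prod_map_def)
  then have "f \<cdot> (?p \<cdot> u) = f \<cdot> (?p \<cdot> v) \<and> g \<cdot> (?q \<cdot> u) = g \<cdot> (?q \<cdot> v)"
    by (rule tuple_inject) (use uv in simp_all)
  then have "?p \<cdot> u = ?p \<cdot> v" "?q \<cdot> u = ?q \<cdot> v"
    using uv by (auto intro: monic_cancel[OF assms(1)] monic_cancel[OF assms(2)])
  then show "u = v"
    by (intro tuple_eqI[of "Dom E f" "Dom E g" u v]) (use uv in simp_all)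
qed

lemma tuple_monic_left:
  assumes "monic E x" "y \<in> Ar E" "Dom E x = Dom E y"
  shows "monic E \<langle>x, y\<rangle>"
proof (rule monicI)
  note ar [simp] = monic_arrow[OF assms(1)] assms(2,3)
  show "\<langle>x, y\<rangle> \<in> Ar E" by simp
  fix u v
  assume uv: "u \<in> Ar E" "v \<in> Ar E" "Cod E u = Dom E \<langle>x, y\<rangle>" "Cod E v = Dom E \<langle>x, y\<rangle>"
    "Dom E u = Dom E v" "\<langle>x, y\<rangle> \<cdot> u = \<langle>x, y\<rangle> \<cdot> v"
  then have "\<langle>x \<cdot> u, y \<cdot> u\<rangle> = \<langle>x \<cdot> v, y \<cdot> v\<rangle>" by simp
  then have "x \<cdot> u = x \<cdot> v \<and> y \<cdot> u = y \<cdot> v"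
    by (rule tuple_inject) (use uv in simp_all)
  then show "u = v"
    using uv by (auto intro: monic_cancel[OF assms(1)])
qed

lemma ident_monic: "X \<in> Ob E \<Longrightarrow> monic E (Ident E X)"
  by (rule monicI) auto

abbreviation swap :: "'o \<Rightarrow> 'o \<Rightarrow> 'm" where
  "swap X Y \<equiv> \<langle>Snd K X Y, Fst K X Y\<rangle>"

lemma swap_swap: "\<lbrakk>X \<in> Ob E; Y \<in> Ob E\<rbrakk> \<Longrightarrow> swap X Y \<cdot> swap Y X = Ident E (Prod K Y X)"
  by (simp add: tuple_projections_ident)

lemma swap_monic:
  assumes [simp]: "X \<in> Ob E" "Y \<in> Ob E"
  shows "monic E (swap X Y)"
proof (rule monicI)
  fix u v
  assume uv: "u \<in> Ar E" "v \<in> Ar E" "Cod E u = Dom E (swap X Y)" "Cod E v = Dom E (swap X Y)"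
    "Dom E u = Dom E v" "swap X Y \<cdot> u = swap X Y \<cdot> v"
  have "Snd K X Y \<cdot> u = Snd K X Y \<cdot> v \<and> Fst K X Y \<cdot> u = Fst K X Y \<cdot> v"
    by (rule tuple_inject) (use uv in simp_all)
  then show "u = v"
    by (intro tuple_eqI[of X Y u v]) (use uv in simp_all)
qed simp

lemma tuple_projections_comp [simp]:
  "\<lbrakk>X \<in> Ob E; Y \<in> Ob E; u \<in> Ar E; Cod E u = Prod K X Y\<rbrakk> \<Longrightarrow> \<langle>Fst K X Y \<cdot> u, Snd K X Y \<cdot> u\<rangle> = u"
  by (rule tuple_eta[symmetric])

text \<open>
  A comparison of two ways to say that \<open>i \<cdot> h\<close> is the transpose of \<open>g\<close>: through an arbitrary product
  \<open>P\<close> of the exponential \<open>X\<close> with \<open>A\<close>, and through the chosen product of an object \<open>R\<close> with \<open>A\<close>, where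
  \<open>i : R \<rightarrow> X\<close>.  The morphism \<open>u\<close> on the left is forced to be \<open>w \<cdot> \<langle>h \<cdot> r, s\<rangle>\<close> by its two projections.
  With \<open>i\<close> an identity this gives exponentials with chosen products; with \<open>i\<close> a coreflection it gives
  exponentials in a coreflective subcategory.
\<close>

lemma exponential_comparison:
  assumes P: "is_product E X A P p q"
    and i: "i \<in> Ar E" "Dom E i = R" "Cod E i = X"
    and w: "w \<in> Ar E" "Dom E w = Prod K R A" "Cod E w = P" "p \<cdot> w = i \<cdot> Fst K R A" "q \<cdot> w = Snd K R A"
    and h: "h \<in> Ar E" "Dom E h = Z" "Cod E h = R"
    and rs: "r \<in> Ar E" "s \<in> Ar E" "Dom E r = Q" "Dom E s = Q" "Cod E r = Z" "Cod E s = A"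
  shows "(\<exists>u \<in> Hom E Q P. p \<cdot> u = (i \<cdot> h) \<cdot> r \<and> q \<cdot> u = s \<and> ev \<cdot> u = g) \<longleftrightarrow>
    ev \<cdot> (w \<cdot> \<langle>h \<cdot> r, s\<rangle>) = g"
proof -
  note pr = product_arrows[OF P]
  have Ob: "R \<in> Ob E" "A \<in> Ob E" using arrow_ends i rs by auto
  have pw: "p \<cdot> (w \<cdot> \<langle>h \<cdot> r, s\<rangle>) = (i \<cdot> h) \<cdot> r"
    using comp_eq_precomp[OF w(4), of "\<langle>h \<cdot> r, s\<rangle>"] i h rs w(1-3) pr Ob by simp
  have qw: "q \<cdot> (w \<cdot> \<langle>h \<cdot> r, s\<rangle>) = s"
    using comp_assoc_arrow[of "\<langle>h \<cdot> r, s\<rangle>" w q] i h rs w pr Ob by simp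
  have wmem: "w \<cdot> \<langle>h \<cdot> r, s\<rangle> \<in> Hom E Q P"
    using i h rs w(1-3) pr Ob by (simp add: Hom_def)
  show ?thesis
  proof
    assume "\<exists>u \<in> Hom E Q P. p \<cdot> u = (i \<cdot> h) \<cdot> r \<and> q \<cdot> u = s \<and> ev \<cdot> u = g"
    then obtain u where u: "u \<in> Hom E Q P" "p \<cdot> u = (i \<cdot> h) \<cdot> r" "q \<cdot> u = s" "ev \<cdot> u = g" by auto
    have "u = w \<cdot> \<langle>h \<cdot> r, s\<rangle>"
    proof (rule product_unique[OF P])
      show "p \<cdot> u = p \<cdot> (w \<cdot> \<langle>h \<cdot> r, s\<rangle>)" using u(2) pw by (rule trans[OF _ sym])
      show "q \<cdot> u = q \<cdot> (w \<cdot> \<langle>h \<cdot> r, s\<rangle>)" using u(3) qw by (rule trans[OF _ sym])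
    qed (use u(1) wmem in \<open>simp_all add: Hom_def\<close>)
    then show "ev \<cdot> (w \<cdot> \<langle>h \<cdot> r, s\<rangle>) = g" using u(4) by (rule subst)
  next
    assume "ev \<cdot> (w \<cdot> \<langle>h \<cdot> r, s\<rangle>) = g"
    then show "\<exists>u \<in> Hom E Q P. p \<cdot> u = (i \<cdot> h) \<cdot> r \<and> q \<cdot> u = s \<and> ev \<cdot> u = g"
      by (intro bexI[OF _ wmem] conjI pw qw)
  qed
qed

definition jointly_epic :: "'m set \<Rightarrow> 'o \<Rightarrow> bool" where
  "jointly_epic S A \<longleftrightarrow> A \<in> Ob E \<and> (\<forall>s \<in> S. s \<in> Ar E \<and> Cod E s = A) \<and>
     (\<forall>f \<in> Ar E. \<forall>g \<in> Ar E. Dom E f = A \<and> Dom E g = A \<and> Cod E f = Cod E g \<and> (\<forall>s \<in> S. f \<cdot> s = g \<cdot> s)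
        \<longrightarrow> f = g)"

lemma jointly_epicD:
  assumes "jointly_epic S A"
  shows "A \<in> Ob E" "s \<in> S \<Longrightarrow> s \<in> Ar E" "s \<in> S \<Longrightarrow> Cod E s = A"
  using assms by (auto simp: jointly_epic_def)

lemma jointly_epic_eq:
  assumes "jointly_epic S A" "f \<in> Ar E" "g \<in> Ar E" "Dom E f = A" "Dom E g = A" "Cod E f = Cod E g"
    "\<And>s. s \<in> S \<Longrightarrow> f \<cdot> s = g \<cdot> s"
  shows "f = g"
  using assms unfolding jointly_epic_def by blast

lemma jointly_epicI:
  assumes "A \<in> Ob E" "\<And>s. s \<in> S \<Longrightarrow> s \<in> Ar E \<and> Cod E s = A"
    "\<And>f g. \<lbrakk>f \<in> Ar E; g \<in> Ar E; Dom E f = A; Dom E g = A; Cod E f = Cod E g;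
      \<And>s. s \<in> S \<Longrightarrow> f \<cdot> s = g \<cdot> s\<rbrakk> \<Longrightarrow> f = g"
  shows "jointly_epic S A"
  unfolding jointly_epic_def using assms by blast

end

section \<open>Truth values and the semilattice of truth values\<close>

locale topos = cartesian_category E K
  for E :: "('o, 'm) cat" (structure) and K :: "('o, 'm) cartesian" +
  fixes \<Omega> :: 'o and tru :: 'm
  assumes elementary_topos: "elementary_topos E"
    and classifier: "subobject_classifier E (One K) \<Omega> tru"
begin

abbreviation true_at :: "'o \<Rightarrow> 'm" where
  "true_at X \<equiv> tru \<cdot> bang X"

abbreviation classifies :: "'m \<Rightarrow> 'm \<Rightarrow> bool" where
  "classifies \<chi> m \<equiv> is_characteristic E (One K) \<Omega> tru m \<chi>"

lemma pullback_exists: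
  assumes "f \<in> Ar E" "g \<in> Ar E" "Cod E f = Cod E g"
  obtains P p q where "is_pullback E P p q f g"
  using elementary_topos assms unfolding elementary_topos_def finitely_complete_def by blast

lemma tru_arrow [simp]: "tru \<in> Ar E" "Dom E tru = One K" "Cod E tru = \<Omega>" "\<Omega> \<in> Ob E"
  using classifier by (auto simp: subobject_classifier_def Hom_def)

lemma classifies_arrow:
  assumes "classifies \<chi> m"
  shows "\<chi> \<in> Ar E" "Dom E \<chi> = Cod E m" "Cod E \<chi> = \<Omega>"
  using assms by (auto simp: is_characteristic_def Hom_def)

lemma ex1_classifies: "monic E m \<Longrightarrow> \<exists>!\<chi>. classifies \<chi> m"
  using classifier by (auto simp: subobject_classifier_def)

lemma classifies_characteristic:
  "monic E m \<Longrightarrow> classifies (characteristic E (One K) \<Omega> tru m) m"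
  unfolding characteristic_def by (rule theI'[OF ex1_classifies])

lemma classifies_unique: "\<lbrakk>monic E m; classifies \<chi> m; classifies \<chi>' m\<rbrakk> \<Longrightarrow> \<chi> = \<chi>'"
  using ex1_classifies by blast

lemma characteristic_eq:
  "\<lbrakk>monic E m; classifies \<chi> m\<rbrakk> \<Longrightarrow> characteristic E (One K) \<Omega> tru m = \<chi>"
  using classifies_unique classifies_characteristic by blast

text \<open>
  The pullback property of a characteristic morphism, read on generalized elements: an element lies
  in the subobject exactly when its truth value is \<open>true\<close>.
\<close>

lemma classifies_iff:
  assumes "classifies \<chi> m" "monic E m" "x \<in> Ar E" "Cod E x = Cod E m"
  shows "\<chi> \<cdot> x = true_at (Dom E x) \<longleftrightarrow> factors_through E x m"
proof
  note [simp] = classifies_arrow[OF assms(1)] monic_arrow[OF assms(2)]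
  have pb: "is_pullback E (Dom E m) m (bang (Dom E m)) \<chi> tru"
    using assms(1) by (simp add: is_characteristic_def)
  {
    assume "\<chi> \<cdot> x = true_at (Dom E x)"
    then obtain u where "u \<in> Ar E" "Dom E u = Dom E x" "Cod E u = Dom E m" "m \<cdot> u = x"
      using assms(3,4) pullback_lift[OF pb, of x "bang (Dom E x)"] by simp blast
    then show "factors_through E x m" by (rule factors_throughI)
  next
    assume "factors_through E x m"
    then obtain u where u: "u \<in> Ar E" "Dom E u = Dom E x" "Cod E u = Dom E m" "m \<cdot> u = x"
      by (rule factors_throughE)
    have "\<chi> \<cdot> (m \<cdot> u) = tru \<cdot> (bang (Dom E m) \<cdot> u)"
      by (rule comp_eq_precomp[OF pullback_arrows(11)[OF pb]]) (use u in auto)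
    then show "\<chi> \<cdot> x = true_at (Dom E x)" using u by simp
  }
qed

lemma classifiesI:
  assumes m: "monic E m" and chi [simp]: "\<chi> \<in> Ar E" "Dom E \<chi> = Cod E m" "Cod E \<chi> = \<Omega>"
    and iff: "\<And>x. \<lbrakk>x \<in> Ar E; Cod E x = Cod E m\<rbrakk> \<Longrightarrow>
      \<chi> \<cdot> x = true_at (Dom E x) \<longleftrightarrow> factors_through E x m"
  shows "classifies \<chi> m"
proof -
  note [simp] = monic_arrow[OF m]
  have "is_pullback E (Dom E m) m (bang (Dom E m)) \<chi> tru"
  proof (rule is_pullbackI)
    show "\<chi> \<cdot> m = true_at (Dom E m)"
      using iff[of m] factors_through_self[of m] by simp
  next
    fix x y
    assume xy: "x \<in> Ar E" "y \<in> Ar E" "Dom E x = Dom E y" "Cod E x = Dom E \<chi>" "Cod E y = Dom E tru"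
      "\<chi> \<cdot> x = tru \<cdot> y"
    then have y: "y = bang (Dom E x)" by (intro to_One_unique) auto
    then have "factors_through E x m" using iff[of x] xy by simp
    then obtain u where "u \<in> Ar E" "Dom E u = Dom E x" "Cod E u = Dom E m" "m \<cdot> u = x"
      by (rule factors_throughE)
    then show "\<exists>u. u \<in> Ar E \<and> Dom E u = Dom E x \<and> Cod E u = Dom E m \<and> m \<cdot> u = x \<and> bang (Dom E m) \<cdot> u = y"
      using y by (intro exI[of _ u]) simp
  next
    fix u v
    assume "u \<in> Ar E" "v \<in> Ar E" "Dom E u = Dom E v" "Cod E u = Dom E m" "Cod E v = Dom E m"
      "m \<cdot> u = m \<cdot> v"
    then show "u = v" by (intro monic_cancel[OF m, of u v]) simp_all
  qed auto
  then show ?thesis by (simp add: is_characteristic_def Hom_def)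
qed

lemma classified_exists:
  assumes "\<chi> \<in> Ar E" "Cod E \<chi> = \<Omega>"
  obtains m where "monic E m" "Cod E m = Dom E \<chi>" "classifies \<chi> m"
proof -
  obtain P m q where pb: "is_pullback E P m q \<chi> tru"
    using pullback_exists[of \<chi> tru] assms by auto
  note ar = pullback_arrows[OF pb]
  have m: "monic E m" by (rule pullback_monic[OF pb from_One_monic]) auto
  have "q = bang P" by (rule to_One_unique) (use ar in auto)
  then have "classifies \<chi> m"
    using pb ar assms by (simp add: is_characteristic_def Hom_def)
  then show ?thesis using that m ar by metis
qed

text \<open>
  A morphism into \<open>\<Omega>\<close> is determined by the generalized elements that it sends to \<open>true\<close>: both
  morphisms then classify the same subobject.  All identities between morphisms into \<open>\<Omega>\<close> below
  are reduced to equivalences by this principle.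
\<close>

lemma omega_eqI:
  assumes "f \<in> Ar E" "g \<in> Ar E" "Dom E f = Dom E g" "Cod E f = \<Omega>" "Cod E g = \<Omega>"
    and iff: "\<And>x. \<lbrakk>x \<in> Ar E; Cod E x = Dom E f\<rbrakk> \<Longrightarrow>
      f \<cdot> x = true_at (Dom E x) \<longleftrightarrow> g \<cdot> x = true_at (Dom E x)"
  shows "f = g"
proof -
  obtain m where m: "monic E m" "Cod E m = Dom E f" "classifies f m"
    using classified_exists assms by metis
  have "classifies g m"
    by (rule classifiesI) (use m assms in \<open>auto simp: classifies_iff[symmetric]\<close>)
  then show ?thesis using classifies_unique m by blast
qed

lemma omega_eqI_pairs:
  assumes "f \<in> Ar E" "g \<in> Ar E" "Dom E f = Prod K X Y" "Dom E g = Prod K X Y"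
    "Cod E f = \<Omega>" "Cod E g = \<Omega>" and X: "X \<in> Ob E" and Y: "Y \<in> Ob E"
    and iff: "\<And>a b T. \<lbrakk>T \<in> Ob E; a \<in> Ar E; b \<in> Ar E; Dom E a = T; Dom E b = T; Cod E a = X; Cod E b = Y\<rbrakk> \<Longrightarrow>
      f \<cdot> \<langle>a, b\<rangle> = true_at T \<longleftrightarrow> g \<cdot> \<langle>a, b\<rangle> = true_at T"
  shows "f = g"
proof (rule omega_eqI)
  fix x assume x: "x \<in> Ar E" "Cod E x = Dom E f"
  then have x': "Cod E x = Prod K X Y" using assms by simp
  have "f \<cdot> \<langle>Fst K X Y \<cdot> x, Snd K X Y \<cdot> x\<rangle> = true_at (Dom E x) \<longleftrightarrow>
      g \<cdot> \<langle>Fst K X Y \<cdot> x, Snd K X Y \<cdot> x\<rangle> = true_at (Dom E x)"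
    using x(1) x' X Y by (intro iff) simp_all
  then show "f \<cdot> x = true_at (Dom E x) \<longleftrightarrow> g \<cdot> x = true_at (Dom E x)"
    unfolding tuple_eta[OF X Y x(1) x', symmetric] .
qed (use assms in simp_all)

lemma subobject_rel_iff_characteristic:
  assumes "monic E k" "monic E l" "Cod E k = Cod E l"
  shows "(k, l) \<in> subobject_rel E \<longleftrightarrow>
    characteristic E (One K) \<Omega> tru k = characteristic E (One K) \<Omega> tru l"
proof
  note ck = classifies_characteristic[OF assms(1)] and cl = classifies_characteristic[OF assms(2)]
  note [simp] = monic_arrow[OF assms(1)] monic_arrow[OF assms(2)]
  {
    assume "(k, l) \<in> subobject_rel E"
    then have "factors_through E k l" "factors_through E l k"
      by (auto simp: subobject_rel_def)
    then have "factors_through E x k \<longleftrightarrow> factors_through E x l" for x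
      using factors_through_trans[of x] by auto
    then show "characteristic E (One K) \<Omega> tru k = characteristic E (One K) \<Omega> tru l"
      using classifies_iff[OF ck assms(1)] classifies_iff[OF cl assms(2)]
        classifies_arrow[OF ck] classifies_arrow[OF cl] assms(3)
      by (intro omega_eqI) auto
  next
    assume eq: "characteristic E (One K) \<Omega> tru k = characteristic E (One K) \<Omega> tru l"
    then have "factors_through E x k \<longleftrightarrow> factors_through E x l"
      if "x \<in> Ar E" "Cod E x = Cod E k" for x
      using classifies_iff[OF ck assms(1)] classifies_iff[OF cl assms(2)] that assms(3) by auto
    from this[of k] this[of l] show "(k, l) \<in> subobject_rel E"
      using assms factors_through_self by (auto simp: subobject_rel_def)
  }
qed

definition omega_meet :: 'm where
  "omega_meet = characteristic E (One K) \<Omega> tru (tru \<otimes> tru)"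

lemma classifies_omega_meet: "classifies omega_meet (tru \<otimes> tru)"
  unfolding omega_meet_def by (intro classifies_characteristic prod_map_monic from_One_monic) auto

lemma omega_meet_arrow [simp]:
  "omega_meet \<in> Ar E" "Dom E omega_meet = Prod K \<Omega> \<Omega>" "Cod E omega_meet = \<Omega>"
  using classifies_arrow[OF classifies_omega_meet] by auto

text \<open>
  Through this equivalence the semilattice laws of \<open>\<Omega>\<close>, and the preservation of meets by maps into
  \<open>\<Omega>\<close>, become laws of conjunction.
\<close>

lemma omega_meet_true_iff:
  assumes "x \<in> Ar E" "y \<in> Ar E" "Dom E x = Dom E y" "Cod E x = \<Omega>" "Cod E y = \<Omega>" "Dom E y = X"
  shows "omega_meet \<cdot> \<langle>x, y\<rangle> = true_at X \<longleftrightarrow> x = true_at X \<and> y = true_at X"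
proof -
  have [simp]: "X \<in> Ob E" using assms by auto
  have "monic E (tru \<otimes> tru)" by (intro prod_map_monic from_One_monic) auto
  from classifies_iff[OF classifies_omega_meet this, of "\<langle>x, y\<rangle>"]
  have "omega_meet \<cdot> \<langle>x, y\<rangle> = true_at X \<longleftrightarrow> factors_through E \<langle>x, y\<rangle> (tru \<otimes> tru)"
    using assms by simp
  also have "\<dots> \<longleftrightarrow> x = true_at X \<and> y = true_at X"
  proof
    assume "factors_through E \<langle>x, y\<rangle> (tru \<otimes> tru)"
    then obtain u where "u \<in> Ar E" "Dom E u = Dom E \<langle>x, y\<rangle>" "Cod E u = Dom E (tru \<otimes> tru)"
      and teq: "(tru \<otimes> tru) \<cdot> u = \<langle>x, y\<rangle>"
      by (rule factors_throughE)
    then have u: "u \<in> Ar E" "Dom E u = X" "Cod E u = Prod K (One K) (One K)"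
      using assms by simp_all
    have "\<langle>Fst K (One K) (One K) \<cdot> u, Snd K (One K) (One K) \<cdot> u\<rangle> = \<langle>bang X, bang X\<rangle>"
      by (rule tuple_eqI[of "One K" "One K"]) (use u in \<open>auto intro!: to_One_unique\<close>)
    then have "u = \<langle>bang X, bang X\<rangle>"
      using tuple_eta[of "One K" "One K" u] u by simp
    with teq have "\<langle>true_at X, true_at X\<rangle> = \<langle>x, y\<rangle>" by simp
    then have "true_at X = x \<and> true_at X = y"
      by (rule tuple_inject) (use assms in auto)
    then show "x = true_at X \<and> y = true_at X" by metis
  next
    assume "x = true_at X \<and> y = true_at X"
    then show "factors_through E \<langle>x, y\<rangle> (tru \<otimes> tru)"
      using \<open>X \<in> Ob E\<close> by (intro factors_throughI[of "\<langle>bang X, bang X\<rangle>"]) auto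
  qed
  finally show ?thesis .
qed

lemma Omega_is_semilattice: "internal_semilattice E K (Omega_semilattice E K \<Omega> tru)"
proof -
  have 1: "omega_meet \<cdot> \<langle>x, true_at X\<rangle> = x" if "X \<in> Ob E" "x \<in> Ar E" "Dom E x = X" "Cod E x = \<Omega>" for x X
    by (rule omega_eqI) (use that in \<open>simp_all add: omega_meet_true_iff\<close>)
  have 2: "omega_meet \<cdot> \<langle>x, x\<rangle> = x" if "X \<in> Ob E" "x \<in> Ar E" "Dom E x = X" "Cod E x = \<Omega>" for x X
    by (rule omega_eqI) (use that in \<open>simp_all add: omega_meet_true_iff\<close>)
  have 3: "omega_meet \<cdot> \<langle>x, y\<rangle> = omega_meet \<cdot> \<langle>y, x\<rangle>"
    if "X \<in> Ob E" "x \<in> Ar E" "Dom E x = X" "Cod E x = \<Omega>" "y \<in> Ar E" "Dom E y = X" "Cod E y = \<Omega>" for x y X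
    by (rule omega_eqI) (use that in \<open>simp_all add: omega_meet_true_iff conj_ac\<close>)
  have 4: "omega_meet \<cdot> \<langle>true_at X, x\<rangle> = x" if "X \<in> Ob E" "x \<in> Ar E" "Dom E x = X" "Cod E x = \<Omega>" for x X
    by (rule omega_eqI) (use that in \<open>simp_all add: omega_meet_true_iff conj_ac\<close>)
  have 5: "omega_meet \<cdot> \<langle>omega_meet \<cdot> \<langle>x, y\<rangle>, z\<rangle> = omega_meet \<cdot> \<langle>x, omega_meet \<cdot> \<langle>y, z\<rangle>\<rangle>"
    if "X \<in> Ob E" "x \<in> Ar E" "Dom E x = X" "Cod E x = \<Omega>" "y \<in> Ar E" "Dom E y = X" "Cod E y = \<Omega>"
      "z \<in> Ar E" "Dom E z = X" "Cod E z = \<Omega>" for x y z X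
    by (rule omega_eqI) (use that in \<open>simp_all add: omega_meet_true_iff conj_ac\<close>)
  show ?thesis
    unfolding internal_semilattice_def Omega_semilattice_def Let_def omega_meet_def[symmetric] semilat.simps
  proof (intro conjI ballI)
  qed (simp_all add: Hom_def 1 2 4 5, rule 3, simp_all)
qed

lemma pullback_tuple_monic:
  assumes pb: "is_pullback E P p q f g"
  shows "monic E \<langle>p, q\<rangle>"
proof (rule monicI)
  note [simp] = pullback_arrows(1-10)[OF pb]
  show "\<langle>p, q\<rangle> \<in> Ar E" by simp
  fix u v
  assume uv: "u \<in> Ar E" "v \<in> Ar E" "Cod E u = Dom E \<langle>p, q\<rangle>" "Cod E v = Dom E \<langle>p, q\<rangle>"
    "Dom E u = Dom E v" "\<langle>p, q\<rangle> \<cdot> u = \<langle>p, q\<rangle> \<cdot> v"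
  then have "\<langle>p \<cdot> u, q \<cdot> u\<rangle> = \<langle>p \<cdot> v, q \<cdot> v\<rangle>" by simp
  then have "p \<cdot> u = p \<cdot> v \<and> q \<cdot> u = q \<cdot> v"
    by (rule tuple_inject) (use uv in simp_all)
  then show "u = v"
    by (intro pullback_unique[OF pb, of u v]) (use uv in simp_all)
qed

text \<open>
  The kernel pair of \<open>m\<close> is a subobject of \<open>Dom m \<times> Dom m\<close> and hence lies in the class.  So its two
  projections, which \<open>m\<close> equalizes, agree, and \<open>m\<close> is monic.  This has two uses: monomorphisms of
  the full subcategory on the class are monomorphisms of \<open>E\<close>, and the counit of a hyperconnected
  geometric morphism is monic because maps from the class factor through it uniquely.
\<close>

lemma monic_if_monic_on_class:
  assumes sub: "\<And>m. \<lbrakk>monic E m; Cod E m \<in> Q\<rbrakk> \<Longrightarrow> Dom E m \<in> Q"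
    and prod: "\<And>X Y. \<lbrakk>X \<in> Q; Y \<in> Q\<rbrakk> \<Longrightarrow> Prod K X Y \<in> Q"
    and m [simp]: "m \<in> Ar E" "Dom E m \<in> Q"
    and cancel: "\<And>f g. \<lbrakk>f \<in> Ar E; g \<in> Ar E; Dom E f \<in> Q; Dom E f = Dom E g; Cod E f = Dom E m;
      Cod E g = Dom E m; m \<cdot> f = m \<cdot> g\<rbrakk> \<Longrightarrow> f = g"
  shows "monic E m"
proof (rule monicI)
  obtain P p q where pb: "is_pullback E P p q m m" using pullback_exists[of m m] by auto
  note ar = pullback_arrows[OF pb]
  have "P \<in> Q" using sub[OF pullback_tuple_monic[OF pb]] prod[of "Dom E m" "Dom E m"] ar by simp
  then have pq: "p = q" using ar by (intro cancel[of p q]) simp_all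
  fix f g
  assume fg: "f \<in> Ar E" "g \<in> Ar E" "Cod E f = Dom E m" "Cod E g = Dom E m" "Dom E f = Dom E g"
    "m \<cdot> f = m \<cdot> g"
  then obtain u where "p \<cdot> u = f" "q \<cdot> u = g"
    using pullback_lift[OF pb, of f g] by metis
  then show "f = g" using pq by simp
qed simp

end

section \<open>Internal filters and semilattice homomorphisms into the truth values\<close>

context topos
begin

lemma semilattice_arrows:
  assumes "internal_semilattice E K A"
  shows "Carrier A \<in> Ob E" "Top A \<in> Ar E" "Dom E (Top A) = One K" "Cod E (Top A) = Carrier A"
    "Meet A \<in> Ar E" "Dom E (Meet A) = Prod K (Carrier A) (Carrier A)" "Cod E (Meet A) = Carrier A"
  using assms by (auto simp: internal_semilattice_def Hom_def)

lemma semilattice_laws: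
  assumes "internal_semilattice E K A" "x \<in> Ar E" "y \<in> Ar E" "z \<in> Ar E"
    "Dom E x = X" "Dom E y = X" "Dom E z = X"
    "Cod E x = Carrier A" "Cod E y = Carrier A" "Cod E z = Carrier A"
  shows "Meet A \<cdot> \<langle>Meet A \<cdot> \<langle>x, y\<rangle>, z\<rangle> = Meet A \<cdot> \<langle>x, Meet A \<cdot> \<langle>y, z\<rangle>\<rangle>"
    "Meet A \<cdot> \<langle>x, y\<rangle> = Meet A \<cdot> \<langle>y, x\<rangle>"
    "Meet A \<cdot> \<langle>x, x\<rangle> = x"
proof -
  have X: "X \<in> Ob E" and mem: "x \<in> Hom E X (Carrier A)" "y \<in> Hom E X (Carrier A)" "z \<in> Hom E X (Carrier A)"
    using assms(2-) by (auto simp: Hom_def)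
  have laws:
    "\<forall>x \<in> Hom E X (Carrier A). \<forall>y \<in> Hom E X (Carrier A). \<forall>z \<in> Hom E X (Carrier A).
      Meet A \<cdot> \<langle>Meet A \<cdot> \<langle>x, y\<rangle>, z\<rangle> = Meet A \<cdot> \<langle>x, Meet A \<cdot> \<langle>y, z\<rangle>\<rangle>"
    "\<forall>x \<in> Hom E X (Carrier A). \<forall>y \<in> Hom E X (Carrier A). Meet A \<cdot> \<langle>x, y\<rangle> = Meet A \<cdot> \<langle>y, x\<rangle>"
    "\<forall>x \<in> Hom E X (Carrier A). Meet A \<cdot> \<langle>x, x\<rangle> = x"
    using assms(1) X unfolding internal_semilattice_def Let_def by blast+
  show "Meet A \<cdot> \<langle>Meet A \<cdot> \<langle>x, y\<rangle>, z\<rangle> = Meet A \<cdot> \<langle>x, Meet A \<cdot> \<langle>y, z\<rangle>\<rangle>"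
    by (rule bspec[OF bspec[OF bspec[OF laws(1) mem(1)] mem(2)] mem(3)])
  show "Meet A \<cdot> \<langle>x, y\<rangle> = Meet A \<cdot> \<langle>y, x\<rangle>"
    by (rule bspec[OF bspec[OF laws(2) mem(1)] mem(2)])
  show "Meet A \<cdot> \<langle>x, x\<rangle> = x"
    by (rule bspec[OF laws(3) mem(1)])
qed

text \<open>
  From left to right, \<open>x \<and> y \<le> x\<close> and \<open>x \<and> y \<le> y\<close> are combined with upward closure.  The equivalence
  is the form in which filters are compared with homomorphisms into \<open>\<Omega>\<close>.
\<close>

lemma filter_meet_iff:
  assumes F: "internal_filter E K A k" and x: "x \<in> Ar E" "Cod E x = Carrier A"
    and y: "y \<in> Ar E" "Cod E y = Carrier A" and xy: "Dom E x = Dom E y"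
  shows "factors_through E (Meet A \<cdot> \<langle>x, y\<rangle>) k \<longleftrightarrow> factors_through E x k \<and> factors_through E y k"
proof -
  have A: "internal_semilattice E K A" and k: "monic E k" and [simp]: "Cod E k = Carrier A"
    and meet: "factors_through E (Meet A \<cdot> (k \<otimes> k)) k"
    using F by (auto simp: internal_filter_def)
  note [simp] = semilattice_arrows[OF A] monic_arrow[OF k] x y xy
  have up: "factors_through E b k"
    if a: "factors_through E a k" "a \<in> Ar E" "b \<in> Ar E" "Dom E a = Dom E b" "Cod E b = Carrier A"
      "Meet A \<cdot> \<langle>a, b\<rangle> = a" for a b
  proof -
    obtain u where u: "u \<in> Ar E" "Dom E u = Dom E a" "Cod E u = Dom E k" and a_eq: "k \<cdot> u = a"
      using a(1) by (rule factors_throughE)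
    have mem: "Dom E a \<in> Ob E" "u \<in> Hom E (Dom E a) (Dom E k)" "b \<in> Hom E (Dom E a) (Carrier A)"
      using u a by (auto simp: Hom_def)
    have all: "\<forall>T \<in> Ob E. \<forall>u \<in> Hom E T (Dom E k). \<forall>x \<in> Hom E T (Carrier A).
        Meet A \<cdot> \<langle>k \<cdot> u, x\<rangle> = k \<cdot> u \<longrightarrow> factors_through E x k"
      using F unfolding internal_filter_def by (elim conjE)
    show ?thesis
      by (rule bspec[OF bspec[OF bspec[OF all mem(1)] mem(2)] mem(3), THEN mp]) (simp add: a_eq a)
  qed
  show ?thesis
  proof
    assume m: "factors_through E (Meet A \<cdot> \<langle>x, y\<rangle>) k"
    let ?m = "Meet A \<cdot> \<langle>x, y\<rangle>"
    have my: "Meet A \<cdot> \<langle>?m, y\<rangle> = ?m"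
      using semilattice_laws(1)[OF A, of x y y] semilattice_laws(3)[OF A, of y y y] by simp
    have "Meet A \<cdot> \<langle>?m, x\<rangle> = Meet A \<cdot> \<langle>Meet A \<cdot> \<langle>y, x\<rangle>, x\<rangle>"
      using semilattice_laws(2)[OF A, of x y y] by simp
    also have "\<dots> = Meet A \<cdot> \<langle>y, x\<rangle>"
      using semilattice_laws(1)[OF A, of y x x] semilattice_laws(3)[OF A, of x x x] by simp
    also have "\<dots> = ?m" using semilattice_laws(2)[OF A, of x y y] by simp
    finally show "factors_through E x k \<and> factors_through E y k"
      using up[OF m, of y] up[OF m, of x] my by simp
  next
    assume "factors_through E x k \<and> factors_through E y k"
    then have fx: "factors_through E x k" and fy: "factors_through E y k" by auto
    obtain u where u: "u \<in> Ar E" "Dom E u = Dom E x" "Cod E u = Dom E k" "k \<cdot> u = x"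
      using fx by (rule factors_throughE)
    obtain v where v: "v \<in> Ar E" "Dom E v = Dom E y" "Cod E v = Dom E k" "k \<cdot> v = y"
      using fy by (rule factors_throughE)
    have "(Meet A \<cdot> (k \<otimes> k)) \<cdot> \<langle>u, v\<rangle> = Meet A \<cdot> \<langle>x, y\<rangle>"
      using u v by simp
    with factors_through_precomp[OF meet, of "\<langle>u, v\<rangle>"] u v
    show "factors_through E (Meet A \<cdot> \<langle>x, y\<rangle>) k" by simp
  qed
qed

text \<open>
  With \<open>filter_meet_iff\<close> and \<open>omega_meet_true_iff\<close> both sides of the homomorphism law are true at the
  pair \<open>(a, b)\<close> exactly when \<open>a\<close> and \<open>b\<close> lie in the filter.
\<close>

lemma characteristic_of_filter_is_hom:
  assumes F: "internal_filter E K A k"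
  shows "characteristic E (One K) \<Omega> tru k \<in> semilattice_homs E K A (Omega_semilattice E K \<Omega> tru)"
proof -
  have A: "internal_semilattice E K A" and k: "monic E k" and [simp]: "Cod E k = Carrier A"
    and top: "factors_through E (Top A) k"
    using F by (auto simp: internal_filter_def)
  define \<chi> where "\<chi> = characteristic E (One K) \<Omega> tru k"
  have chi: "classifies \<chi> k" unfolding \<chi>_def by (rule classifies_characteristic[OF k])
  note [simp] = semilattice_arrows[OF A] monic_arrow[OF k] classifies_arrow[OF chi]
  have iff: "\<chi> \<cdot> x = true_at (Dom E x) \<longleftrightarrow> factors_through E x k"
    if "x \<in> Ar E" "Cod E x = Carrier A" for x
    using classifies_iff[OF chi k] that by simp
  have "bang (One K) = Ident E (One K)" by (rule to_One_unique) auto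
  then have "\<chi> \<cdot> Top A = tru" using iff[of "Top A"] top by simp
  moreover have "\<chi> \<cdot> Meet A = omega_meet \<cdot> (\<chi> \<otimes> \<chi>)"
  proof (rule omega_eqI_pairs[of _ _ "Carrier A" "Carrier A"])
    fix a b T
    assume [simp]: "T \<in> Ob E" "a \<in> Ar E" "b \<in> Ar E" "Dom E a = T" "Dom E b = T"
      "Cod E a = Carrier A" "Cod E b = Carrier A"
    have "\<chi> \<cdot> (Meet A \<cdot> \<langle>a, b\<rangle>) = true_at T \<longleftrightarrow> \<chi> \<cdot> a = true_at T \<and> \<chi> \<cdot> b = true_at T"
      using iff[of "Meet A \<cdot> \<langle>a, b\<rangle>"] iff[of a] iff[of b] filter_meet_iff[OF F, of a b] by simp
    then show "(\<chi> \<cdot> Meet A) \<cdot> \<langle>a, b\<rangle> = true_at T \<longleftrightarrow> (omega_meet \<cdot> (\<chi> \<otimes> \<chi>)) \<cdot> \<langle>a, b\<rangle> = true_at T"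
      by (simp add: omega_meet_true_iff)
  qed simp_all
  ultimately show ?thesis
    using A Omega_is_semilattice
    by (simp add: semilattice_homs_def Omega_semilattice_def Hom_def flip: \<chi>_def omega_meet_def)
qed

lemma hom_classifies_filter:
  assumes h: "h \<in> semilattice_homs E K A (Omega_semilattice E K \<Omega> tru)"
    and k: "monic E k" and hk: "classifies h k"
  shows "internal_filter E K A k"
proof -
  have A: "internal_semilattice E K A"
    using h by (simp add: semilattice_homs_def)
  have h_top: "h \<cdot> Top A = tru" and h_meet: "h \<cdot> Meet A = omega_meet \<cdot> (h \<otimes> h)"
    and [simp]: "Dom E h = Carrier A"
    using h by (auto simp: semilattice_homs_def Omega_semilattice_def Hom_def omega_meet_def)
  note [simp] = semilattice_arrows[OF A] monic_arrow[OF k] classifies_arrow(1,3)[OF hk]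
  have [simp]: "Cod E k = Carrier A" using classifies_arrow(2)[OF hk] by simp
  have iff: "h \<cdot> x = true_at (Dom E x) \<longleftrightarrow> factors_through E x k"
    if "x \<in> Ar E" "Cod E x = Carrier A" for x
    using classifies_iff[OF hk k] that by simp
  have meet: "h \<cdot> (Meet A \<cdot> \<langle>x, y\<rangle>) = omega_meet \<cdot> \<langle>h \<cdot> x, h \<cdot> y\<rangle>"
    if "x \<in> Ar E" "Cod E x = Carrier A" "y \<in> Ar E" "Cod E y = Carrier A" "Dom E x = Dom E y" for x y
    using comp_eq_precomp[OF h_meet, of "\<langle>x, y\<rangle>"] that by simp
  have "bang (One K) = Ident E (One K)" by (rule to_One_unique) auto
  then have "factors_through E (Top A) k" using iff[of "Top A"] h_top by simp
  moreover have "factors_through E (Meet A \<cdot> (k \<otimes> k)) k"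
  proof -
    have "h \<cdot> (Meet A \<cdot> (k \<otimes> k)) = true_at (Prod K (Dom E k) (Dom E k))"
    proof -
      let ?p = "Fst K (Dom E k) (Dom E k)" and ?q = "Snd K (Dom E k) (Dom E k)"
      have "h \<cdot> k = true_at (Dom E k)" using iff[of k] factors_through_self by simp
      then have "h \<cdot> (k \<cdot> ?p) = true_at (Dom E k) \<cdot> ?p" "h \<cdot> (k \<cdot> ?q) = true_at (Dom E k) \<cdot> ?q"
        by (simp_all flip: comp_assoc_arrow)
      then show ?thesis
        using meet[of "k \<cdot> ?p" "k \<cdot> ?q"] by (simp add: prod_map_def omega_meet_true_iff)
    qed
    then show ?thesis using iff[of "Meet A \<cdot> (k \<otimes> k)"] by simp
  qed
  moreover have up: "factors_through E x k"
    if "u \<in> Hom E T (Dom E k)" "x \<in> Hom E T (Carrier A)" and eq: "Meet A \<cdot> \<langle>k \<cdot> u, x\<rangle> = k \<cdot> u" for T u x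
  proof -
    have ux: "u \<in> Ar E" "Cod E u = Dom E k" "x \<in> Ar E" "Dom E u = T" "Dom E x = T" "Cod E x = Carrier A"
      using that by (simp_all add: Hom_def)
    have "h \<cdot> (k \<cdot> u) = true_at (Dom E u)"
      using iff[of "k \<cdot> u"] ux by (simp add: factors_throughI[of u])
    then have "omega_meet \<cdot> \<langle>h \<cdot> (k \<cdot> u), h \<cdot> x\<rangle> = true_at T"
      using meet[of "k \<cdot> u" x] ux eq by simp
    then show ?thesis using ux iff[of x] by (simp add: omega_meet_true_iff)
  qed
  ultimately show ?thesis
    unfolding internal_filter_def using A k \<open>Cod E k = Carrier A\<close>
    by (intro conjI ballI impI) (assumption | (rule up; assumption))+
qed

end

section \<open>Jointly epic families and exponentials\<close>

context topos
begin

lemma exponential_exists: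
  assumes A: "A \<in> Ob E" and B: "B \<in> Ob E"
  obtains X ev where "X \<in> Ob E" "ev \<in> Ar E" "Dom E ev = Prod K X A" "Cod E ev = B"
    "\<And>Z g. \<lbrakk>Z \<in> Ob E; g \<in> Ar E; Dom E g = Prod K Z A; Cod E g = B\<rbrakk> \<Longrightarrow>
      \<exists>!h. h \<in> Hom E Z X \<and> ev \<cdot> (h \<otimes> Ident E A) = g"
proof -
  obtain X P p q ev where ex: "is_exponential E A B X P p q ev"
    using elementary_topos A B unfolding elementary_topos_def has_exponentials_def by blast
  have X: "X \<in> Ob E" and P: "is_product E X A P p q" and ev: "ev \<in> Ar E" "Dom E ev = P" "Cod E ev = B"
    using ex by (auto simp: is_exponential_def Hom_def)
  note [simp] = A B X ev product_arrows[OF P]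
  obtain w where w: "w \<in> Ar E" "Dom E w = Prod K X A" "Cod E w = P" "p \<cdot> w = Fst K X A" "q \<cdot> w = Snd K X A"
    by (rule product_lift[OF P, of "Fst K X A" "Snd K X A" "Prod K X A"]) simp_all
  show ?thesis
  proof (rule that[of X "ev \<cdot> w"])
    fix Z g
    assume Zg: "Z \<in> Ob E" "g \<in> Ar E" "Dom E g = Prod K Z A" "Cod E g = B"
    have "\<forall>Z \<in> Ob E. \<forall>Q r s. is_product E Z A Q r s \<longrightarrow> (\<forall>g \<in> Hom E Q B.
        \<exists>!h. h \<in> Hom E Z X \<and>
          (\<exists>u \<in> Hom E Q P. p \<cdot> u = h \<cdot> r \<and> q \<cdot> u = s \<and> ev \<cdot> u = g))"
      using ex unfolding is_exponential_def by (elim conjE)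
    then have *: "\<exists>!h. h \<in> Hom E Z X \<and>
        (\<exists>u \<in> Hom E (Prod K Z A) P. p \<cdot> u = h \<cdot> Fst K Z A \<and> q \<cdot> u = Snd K Z A \<and> ev \<cdot> u = g)"
      using Zg Prod_is_product[OF Zg(1) A] by (simp add: Hom_def)
    have "(\<exists>u \<in> Hom E (Prod K Z A) P. p \<cdot> u = h \<cdot> Fst K Z A \<and> q \<cdot> u = Snd K Z A \<and> ev \<cdot> u = g) \<longleftrightarrow>
        (ev \<cdot> w) \<cdot> (h \<otimes> Ident E A) = g" if "h \<in> Hom E Z X" for h
      using exponential_comparison[OF P, of "Ident E X" X w h Z "Fst K Z A" "Snd K Z A" "Prod K Z A" ev g]
        that Zg w by (simp add: Hom_def prod_map_def)
    then show "\<exists>!h. h \<in> Hom E Z X \<and> (ev \<cdot> w) \<cdot> (h \<otimes> Ident E A) = g"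
      using * by (simp cong: conj_cong)
  qed (use w in simp_all)
qed

text \<open>
  The functor \<open>- \<times> B\<close> is a left adjoint and so preserves joint epicness: the transposes of \<open>f\<close> and
  \<open>g\<close> agree on the family.
\<close>

lemma jointly_epic_times_ident:
  assumes S: "jointly_epic S A" and B: "B \<in> Ob E"
  shows "jointly_epic ((\<lambda>s. s \<otimes> Ident E B) ` S) (Prod K A B)"
proof (rule jointly_epicI)
  note [simp] = jointly_epicD[OF S] B
  show "Prod K A B \<in> Ob E" by simp
  show "t \<in> Ar E \<and> Cod E t = Prod K A B" if "t \<in> (\<lambda>s. s \<otimes> Ident E B) ` S" for t
    using that by auto
  fix f g
  assume fg [simp]: "f \<in> Ar E" "g \<in> Ar E" "Dom E f = Prod K A B" "Dom E g = Prod K A B" "Cod E f = Cod E g"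
    and eq: "\<And>t. t \<in> (\<lambda>s. s \<otimes> Ident E B) ` S \<Longrightarrow> f \<cdot> t = g \<cdot> t"
  have D: "Cod E g \<in> Ob E" by simp
  obtain X ev where X: "X \<in> Ob E" and ev [simp]: "ev \<in> Ar E" "Dom E ev = Prod K X B" "Cod E ev = Cod E g"
    and curry: "\<And>Z g'. \<lbrakk>Z \<in> Ob E; g' \<in> Ar E; Dom E g' = Prod K Z B; Cod E g' = Cod E g\<rbrakk> \<Longrightarrow>
      \<exists>!h. h \<in> Hom E Z X \<and> ev \<cdot> (h \<otimes> Ident E B) = g'"
    by (rule exponential_exists[OF B D]) (rule that)
  obtain f' where f': "f' \<in> Ar E" "Dom E f' = A" "Cod E f' = X" "ev \<cdot> (f' \<otimes> Ident E B) = f"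
    using ex1_implies_ex[OF curry[of A f]] by (auto simp: Hom_def)
  obtain g' where g': "g' \<in> Ar E" "Dom E g' = A" "Cod E g' = X" "ev \<cdot> (g' \<otimes> Ident E B) = g"
    using ex1_implies_ex[OF curry[of A g]] by (auto simp: Hom_def)
  have "f' = g'"
  proof (rule jointly_epic_eq[OF S])
    fix s assume s [simp]: "s \<in> S"
    have "\<exists>!h. h \<in> Hom E (Dom E s) X \<and> ev \<cdot> (h \<otimes> Ident E B) = g \<cdot> (s \<otimes> Ident E B)"
      by (rule curry) simp_all
    then show "f' \<cdot> s = g' \<cdot> s"
    proof (rule ex1_same)
      have pre: "ev \<cdot> ((k \<cdot> s) \<otimes> Ident E B) = (ev \<cdot> (k \<otimes> Ident E B)) \<cdot> (s \<otimes> Ident E B)"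
        if "k \<in> Ar E" "Dom E k = A" "Cod E k = X" for k
        using that X by simp
      have "f \<cdot> (s \<otimes> Ident E B) = g \<cdot> (s \<otimes> Ident E B)" by (rule eq) simp
      then show "f' \<cdot> s \<in> Hom E (Dom E s) X \<and> ev \<cdot> ((f' \<cdot> s) \<otimes> Ident E B) = g \<cdot> (s \<otimes> Ident E B)"
        using pre[of f'] f' by (simp add: Hom_def)
      show "g' \<cdot> s \<in> Hom E (Dom E s) X \<and> ev \<cdot> ((g' \<cdot> s) \<otimes> Ident E B) = g \<cdot> (s \<otimes> Ident E B)"
        using pre[of g'] g' by (simp add: Hom_def)
    qed
  qed (use f' g' in simp_all)
  then show "f = g" using f'(4) g'(4) by simp
qed

lemma jointly_epic_ident_times:
  assumes T: "jointly_epic T B" and A: "A \<in> Ob E"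
  shows "jointly_epic ((\<lambda>t. Ident E A \<otimes> t) ` T) (Prod K A B)"
proof (rule jointly_epicI)
  note [simp] = jointly_epicD[OF T] A
  show "Prod K A B \<in> Ob E" by simp
  show "s \<in> Ar E \<and> Cod E s = Prod K A B" if "s \<in> (\<lambda>t. Ident E A \<otimes> t) ` T" for s
    using that by auto
  fix f g
  assume fg [simp]: "f \<in> Ar E" "g \<in> Ar E" "Dom E f = Prod K A B" "Dom E g = Prod K A B" "Cod E f = Cod E g"
    and eq: "\<And>s. s \<in> (\<lambda>t. Ident E A \<otimes> t) ` T \<Longrightarrow> f \<cdot> s = g \<cdot> s"
  have "f \<cdot> swap B A = g \<cdot> swap B A"
  proof (rule jointly_epic_eq[OF jointly_epic_times_ident[OF T A]])
    fix s assume "s \<in> (\<lambda>t. t \<otimes> Ident E A) ` T"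
    then obtain t where t [simp]: "t \<in> T" and s: "s = t \<otimes> Ident E A" by auto
    have "swap B A \<cdot> s = (Ident E A \<otimes> t) \<cdot> swap (Dom E t) A"
      by (simp add: s prod_map_def)
    moreover have "f \<cdot> (Ident E A \<otimes> t) = g \<cdot> (Ident E A \<otimes> t)" by (rule eq) simp
    then have "f \<cdot> ((Ident E A \<otimes> t) \<cdot> swap (Dom E t) A) = g \<cdot> ((Ident E A \<otimes> t) \<cdot> swap (Dom E t) A)"
      by (rule comp_eq_precomp) simp_all
    ultimately show "(f \<cdot> swap B A) \<cdot> s = (g \<cdot> swap B A) \<cdot> s"
      by (simp add: s)
  qed simp_all
  then have "f \<cdot> (swap B A \<cdot> swap A B) = g \<cdot> (swap B A \<cdot> swap A B)"
    by (rule comp_eq_precomp) simp_all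
  then show "f = g" using swap_swap[of B A] by simp
qed

lemma jointly_epic_prod:
  assumes S: "jointly_epic S A" and T: "jointly_epic T B"
  shows "jointly_epic {s \<otimes> t |s t. s \<in> S \<and> t \<in> T} (Prod K A B)"
proof (rule jointly_epicI)
  note [simp] = jointly_epicD[OF S] jointly_epicD[OF T]
  show "Prod K A B \<in> Ob E" by simp
  show "r \<in> Ar E \<and> Cod E r = Prod K A B" if "r \<in> {s \<otimes> t |s t. s \<in> S \<and> t \<in> T}" for r
    using that by auto
  fix f g
  assume fg [simp]: "f \<in> Ar E" "g \<in> Ar E" "Dom E f = Prod K A B" "Dom E g = Prod K A B" "Cod E f = Cod E g"
    and eq: "\<And>r. r \<in> {s \<otimes> t |s t. s \<in> S \<and> t \<in> T} \<Longrightarrow> f \<cdot> r = g \<cdot> r"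
  show "f = g"
  proof (rule jointly_epic_eq[OF jointly_epic_times_ident[OF S jointly_epicD(1)[OF T]]])
    fix s' assume "s' \<in> (\<lambda>s. s \<otimes> Ident E B) ` S"
    then obtain s where s [simp]: "s \<in> S" and s': "s' = s \<otimes> Ident E B" by auto
    show "f \<cdot> s' = g \<cdot> s'"
    proof (rule jointly_epic_eq[OF jointly_epic_ident_times[OF T, of "Dom E s"]])
      fix t' assume "t' \<in> (\<lambda>t. Ident E (Dom E s) \<otimes> t) ` T"
      then obtain t where t [simp]: "t \<in> T" and t': "t' = Ident E (Dom E s) \<otimes> t" by auto
      have "f \<cdot> (s \<otimes> t) = g \<cdot> (s \<otimes> t)" by (rule eq) (use s t in blast)
      then show "(f \<cdot> s') \<cdot> t' = (g \<cdot> s') \<cdot> t'" by (simp add: s' t')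
    qed (simp_all add: s')
  qed simp_all
qed

end

section \<open>The semilattice of local states\<close>

locale local_states = topos E K \<Omega> tru
  for E :: "('o, 'm) cat" (structure) and K :: "('o, 'm) cartesian" and \<Omega> :: 'o and tru :: 'm +
  fixes \<Xi> :: 'o and \<xi> :: "'o \<Rightarrow> 'm"
  assumes local_state_classifier: "local_state_classifier E \<Xi> \<xi>"
begin

lemma is_cocone_mono_iff:
  "is_cocone (mono_subcategory E) E inclusion_functor c \<mu> \<longleftrightarrow>
    c \<in> Ob E \<and> (\<forall>X \<in> Ob E. \<mu> X \<in> Hom E X c) \<and> (\<forall>m. monic E m \<longrightarrow> \<mu> (Cod E m) \<cdot> m = \<mu> (Dom E m))"
  by (simp add: is_cocone_def mono_subcategory_def inclusion_functor_def)

lemma Xi_Ob [simp]: "\<Xi> \<in> Ob E"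
  and xi_arrow [simp]: "X \<in> Ob E \<Longrightarrow> \<xi> X \<in> Ar E" "X \<in> Ob E \<Longrightarrow> Dom E (\<xi> X) = X" "X \<in> Ob E \<Longrightarrow> Cod E (\<xi> X) = \<Xi>"
  and xi_monic: "monic E m \<Longrightarrow> \<xi> (Cod E m) \<cdot> m = \<xi> (Dom E m)"
  using local_state_classifier
  by (auto simp: local_state_classifier_def is_colimit_def is_cocone_mono_iff Hom_def)

lemma xi_ex1:
  assumes "D \<in> Ob E" "\<And>X. X \<in> Ob E \<Longrightarrow> \<mu> X \<in> Ar E \<and> Dom E (\<mu> X) = X \<and> Cod E (\<mu> X) = D"
    "\<And>m. monic E m \<Longrightarrow> \<mu> (Cod E m) \<cdot> m = \<mu> (Dom E m)"
  shows "\<exists>!h. h \<in> Hom E \<Xi> D \<and> (\<forall>X \<in> Ob E. h \<cdot> \<xi> X = \<mu> X)"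
proof -
  have "is_cocone (mono_subcategory E) E inclusion_functor D \<mu>"
    using assms by (simp add: is_cocone_mono_iff Hom_def)
  then show ?thesis
    using local_state_classifier
    by (simp add: local_state_classifier_def is_colimit_def mono_subcategory_def)
qed

lemma xi_jointly_epic: "jointly_epic (\<xi> ` Ob E) \<Xi>"
proof (rule jointly_epicI)
  fix f g
  assume fg: "f \<in> Ar E" "g \<in> Ar E" "Dom E f = \<Xi>" "Dom E g = \<Xi>" "Cod E f = Cod E g"
    and eq: "\<And>s. s \<in> \<xi> ` Ob E \<Longrightarrow> f \<cdot> s = g \<cdot> s"
  have "\<exists>!h. h \<in> Hom E \<Xi> (Cod E f) \<and> (\<forall>X \<in> Ob E. h \<cdot> \<xi> X = f \<cdot> \<xi> X)"
  proof (rule xi_ex1)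
    fix m assume m: "monic E m"
    then show "(f \<cdot> \<xi> (Cod E m)) \<cdot> m = f \<cdot> \<xi> (Dom E m)"
      using fg xi_monic[OF m] monic_arrow[OF m] by simp
  qed (use fg in simp_all)
  then show "f = g"
    by (rule ex1_same) (use fg eq in \<open>simp_all add: Hom_def\<close>)
qed auto

lemma xi_eqI:
  assumes "f \<in> Ar E" "g \<in> Ar E" "Dom E f = \<Xi>" "Dom E g = \<Xi>" "Cod E f = Cod E g"
    "\<And>X. X \<in> Ob E \<Longrightarrow> f \<cdot> \<xi> X = g \<cdot> \<xi> X"
  shows "f = g"
  by (rule jointly_epic_eq[OF xi_jointly_epic]) (use assms in auto)

lemma xi_pair_jointly_epic: "jointly_epic {\<xi> X \<otimes> \<xi> Y |X Y. X \<in> Ob E \<and> Y \<in> Ob E} (Prod K \<Xi> \<Xi>)"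
proof -
  have "{\<xi> X \<otimes> \<xi> Y |X Y. X \<in> Ob E \<and> Y \<in> Ob E} = {s \<otimes> t |s t. s \<in> \<xi> ` Ob E \<and> t \<in> \<xi> ` Ob E}"
    by auto
  then show ?thesis using jointly_epic_prod[OF xi_jointly_epic xi_jointly_epic] by simp
qed

lemma xi_pair_eqI:
  assumes "f \<in> Ar E" "g \<in> Ar E" "Dom E f = Prod K \<Xi> \<Xi>" "Dom E g = Prod K \<Xi> \<Xi>" "Cod E f = Cod E g"
    "\<And>X Y. \<lbrakk>X \<in> Ob E; Y \<in> Ob E\<rbrakk> \<Longrightarrow> f \<cdot> (\<xi> X \<otimes> \<xi> Y) = g \<cdot> (\<xi> X \<otimes> \<xi> Y)"
  shows "f = g"
  by (rule jointly_epic_eq[OF xi_pair_jointly_epic]) (use assms in auto)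

lemma xi_triple_eqI:
  assumes "f \<in> Ar E" "g \<in> Ar E" "Dom E f = Prod K (Prod K \<Xi> \<Xi>) \<Xi>" "Dom E g = Prod K (Prod K \<Xi> \<Xi>) \<Xi>"
    "Cod E f = Cod E g"
    "\<And>X Y Z. \<lbrakk>X \<in> Ob E; Y \<in> Ob E; Z \<in> Ob E\<rbrakk> \<Longrightarrow>
      f \<cdot> ((\<xi> X \<otimes> \<xi> Y) \<otimes> \<xi> Z) = g \<cdot> ((\<xi> X \<otimes> \<xi> Y) \<otimes> \<xi> Z)"
  shows "f = g"
  by (rule jointly_epic_eq[OF jointly_epic_prod[OF xi_pair_jointly_epic xi_jointly_epic]]) (use assms in auto)

text \<open>
  The functor \<open>- \<times> A\<close> preserves the colimit \<open>\<Xi>\<close>: the transposes \<open>X \<rightarrow> D\<^sup>A\<close> of the morphisms \<open>\<mu> X\<close>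
  form a cocone on monomorphisms, and the induced morphism \<open>\<Xi> \<rightarrow> D\<^sup>A\<close> is transposed back.
\<close>

lemma xi_times_ident_universal:
  assumes A [simp]: "A \<in> Ob E" and D: "D \<in> Ob E"
    and \<mu>: "\<And>X. X \<in> Ob E \<Longrightarrow> \<mu> X \<in> Ar E" "\<And>X. X \<in> Ob E \<Longrightarrow> Dom E (\<mu> X) = Prod K X A"
      "\<And>X. X \<in> Ob E \<Longrightarrow> Cod E (\<mu> X) = D"
    and cocone: "\<And>m. monic E m \<Longrightarrow> \<mu> (Cod E m) \<cdot> (m \<otimes> Ident E A) = \<mu> (Dom E m)"
  obtains h where "h \<in> Ar E" "Dom E h = Prod K \<Xi> A" "Cod E h = D"
    "\<And>X. X \<in> Ob E \<Longrightarrow> h \<cdot> (\<xi> X \<otimes> Ident E A) = \<mu> X"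
proof -
  obtain B ev where B [simp]: "B \<in> Ob E" and ev [simp]: "ev \<in> Ar E" "Dom E ev = Prod K B A" "Cod E ev = D"
    and curry: "\<And>Z g. \<lbrakk>Z \<in> Ob E; g \<in> Ar E; Dom E g = Prod K Z A; Cod E g = D\<rbrakk> \<Longrightarrow>
      \<exists>!h. h \<in> Hom E Z B \<and> ev \<cdot> (h \<otimes> Ident E A) = g"
    by (rule exponential_exists[OF A D]) (rule that)
  have "\<forall>X \<in> Ob E. \<exists>c. c \<in> Hom E X B \<and> ev \<cdot> (c \<otimes> Ident E A) = \<mu> X"
    using curry \<mu> by (blast intro: ex1_implies_ex)
  then obtain c where c: "\<And>X. X \<in> Ob E \<Longrightarrow> c X \<in> Hom E X B"
    and ev_c: "\<And>X. X \<in> Ob E \<Longrightarrow> ev \<cdot> (c X \<otimes> Ident E A) = \<mu> X"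
    using bchoice[of "Ob E" "\<lambda>X c. c \<in> Hom E X B \<and> ev \<cdot> (c \<otimes> Ident E A) = \<mu> X"] by blast
  have c_arrow [simp]: "c X \<in> Ar E" "Dom E (c X) = X" "Cod E (c X) = B" if "X \<in> Ob E" for X
    using c[OF that] by (simp_all add: Hom_def)
  have "\<exists>!h. h \<in> Hom E \<Xi> B \<and> (\<forall>X \<in> Ob E. h \<cdot> \<xi> X = c X)"
  proof (rule xi_ex1)
    fix m assume m: "monic E m"
    note [simp] = monic_arrow[OF m]
    have "\<exists>!h. h \<in> Hom E (Dom E m) B \<and> ev \<cdot> (h \<otimes> Ident E A) = \<mu> (Dom E m)"
      by (rule curry) (simp_all add: \<mu>)
    then show "c (Cod E m) \<cdot> m = c (Dom E m)"
    proof (rule ex1_same)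
      have "ev \<cdot> ((c (Cod E m) \<cdot> m) \<otimes> Ident E A) = (ev \<cdot> (c (Cod E m) \<otimes> Ident E A)) \<cdot> (m \<otimes> Ident E A)"
        by simp
      also have "\<dots> = \<mu> (Dom E m)" using ev_c cocone[OF m] by simp
      finally show "c (Cod E m) \<cdot> m \<in> Hom E (Dom E m) B \<and>
          ev \<cdot> ((c (Cod E m) \<cdot> m) \<otimes> Ident E A) = \<mu> (Dom E m)"
        by (simp add: Hom_def)
    qed (simp add: Hom_def ev_c)
  qed simp_all
  then obtain h where h: "h \<in> Ar E" "Dom E h = \<Xi>" "Cod E h = B" "\<And>X. X \<in> Ob E \<Longrightarrow> h \<cdot> \<xi> X = c X"
    by (auto simp: Hom_def)
  show ?thesis
    by (rule that[of "ev \<cdot> (h \<otimes> Ident E A)"]) (use h ev_c in simp_all)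
qed

text \<open>
  The meet on \<open>\<Xi> \<times> \<Xi>\<close> is built one variable at a time.  For each \<open>Y\<close> the cocone \<open>\<xi> (X \<times> Y)\<close> in \<open>X\<close>
  induces \<open>v Y : \<Xi> \<times> Y \<rightarrow> \<Xi>\<close>; these are compatible with monomorphisms in \<open>Y\<close> because the maps
  \<open>\<xi> X \<times> id\<close> are jointly epic, and so induce a morphism on \<open>\<Xi> \<times> \<Xi>\<close>.
\<close>

lemma Xi_meet_exists:
  obtains w where "w \<in> Ar E" "Dom E w = Prod K \<Xi> \<Xi>" "Cod E w = \<Xi>"
    "\<And>X Y. \<lbrakk>X \<in> Ob E; Y \<in> Ob E\<rbrakk> \<Longrightarrow> w \<cdot> (\<xi> X \<otimes> \<xi> Y) = \<xi> (Prod K X Y)"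
proof -
  have "\<exists>v. v \<in> Ar E \<and> Dom E v = Prod K \<Xi> Y \<and> Cod E v = \<Xi> \<and>
      (\<forall>X \<in> Ob E. v \<cdot> (\<xi> X \<otimes> Ident E Y) = \<xi> (Prod K X Y))" if Y [simp]: "Y \<in> Ob E" for Y
  proof -
    have "\<xi> (Prod K (Cod E m) Y) \<cdot> (m \<otimes> Ident E Y) = \<xi> (Prod K (Dom E m) Y)" if m: "monic E m" for m
      using xi_monic[OF prod_map_monic[OF m ident_monic[OF Y]]] monic_arrow[OF m] by simp
    then obtain v where "v \<in> Ar E" "Dom E v = Prod K \<Xi> Y" "Cod E v = \<Xi>"
      "\<And>X. X \<in> Ob E \<Longrightarrow> v \<cdot> (\<xi> X \<otimes> Ident E Y) = \<xi> (Prod K X Y)"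
      by (rule xi_times_ident_universal[of Y \<Xi> "\<lambda>X. \<xi> (Prod K X Y)", rotated 5]) simp_all
    then show ?thesis by blast
  qed
  then obtain v where v [simp]: "\<And>Y. Y \<in> Ob E \<Longrightarrow> v Y \<in> Ar E" "\<And>Y. Y \<in> Ob E \<Longrightarrow> Dom E (v Y) = Prod K \<Xi> Y"
    "\<And>Y. Y \<in> Ob E \<Longrightarrow> Cod E (v Y) = \<Xi>"
    and v_xi: "\<And>X Y. \<lbrakk>X \<in> Ob E; Y \<in> Ob E\<rbrakk> \<Longrightarrow> v Y \<cdot> (\<xi> X \<otimes> Ident E Y) = \<xi> (Prod K X Y)"
    by metis
  \<comment> \<open>Compatibility of the family \<open>v\<close> with monomorphisms in the second variable.\<close>
  have nat: "v (Cod E m) \<cdot> (Ident E \<Xi> \<otimes> m) = v (Dom E m)" if m: "monic E m" for m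
  proof (rule jointly_epic_eq[OF jointly_epic_times_ident[OF xi_jointly_epic, of "Dom E m"]])
    note [simp] = monic_arrow[OF m]
    fix s assume "s \<in> (\<lambda>s. s \<otimes> Ident E (Dom E m)) ` \<xi> ` Ob E"
    then obtain X where X [simp]: "X \<in> Ob E" and s: "s = \<xi> X \<otimes> Ident E (Dom E m)" by auto
    have "(v (Cod E m) \<cdot> (Ident E \<Xi> \<otimes> m)) \<cdot> s = (v (Cod E m) \<cdot> (\<xi> X \<otimes> Ident E (Cod E m))) \<cdot> (Ident E X \<otimes> m)"
      by (simp add: s)
    also have "\<dots> = v (Dom E m) \<cdot> s"
      using xi_monic[OF prod_map_monic[OF ident_monic[OF X] m]] by (simp add: s v_xi del: comp_assoc_arrow)
    finally show "(v (Cod E m) \<cdot> (Ident E \<Xi> \<otimes> m)) \<cdot> s = v (Dom E m) \<cdot> s" .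
  qed (use monic_arrow[OF m] in simp_all)
  have "(v (Cod E m) \<cdot> swap (Cod E m) \<Xi>) \<cdot> (m \<otimes> Ident E \<Xi>) = v (Dom E m) \<cdot> swap (Dom E m) \<Xi>"
    if m: "monic E m" for m
  proof -
    note [simp] = monic_arrow[OF m]
    have "(v (Cod E m) \<cdot> swap (Cod E m) \<Xi>) \<cdot> (m \<otimes> Ident E \<Xi>) =
        v (Cod E m) \<cdot> ((Ident E \<Xi> \<otimes> m) \<cdot> swap (Dom E m) \<Xi>)"
      by (simp add: prod_map_def)
    also have "\<dots> = (v (Cod E m) \<cdot> (Ident E \<Xi> \<otimes> m)) \<cdot> swap (Dom E m) \<Xi>" by simp
    finally show ?thesis unfolding nat[OF m] .
  qed
  then obtain u where u: "u \<in> Ar E" "Dom E u = Prod K \<Xi> \<Xi>" "Cod E u = \<Xi>"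
    "\<And>Y. Y \<in> Ob E \<Longrightarrow> u \<cdot> (\<xi> Y \<otimes> Ident E \<Xi>) = v Y \<cdot> swap Y \<Xi>"
    by (rule xi_times_ident_universal[of \<Xi> \<Xi> "\<lambda>Y. v Y \<cdot> swap Y \<Xi>", rotated 5]) simp_all
  show ?thesis
  proof (rule that[of "u \<cdot> swap \<Xi> \<Xi>"])
    fix X Y assume [simp]: "X \<in> Ob E" "Y \<in> Ob E"
    have "(u \<cdot> swap \<Xi> \<Xi>) \<cdot> (\<xi> X \<otimes> \<xi> Y) = (u \<cdot> (\<xi> Y \<otimes> Ident E \<Xi>)) \<cdot> ((Ident E Y \<otimes> \<xi> X) \<cdot> swap X Y)"
      using u(1-3) by (simp add: prod_map_def)
    also have "\<dots> = (v Y \<cdot> (\<xi> X \<otimes> Ident E Y)) \<cdot> (swap Y X \<cdot> swap X Y)"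
      using u by (simp add: prod_map_def)
    also have "\<dots> = \<xi> (Prod K X Y)"
      unfolding v_xi[OF \<open>X \<in> Ob E\<close> \<open>Y \<in> Ob E\<close>] swap_swap[OF \<open>Y \<in> Ob E\<close> \<open>X \<in> Ob E\<close>] by simp
    finally show "(u \<cdot> swap \<Xi> \<Xi>) \<cdot> (\<xi> X \<otimes> \<xi> Y) = \<xi> (Prod K X Y)" .
  qed (use u in simp_all)
qed

abbreviation Xi_slat :: "('o, 'm) semilat" where
  "Xi_slat \<equiv> Xi_semilattice E K \<Xi> \<xi>"

abbreviation Xi_meet :: 'm where
  "Xi_meet \<equiv> Meet Xi_slat"

lemma Xi_slat_simps [simp]: "Carrier Xi_slat = \<Xi>" "Top Xi_slat = \<xi> (One K)"
  by (simp_all add: Xi_semilattice_def)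

lemma Xi_meet_arrow [simp]: "Xi_meet \<in> Ar E" "Dom E Xi_meet = Prod K \<Xi> \<Xi>" "Cod E Xi_meet = \<Xi>"
  and Xi_meet_xi: "\<And>X Y. \<lbrakk>X \<in> Ob E; Y \<in> Ob E\<rbrakk> \<Longrightarrow> Xi_meet \<cdot> (\<xi> X \<otimes> \<xi> Y) = \<xi> (Prod K X Y)"
proof -
  let ?P = "\<lambda>w. w \<in> Hom E (Prod K \<Xi> \<Xi>) \<Xi> \<and> (\<forall>X \<in> Ob E. \<forall>Y \<in> Ob E. w \<cdot> (\<xi> X \<otimes> \<xi> Y) = \<xi> (Prod K X Y))"
  obtain w where "w \<in> Ar E" "Dom E w = Prod K \<Xi> \<Xi>" "Cod E w = \<Xi>"
    "\<And>X Y. \<lbrakk>X \<in> Ob E; Y \<in> Ob E\<rbrakk> \<Longrightarrow> w \<cdot> (\<xi> X \<otimes> \<xi> Y) = \<xi> (Prod K X Y)"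
    by (rule Xi_meet_exists) (rule that)
  then have w: "?P w" by (simp add: Hom_def)
  moreover have "w' = w" if "?P w'" for w'
    by (rule xi_pair_eqI) (use w that in \<open>simp_all add: Hom_def\<close>)
  ultimately have "?P (THE w. ?P w)" by (rule theI)
  then have "?P Xi_meet" by (simp add: Xi_semilattice_def)
  then show "Xi_meet \<in> Ar E" "Dom E Xi_meet = Prod K \<Xi> \<Xi>" "Cod E Xi_meet = \<Xi>"
    "\<And>X Y. \<lbrakk>X \<in> Ob E; Y \<in> Ob E\<rbrakk> \<Longrightarrow> Xi_meet \<cdot> (\<xi> X \<otimes> \<xi> Y) = \<xi> (Prod K X Y)"
    by (simp_all add: Hom_def)
qed

lemma Xi_meet_tuple:
  assumes "f \<in> Ar E" "g \<in> Ar E" "Dom E f = Dom E g" "Cod E f = X" "Cod E g = Y"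
  shows "Xi_meet \<cdot> \<langle>\<xi> X \<cdot> f, \<xi> Y \<cdot> g\<rangle> = \<xi> (Prod K X Y) \<cdot> \<langle>f, g\<rangle>"
proof -
  have X: "X \<in> Ob E" and Y: "Y \<in> Ob E" using assms by auto
  have "(Xi_meet \<cdot> (\<xi> X \<otimes> \<xi> Y)) \<cdot> \<langle>f, g\<rangle> = Xi_meet \<cdot> \<langle>\<xi> X \<cdot> f, \<xi> Y \<cdot> g\<rangle>"
    using assms X Y by simp
  then show ?thesis unfolding Xi_meet_xi[OF X Y] by simp
qed

text \<open>
  Each law is checked on the jointly epic family of the \<open>\<xi> X\<close>.  There both sides have the form
  \<open>\<xi> P \<cdot> m\<close> with \<open>P\<close> a product and \<open>m\<close> a structural monomorphism: \<open>\<langle>id, !\<rangle>\<close> for the unit law,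
  the diagonal for idempotence, the symmetry for commutativity and the associator for
  associativity.  By the cocone property \<open>\<xi> P \<cdot> m = \<xi> (Dom m)\<close>, which is
  the same on both sides.
\<close>

lemma Xi_is_semilattice: "internal_semilattice E K Xi_slat"
proof -
  have "Xi_meet \<cdot> \<langle>Ident E \<Xi>, \<xi> (One K) \<cdot> bang \<Xi>\<rangle> = Ident E \<Xi>"
  proof (rule xi_eqI)
    fix X assume [simp]: "X \<in> Ob E"
    have "monic E \<langle>Ident E X, bang X\<rangle>" by (intro tuple_monic_left ident_monic) simp_all
    then show "(Xi_meet \<cdot> \<langle>Ident E \<Xi>, \<xi> (One K) \<cdot> bang \<Xi>\<rangle>) \<cdot> \<xi> X = Ident E \<Xi> \<cdot> \<xi> X"
      using Xi_meet_tuple[of "Ident E X" "bang X" X "One K"] xi_monic by fastforce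
  qed simp_all
  then have 1: "Xi_meet \<cdot> \<langle>x, \<xi> (One K) \<cdot> bang X\<rangle> = x" if "x \<in> Ar E" "Dom E x = X" "Cod E x = \<Xi>" for x X
    using comp_assoc_arrow[of x "\<langle>Ident E \<Xi>, \<xi> (One K) \<cdot> bang \<Xi>\<rangle>" Xi_meet] that by simp
  have "Xi_meet \<cdot> \<langle>Ident E \<Xi>, Ident E \<Xi>\<rangle> = Ident E \<Xi>"
  proof (rule xi_eqI)
    fix X assume [simp]: "X \<in> Ob E"
    have "monic E \<langle>Ident E X, Ident E X\<rangle>" by (intro tuple_monic_left ident_monic) simp_all
    then show "(Xi_meet \<cdot> \<langle>Ident E \<Xi>, Ident E \<Xi>\<rangle>) \<cdot> \<xi> X = Ident E \<Xi> \<cdot> \<xi> X"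
      using Xi_meet_tuple[of "Ident E X" "Ident E X" X X] xi_monic by fastforce
  qed simp_all
  then have 2: "Xi_meet \<cdot> \<langle>x, x\<rangle> = x" if "x \<in> Ar E" "Cod E x = \<Xi>" for x
    using comp_assoc_arrow[of x "\<langle>Ident E \<Xi>, Ident E \<Xi>\<rangle>" Xi_meet] that by simp
  have "Xi_meet \<cdot> swap \<Xi> \<Xi> = Xi_meet"
  proof (rule xi_pair_eqI)
    fix X Y assume [simp]: "X \<in> Ob E" "Y \<in> Ob E"
    have "(Xi_meet \<cdot> swap \<Xi> \<Xi>) \<cdot> (\<xi> X \<otimes> \<xi> Y) = \<xi> (Prod K Y X) \<cdot> swap X Y"
      using Xi_meet_tuple[of "Snd K X Y" "Fst K X Y" Y X] by (simp add: prod_map_def)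
    also have "\<dots> = \<xi> (Prod K X Y)" using xi_monic[OF swap_monic[of X Y]] by simp
    finally show "(Xi_meet \<cdot> swap \<Xi> \<Xi>) \<cdot> (\<xi> X \<otimes> \<xi> Y) = Xi_meet \<cdot> (\<xi> X \<otimes> \<xi> Y)"
      by (simp add: Xi_meet_xi)
  qed simp_all
  then have 3: "Xi_meet \<cdot> \<langle>y, x\<rangle> = Xi_meet \<cdot> \<langle>x, y\<rangle>"
    if "x \<in> Ar E" "y \<in> Ar E" "Dom E x = Dom E y" "Cod E x = \<Xi>" "Cod E y = \<Xi>" for x y
    using comp_assoc_arrow[of "\<langle>x, y\<rangle>" "swap \<Xi> \<Xi>" Xi_meet] that by simp
  let ?P = "Prod K (Prod K \<Xi> \<Xi>) \<Xi>"
  let ?a = "\<lambda>X Y Z. Fst K X Y \<cdot> Fst K (Prod K X Y) Z"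
  let ?b = "\<lambda>X Y Z. Snd K X Y \<cdot> Fst K (Prod K X Y) Z"
  let ?c = "\<lambda>X Y Z. Snd K (Prod K X Y) Z"
  have "Xi_meet \<cdot> \<langle>Xi_meet \<cdot> \<langle>?a \<Xi> \<Xi> \<Xi>, ?b \<Xi> \<Xi> \<Xi>\<rangle>, ?c \<Xi> \<Xi> \<Xi>\<rangle> =
      Xi_meet \<cdot> \<langle>?a \<Xi> \<Xi> \<Xi>, Xi_meet \<cdot> \<langle>?b \<Xi> \<Xi> \<Xi>, ?c \<Xi> \<Xi> \<Xi>\<rangle>\<rangle>" (is "?l = ?r")
  proof (rule xi_triple_eqI)
    fix X Y Z assume [simp]: "X \<in> Ob E" "Y \<in> Ob E" "Z \<in> Ob E"
    let ?m = "\<langle>?a X Y Z, \<langle>?b X Y Z, ?c X Y Z\<rangle>\<rangle>"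
    \<comment> \<open>The map \<open>?m\<close> is the associator; \<open>?r\<close> below is its inverse.\<close>
    have m: "monic E ?m"
    proof (rule split_monic)
      let ?r = "\<langle>\<langle>Fst K X (Prod K Y Z), Fst K Y Z \<cdot> Snd K X (Prod K Y Z)\<rangle>, Snd K Y Z \<cdot> Snd K X (Prod K Y Z)\<rangle>"
      show "?r \<cdot> ?m = Ident E (Dom E ?m)" by (simp add: tuple_projections_ident)
    qed simp_all
    have "?l \<cdot> ((\<xi> X \<otimes> \<xi> Y) \<otimes> \<xi> Z) =
        Xi_meet \<cdot> \<langle>Xi_meet \<cdot> \<langle>\<xi> X \<cdot> ?a X Y Z, \<xi> Y \<cdot> ?b X Y Z\<rangle>, \<xi> Z \<cdot> ?c X Y Z\<rangle>"
      by (simp add: prod_map_def)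
    also have "\<dots> = Xi_meet \<cdot> \<langle>\<xi> (Prod K X Y) \<cdot> \<langle>?a X Y Z, ?b X Y Z\<rangle>, \<xi> Z \<cdot> ?c X Y Z\<rangle>"
      using Xi_meet_tuple[of "?a X Y Z" "?b X Y Z" X Y] by simp
    also have "\<dots> = \<xi> (Prod K (Prod K X Y) Z)"
      using Xi_meet_tuple[of "Fst K (Prod K X Y) Z" "?c X Y Z" "Prod K X Y" Z] by (simp add: tuple_projections_ident)
    finally have l: "?l \<cdot> ((\<xi> X \<otimes> \<xi> Y) \<otimes> \<xi> Z) = \<xi> (Prod K (Prod K X Y) Z)" .
    have "?r \<cdot> ((\<xi> X \<otimes> \<xi> Y) \<otimes> \<xi> Z) =
        Xi_meet \<cdot> \<langle>\<xi> X \<cdot> ?a X Y Z, Xi_meet \<cdot> \<langle>\<xi> Y \<cdot> ?b X Y Z, \<xi> Z \<cdot> ?c X Y Z\<rangle>\<rangle>"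
      by (simp add: prod_map_def)
    also have "\<dots> = Xi_meet \<cdot> \<langle>\<xi> X \<cdot> ?a X Y Z, \<xi> (Prod K Y Z) \<cdot> \<langle>?b X Y Z, ?c X Y Z\<rangle>\<rangle>"
      using Xi_meet_tuple[of "?b X Y Z" "?c X Y Z" Y Z] by simp
    also have "\<dots> = \<xi> (Prod K X (Prod K Y Z)) \<cdot> ?m"
      by (rule Xi_meet_tuple) simp_all
    also have "\<dots> = \<xi> (Prod K (Prod K X Y) Z)" using xi_monic[OF m] by simp
    finally show "?l \<cdot> ((\<xi> X \<otimes> \<xi> Y) \<otimes> \<xi> Z) = ?r \<cdot> ((\<xi> X \<otimes> \<xi> Y) \<otimes> \<xi> Z)" using l by simp
  qed simp_all
  note assoc = this
  have 4: "Xi_meet \<cdot> \<langle>Xi_meet \<cdot> \<langle>x, y\<rangle>, z\<rangle> = Xi_meet \<cdot> \<langle>x, Xi_meet \<cdot> \<langle>y, z\<rangle>\<rangle>"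
    if "x \<in> Ar E" "y \<in> Ar E" "z \<in> Ar E" "Dom E x = Dom E z" "Dom E y = Dom E z"
      "Cod E x = \<Xi>" "Cod E y = \<Xi>" "Cod E z = \<Xi>" for x y z
  proof -
    from assoc have "?l \<cdot> \<langle>\<langle>x, y\<rangle>, z\<rangle> = ?r \<cdot> \<langle>\<langle>x, y\<rangle>, z\<rangle>" by (rule arg_cong)
    then show ?thesis using that by simp
  qed
  have 5: "Xi_meet \<cdot> \<langle>\<xi> (One K) \<cdot> bang X, x\<rangle> = x" if "x \<in> Ar E" "Dom E x = X" "Cod E x = \<Xi>" for x X
    using 1[OF that] 3[of x "\<xi> (One K) \<cdot> bang X"] that by auto
  show ?thesis
    unfolding internal_semilattice_def Let_def Xi_slat_simps
  proof (intro conjI ballI)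
  qed (simp_all add: Hom_def 1 2 4 5, rule 3, simp_all)
qed

end

section \<open>From a class of objects to a hyperconnected geometric morphism\<close>

definition full_subcategory :: "('o, 'm) cat \<Rightarrow> 'o set \<Rightarrow> ('o, 'm) cat" where
  "full_subcategory C Q = C\<lparr>Ob := Q, Ar := {f \<in> Ar C. Dom C f \<in> Q \<and> Cod C f \<in> Q}\<rparr>"

lemma full_subcategory_simps [simp]:
  "Ob (full_subcategory C Q) = Q"
  "Ar (full_subcategory C Q) = {f \<in> Ar C. Dom C f \<in> Q \<and> Cod C f \<in> Q}"
  "Dom (full_subcategory C Q) = Dom C" "Cod (full_subcategory C Q) = Cod C"
  "Ident (full_subcategory C Q) = Ident C" "Comp (full_subcategory C Q) = Comp C"
  by (simp_all add: full_subcategory_def)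

lemma Hom_full_subcategory [simp]:
  "\<lbrakk>X \<in> Q; Y \<in> Q\<rbrakk> \<Longrightarrow> Hom (full_subcategory C Q) X Y = Hom C X Y"
  by (auto simp: Hom_def)

lemma (in category) category_full_subcategory:
  assumes "Q \<subseteq> Ob C"
  shows "category (full_subcategory C Q)"
proof
  have [simp]: "X \<in> Q \<Longrightarrow> X \<in> Ob C" for X using assms by auto
  show "X \<in> Ob (full_subcategory C Q) \<Longrightarrow> Ident (full_subcategory C Q) X \<in> Hom (full_subcategory C Q) X X" for X
    by (simp add: Hom_def)
qed (auto simp: Hom_def)

text \<open>
  These are the classes of objects that arise as inverse images of hyperconnected geometric
  morphisms: they are closed under subobjects and finite products, and every object has a largest
  subobject in the class, through which all maps from the class factor.
\<close>

locale hyperconnected_class = topos E K \<Omega> tru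
  for E :: "('o, 'm) cat" (structure) and K :: "('o, 'm) cartesian" and \<Omega> :: 'o and tru :: 'm +
  fixes Q :: "'o set"
  assumes class_subset: "Q \<subseteq> Ob E"
    and class_subobject: "\<lbrakk>monic E m; Cod E m \<in> Q\<rbrakk> \<Longrightarrow> Dom E m \<in> Q"
    and class_One [simp]: "One K \<in> Q"
    and class_Prod [simp]: "\<lbrakk>X \<in> Q; Y \<in> Q\<rbrakk> \<Longrightarrow> Prod K X Y \<in> Q"
    and class_coreflection: "Y \<in> Ob E \<Longrightarrow> \<exists>m. monic E m \<and> Cod E m = Y \<and> Dom E m \<in> Q \<and>
      (\<forall>f \<in> Ar E. Dom E f \<in> Q \<and> Cod E f = Y \<longrightarrow> factors_through E f m)"
begin

abbreviation S :: "('o, 'm) cat" where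
  "S \<equiv> full_subcategory E Q"

lemma class_Ob [simp]: "X \<in> Q \<Longrightarrow> X \<in> Ob E"
  using class_subset by auto

lemma category_S: "category S"
  by (rule category_full_subcategory[OF class_subset])

definition counit :: "'o \<Rightarrow> 'm" where
  "counit Y = (SOME m. monic E m \<and> Cod E m = Y \<and> Dom E m \<in> Q \<and>
      (\<forall>f \<in> Ar E. Dom E f \<in> Q \<and> Cod E f = Y \<longrightarrow> factors_through E f m))"

abbreviation core :: "'o \<Rightarrow> 'o" where
  "core Y \<equiv> Dom E (counit Y)"

lemma counit_props:
  assumes "Y \<in> Ob E"
  shows "monic E (counit Y)" "Cod E (counit Y) = Y" "core Y \<in> Q"
    "\<lbrakk>f \<in> Ar E; Dom E f \<in> Q; Cod E f = Y\<rbrakk> \<Longrightarrow> factors_through E f (counit Y)"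
  using someI_ex[OF class_coreflection[OF assms]] unfolding counit_def[symmetric] by blast+

lemma counit_arrow [simp]:
  "Y \<in> Ob E \<Longrightarrow> counit Y \<in> Ar E" "Y \<in> Ob E \<Longrightarrow> Cod E (counit Y) = Y" "Y \<in> Ob E \<Longrightarrow> core Y \<in> Q"
  "Y \<in> Ob E \<Longrightarrow> core Y \<in> Ob E"
  using counit_props[of Y] monic_arrow by auto

definition lift :: "'m \<Rightarrow> 'm" where
  "lift f = (SOME h. h \<in> Ar E \<and> Dom E h = Dom E f \<and> Cod E h = core (Cod E f) \<and> counit (Cod E f) \<cdot> h = f)"

lemma lift_props [simp]:
  assumes "f \<in> Ar E" "Dom E f \<in> Q"
  shows "lift f \<in> Ar E" "Dom E (lift f) = Dom E f" "Cod E (lift f) = core (Cod E f)"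
    "Cod E f = Y \<Longrightarrow> counit Y \<cdot> lift f = f"
proof -
  have "factors_through E f (counit (Cod E f))" using assms by (intro counit_props(4)) simp_all
  then have "\<exists>h. h \<in> Ar E \<and> Dom E h = Dom E f \<and> Cod E h = core (Cod E f) \<and> counit (Cod E f) \<cdot> h = f"
    by (rule factors_throughE) blast
  from someI_ex[OF this] show "lift f \<in> Ar E" "Dom E (lift f) = Dom E f" "Cod E (lift f) = core (Cod E f)"
    "Cod E f = Y \<Longrightarrow> counit Y \<cdot> lift f = f"
    unfolding lift_def[symmetric] by simp_all
qed

lemma counit_cancel:
  assumes "Y \<in> Ob E" "f \<in> Ar E" "g \<in> Ar E" "Dom E f = Dom E g" "Cod E f = core Y" "Cod E g = core Y"
    "counit Y \<cdot> f = counit Y \<cdot> g"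
  shows "f = g"
  by (rule monic_cancel[OF counit_props(1)[OF assms(1)]]) (use assms in simp_all)

lemma lift_eqI:
  assumes "h \<in> Ar E" "f \<in> Ar E" "Dom E f \<in> Q" "Dom E h = Dom E f" "Cod E h = core (Cod E f)"
    "counit (Cod E f) \<cdot> h = f"
  shows "lift f = h"
  by (rule counit_cancel[of "Cod E f"]) (use assms in simp_all)

lemma is_pullback_S:
  assumes pb: "is_pullback E P p q f g" and PQ: "P \<in> Q" "Dom E f \<in> Q" "Dom E g \<in> Q" "Cod E g \<in> Q"
  shows "is_pullback S P p q f g"
proof -
  note ar = pullback_arrows[OF pb]
  show ?thesis
  proof (rule category.is_pullbackI[OF category_S])
    fix x y
    assume xy: "x \<in> Ar S" "y \<in> Ar S" "Dom S x = Dom S y" "Cod S x = Dom S f" "Cod S y = Dom S g"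
      "f \<cdot>\<^bsub>S\<^esub> x = g \<cdot>\<^bsub>S\<^esub> y"
    obtain u where "u \<in> Ar E" "Dom E u = Dom E x" "Cod E u = P" "p \<cdot> u = x" "q \<cdot> u = y"
      by (rule pullback_lift[OF pb, of x y]) (use xy in simp_all)
    then show "\<exists>u. u \<in> Ar S \<and> Dom S u = Dom S x \<and> Cod S u = P \<and> p \<cdot>\<^bsub>S\<^esub> u = x \<and> q \<cdot>\<^bsub>S\<^esub> u = y"
      using xy(1) PQ(1) by (intro exI[of _ u]) simp
  next
    fix u v
    assume "u \<in> Ar S" "v \<in> Ar S" "Dom S u = Dom S v" "Cod S u = P" "Cod S v = P"
      "p \<cdot>\<^bsub>S\<^esub> u = p \<cdot>\<^bsub>S\<^esub> v" "q \<cdot>\<^bsub>S\<^esub> u = q \<cdot>\<^bsub>S\<^esub> v"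
    then show "u = v" by (intro pullback_unique[OF pb, of u v]) simp_all
  qed (use ar PQ in simp_all)
qed

lemma pullback_corner_in_class:
  assumes pb: "is_pullback E P p q f g" and "Dom E f \<in> Q" "Dom E g \<in> Q"
  shows "P \<in> Q"
  using class_subobject[OF pullback_tuple_monic[OF pb]] pullback_arrows[OF pb] assms(2,3) by simp

lemma pullback_exists_S:
  assumes "f \<in> Ar S" "g \<in> Ar S" "Cod E f = Cod E g"
  obtains P p q where "is_pullback E P p q f g" "is_pullback S P p q f g" "P \<in> Q"
proof -
  obtain P p q where pb: "is_pullback E P p q f g" using pullback_exists[of f g] assms by auto
  moreover have "P \<in> Q" by (rule pullback_corner_in_class[OF pb]) (use assms in simp_all)
  moreover from this have "is_pullback S P p q f g"
    by (rule is_pullback_S[OF pb]) (use assms in simp_all)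
  ultimately show ?thesis using that by blast
qed

text \<open>
  The pullback \<open>P'\<close> in \<open>E\<close> belongs to the class, as a subobject of a product, and so maps to the given
  pullback \<open>P\<close> of the subcategory.  This gives existence of lifts; uniqueness for test objects
  outside the class holds because \<open>\<langle>p, q\<rangle>\<close> is monic on the class, hence monic.
\<close>

lemma pullback_S_is_pullback:
  assumes pb: "is_pullback S P p q f g"
  shows "is_pullback E P p q f g"
proof -
  note ar = category.pullback_arrows[OF category_S pb, simplified]
  note [simp] = ar
  obtain P' p' q' where pb': "is_pullback E P' p' q' f g" "P' \<in> Q"
    by (rule pullback_exists_S[of f g]) simp_all
  note ar' = pullback_arrows[OF pb'(1)]
  note [simp] = ar'(1-10) pb'(2)
  obtain v where v: "v \<in> Ar E" "Dom E v = P'" "Cod E v = P" "p \<cdot> v = p'" "q \<cdot> v = q'"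
    using category.pullback_lift[OF category_S pb, of p' q'] ar'(11) by auto
  have "monic E \<langle>p, q\<rangle>"
  proof (rule monic_if_monic_on_class[of Q])
    fix a b
    assume ab: "a \<in> Ar E" "b \<in> Ar E" "Dom E a \<in> Q" "Dom E a = Dom E b" "Cod E a = Dom E \<langle>p, q\<rangle>"
      "Cod E b = Dom E \<langle>p, q\<rangle>" "\<langle>p, q\<rangle> \<cdot> a = \<langle>p, q\<rangle> \<cdot> b"
    then have "\<langle>p \<cdot> a, q \<cdot> a\<rangle> = \<langle>p \<cdot> b, q \<cdot> b\<rangle>" by simp
    then have "p \<cdot> a = p \<cdot> b \<and> q \<cdot> a = q \<cdot> b" by (rule tuple_inject) (use ab in simp_all)
    then show "a = b"
      using category.pullback_unique[OF category_S pb, of a b] ab by simp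
  qed (use class_subobject in simp_all)
  note mono = monic_cancel[OF this]
  show ?thesis
  proof (rule is_pullbackI)
    fix x y
    assume xy: "x \<in> Ar E" "y \<in> Ar E" "Dom E x = Dom E y" "Cod E x = Dom E f" "Cod E y = Dom E g"
      "f \<cdot> x = g \<cdot> y"
    obtain t where t: "t \<in> Ar E" "Dom E t = Dom E x" "Cod E t = P'" "p' \<cdot> t = x" "q' \<cdot> t = y"
      by (rule pullback_lift[OF pb'(1) xy])
    have "p \<cdot> (v \<cdot> t) = p' \<cdot> t" "q \<cdot> (v \<cdot> t) = q' \<cdot> t"
      unfolding v(4,5)[symmetric] using v(1-3) t(1-3) by simp_all
    then show "\<exists>u. u \<in> Ar E \<and> Dom E u = Dom E x \<and> Cod E u = P \<and> p \<cdot> u = x \<and> q \<cdot> u = y"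
      using v(1-3) t by (intro exI[of _ "v \<cdot> t"]) simp
  next
    fix u w
    assume "u \<in> Ar E" "w \<in> Ar E" "Dom E u = Dom E w" "Cod E u = P" "Cod E w = P"
      "p \<cdot> u = p \<cdot> w" "q \<cdot> u = q \<cdot> w"
    then show "u = w" by (intro mono[of u w]) simp_all
  qed (use ar in simp_all)
qed

lemma is_terminal_One: "is_terminal E (One K)"
  using cartesian by (simp add: cartesian_structure_def)

lemma is_terminal_S_One: "is_terminal S (One K)"
  using is_terminal_One by (simp add: is_terminal_def)

lemma terminal_S_is_terminal:
  assumes t: "is_terminal S t"
  shows "is_terminal E t"
proof -
  have tQ: "t \<in> Q" using t by (simp add: is_terminal_def)
  have ex1: "\<exists>!f. f \<in> Hom E X t" if "X \<in> Q" for X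
    using t that tQ by (simp add: is_terminal_def)
  note [simp] = tQ
  obtain b where b: "b \<in> Ar E" "Dom E b = One K" "Cod E b = t"
    using ex1_implies_ex[OF ex1[of "One K"]] by (auto simp: Hom_def)
  have id: "b \<cdot> bang t = Ident E t"
    by (rule ex1_same[OF ex1[OF tQ]]) (use b in \<open>simp_all add: Hom_def\<close>)
  have eq: "f = b \<cdot> bang X" if "f \<in> Hom E X t" for f X
  proof -
    have f: "f \<in> Ar E" "Dom E f = X" "Cod E f = t" using that by (simp_all add: Hom_def)
    then have "f = (b \<cdot> bang t) \<cdot> f" unfolding id by simp
    also have "\<dots> = b \<cdot> bang X" using f b by simp
    finally show ?thesis .
  qed
  have "\<exists>!f. f \<in> Hom E X t" if "X \<in> Ob E" for X
    by (rule ex1I[of _ "b \<cdot> bang X"], use b that in \<open>simp add: Hom_def\<close>, erule eq)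
  then show ?thesis by (simp add: is_terminal_def)
qed

lemma finitely_complete_S: "finitely_complete S"
  unfolding finitely_complete_def
proof (intro conjI ballI impI)
  show "\<exists>t. is_terminal S t" using is_terminal_S_One by blast
  fix f g assume "f \<in> Ar S" "g \<in> Ar S" "Cod S f = Cod S g"
  then obtain P p q where "is_pullback S P p q f g"
    using pullback_exists_S[of f g] by (metis full_subcategory_simps(4))
  then show "\<exists>P p q. is_pullback S P p q f g" by blast
qed

lemma product_S_is_product:
  assumes pr: "is_product S X Y P p q" and [simp]: "X \<in> Q" "Y \<in> Q"
  shows "is_product E X Y P p q"
proof -
  note ar = category.product_arrows[OF category_S pr, simplified]
  note [simp] = ar
  obtain v where v: "v \<in> Ar E" "Dom E v = Prod K X Y" "Cod E v = P" "p \<cdot> v = Fst K X Y" "q \<cdot> v = Snd K X Y"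
    using category.product_lift[OF category_S pr, of "Fst K X Y" "Snd K X Y" "Prod K X Y"] by auto
  have pv: "p \<cdot> (v \<cdot> w) = Fst K X Y \<cdot> w" "q \<cdot> (v \<cdot> w) = Snd K X Y \<cdot> w"
    if "w \<in> Ar E" "Cod E w = Prod K X Y" for w
    unfolding v(4,5)[symmetric] using v(1-3) that by simp_all
  have id: "v \<cdot> \<langle>p, q\<rangle> = Ident E P"
    by (rule category.product_unique[OF category_S pr]) (use v(1-3) pv in simp_all)
  have "\<exists>!u. u \<in> Hom E T P \<and> p \<cdot> u = x \<and> q \<cdot> u = y" if "x \<in> Hom E T X" "y \<in> Hom E T Y" for T x y
  proof (rule ex1I[of _ "v \<cdot> \<langle>x, y\<rangle>"])
    have xy: "x \<in> Ar E" "Dom E x = T" "Cod E x = X" "y \<in> Ar E" "Dom E y = T" "Cod E y = Y"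
      using that by (simp_all add: Hom_def)
    then show "v \<cdot> \<langle>x, y\<rangle> \<in> Hom E T P \<and> p \<cdot> (v \<cdot> \<langle>x, y\<rangle>) = x \<and> q \<cdot> (v \<cdot> \<langle>x, y\<rangle>) = y"
      using v(1-3) pv by (simp add: Hom_def)
    fix u assume u: "u \<in> Hom E T P \<and> p \<cdot> u = x \<and> q \<cdot> u = y"
    then have u': "u \<in> Ar E" "Cod E u = P" by (simp_all add: Hom_def)
    then have "u = (v \<cdot> \<langle>p, q\<rangle>) \<cdot> u" unfolding id by simp
    also have "\<dots> = v \<cdot> \<langle>p \<cdot> u, q \<cdot> u\<rangle>" using u' v(1-3) by simp
    finally show "u = v \<cdot> \<langle>x, y\<rangle>" using u by simp
  qed
  moreover have "p \<in> Hom E P X" "q \<in> Hom E P Y" by (simp_all add: Hom_def)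
  ultimately show ?thesis unfolding is_product_def using class_Ob[OF ar(1)] by blast
qed

text \<open>
  Maps from the class into \<open>B\<^sup>A\<close> factor uniquely through its coreflection, which is therefore the
  exponential in the subcategory.
\<close>

lemma has_exponentials_S: "has_exponentials S"
  unfolding has_exponentials_def
proof (intro ballI)
  fix A B assume "A \<in> Ob S" "B \<in> Ob S"
  then have [simp]: "A \<in> Q" "B \<in> Q" by simp_all
  obtain X P p q ev where ex: "is_exponential E A B X P p q ev"
    using elementary_topos unfolding elementary_topos_def has_exponentials_def
    by (meson \<open>A \<in> Q\<close> \<open>B \<in> Q\<close> class_Ob)
  have X: "X \<in> Ob E" and P: "is_product E X A P p q" and ev: "ev \<in> Ar E" "Dom E ev = P" "Cod E ev = B"
    using ex by (auto simp: is_exponential_def Hom_def)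
  note [simp] = X ev product_arrows[OF P]
  obtain w where w: "w \<in> Ar E" "Dom E w = Prod K (core X) A" "Cod E w = P"
    "p \<cdot> w = counit X \<cdot> Fst K (core X) A" "q \<cdot> w = Snd K (core X) A"
    by (rule product_lift[OF P, of "counit X \<cdot> Fst K (core X) A" "Snd K (core X) A" "Prod K (core X) A"]) simp_all
  have univ: "\<forall>Z \<in> Ob E. \<forall>Q r s. is_product E Z A Q r s \<longrightarrow> (\<forall>g \<in> Hom E Q B.
        \<exists>!h. h \<in> Hom E Z X \<and>
          (\<exists>u \<in> Hom E Q P. p \<cdot> u = h \<cdot> r \<and> q \<cdot> u = s \<and> ev \<cdot> u = g))"
    using ex unfolding is_exponential_def by (elim conjE)
  let ?ev = "ev \<cdot> w"
  have "is_exponential S A B (core X) (Prod K (core X) A) (Fst K (core X) A) (Snd K (core X) A) ?ev"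
    unfolding is_exponential_def
  proof (intro conjI ballI allI impI)
    show "core X \<in> Ob S" by simp
    show "is_product S (core X) A (Prod K (core X) A) (Fst K (core X) A) (Snd K (core X) A)"
      using Prod_is_product[of "core X" A] by (simp add: is_product_def)
    show "?ev \<in> Hom S (Prod K (core X) A) B" using w(1-3) by (simp add: Hom_def)
    fix Z R r s g
    assume Z: "Z \<in> Ob S" and prS: "is_product S Z A R r s" and g: "g \<in> Hom S R B"
    note arS = category.product_arrows[OF category_S prS, simplified]
    have [simp]: "Z \<in> Q" using Z by simp
    have pr: "is_product E Z A R r s" by (rule product_S_is_product[OF prS]) simp_all
    note [simp] = arS
    have gE: "g \<in> Hom E R B" using g by simp
    have step: "(\<exists>u \<in> Hom S R (Prod K (core X) A). Fst K (core X) A \<cdot>\<^bsub>S\<^esub> u = h \<cdot>\<^bsub>S\<^esub> r \<and>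
          Snd K (core X) A \<cdot>\<^bsub>S\<^esub> u = s \<and> ?ev \<cdot>\<^bsub>S\<^esub> u = g) \<longleftrightarrow>
        (\<exists>u \<in> Hom E R P. p \<cdot> u = (counit X \<cdot> h) \<cdot> r \<and> q \<cdot> u = s \<and> ev \<cdot> u = g)"
      if "h \<in> Hom E Z (core X)" for h
    proof -
      have h: "h \<in> Ar E" "Dom E h = Z" "Cod E h = core X" using that by (simp_all add: Hom_def)
      have "(\<exists>u \<in> Hom E R P. p \<cdot> u = (counit X \<cdot> h) \<cdot> r \<and> q \<cdot> u = s \<and> ev \<cdot> u = g) \<longleftrightarrow>
          ev \<cdot> (w \<cdot> \<langle>h \<cdot> r, s\<rangle>) = g"
        by (rule exponential_comparison[OF P]) (use w h in simp_all)
      moreover have "(\<exists>u \<in> Hom E R (Prod K (core X) A). Fst K (core X) A \<cdot> u = (Ident E (core X) \<cdot> h) \<cdot> r \<and>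
          Snd K (core X) A \<cdot> u = s \<and> ?ev \<cdot> u = g) \<longleftrightarrow> ?ev \<cdot> (Ident E (Prod K (core X) A) \<cdot> \<langle>h \<cdot> r, s\<rangle>) = g"
        by (rule exponential_comparison[OF Prod_is_product]) (use h in simp_all)
      ultimately show ?thesis using h w(1-3) by simp
    qed
    from univ gE pr have ex1: "\<exists>!h. h \<in> Hom E Z X \<and>
          (\<exists>u \<in> Hom E R P. p \<cdot> u = h \<cdot> r \<and> q \<cdot> u = s \<and> ev \<cdot> u = g)"
      by simp
    then obtain h0 where h0: "h0 \<in> Hom E Z X" "\<exists>u \<in> Hom E R P. p \<cdot> u = h0 \<cdot> r \<and> q \<cdot> u = s \<and> ev \<cdot> u = g"
      by (elim ex1E conjE)
    have h0': "h0 \<in> Ar E" "Dom E h0 = Z" "Cod E h0 = X" using h0(1) by (simp_all add: Hom_def)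
    have lift_mem: "lift h0 \<in> Hom E Z (core X)" using h0' by (simp add: Hom_def)
    show "\<exists>!h. h \<in> Hom S Z (core X) \<and> (\<exists>u \<in> Hom S R (Prod K (core X) A).
        Fst K (core X) A \<cdot>\<^bsub>S\<^esub> u = h \<cdot>\<^bsub>S\<^esub> r \<and> Snd K (core X) A \<cdot>\<^bsub>S\<^esub> u = s \<and> ?ev \<cdot>\<^bsub>S\<^esub> u = g)"
    proof (rule ex1I[of _ "lift h0"])
      show "lift h0 \<in> Hom S Z (core X) \<and> (\<exists>u \<in> Hom S R (Prod K (core X) A).
          Fst K (core X) A \<cdot>\<^bsub>S\<^esub> u = lift h0 \<cdot>\<^bsub>S\<^esub> r \<and> Snd K (core X) A \<cdot>\<^bsub>S\<^esub> u = s \<and> ?ev \<cdot>\<^bsub>S\<^esub> u = g)"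
        unfolding step[OF lift_mem] using lift_mem h0(2) h0' by simp
      fix h
      assume h: "h \<in> Hom S Z (core X) \<and> (\<exists>u \<in> Hom S R (Prod K (core X) A).
          Fst K (core X) A \<cdot>\<^bsub>S\<^esub> u = h \<cdot>\<^bsub>S\<^esub> r \<and> Snd K (core X) A \<cdot>\<^bsub>S\<^esub> u = s \<and> ?ev \<cdot>\<^bsub>S\<^esub> u = g)"
      then have h_mem: "h \<in> Hom E Z (core X)" by simp
      have "counit X \<cdot> h = h0"
        by (rule ex1_same[OF ex1])
          (use h h0 h_mem step[OF h_mem] in \<open>simp_all add: Hom_def\<close>)
      then show "h = lift h0"
        using lift_eqI[of h h0] h_mem h0' by (simp add: Hom_def)
    qed
  qed
  then show "\<exists>X P p q ev. is_exponential S A B X P p q ev" by blast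
qed

lemma monic_S:
  assumes "monic S m"
  shows "monic E m"
proof (rule monic_if_monic_on_class[of Q])
  have m: "m \<in> Ar S" using category.monic_arrow[OF category_S assms] .
  then show "m \<in> Ar E" "Dom E m \<in> Q" by simp_all
  fix f g
  assume "f \<in> Ar E" "g \<in> Ar E" "Dom E f \<in> Q" "Dom E f = Dom E g" "Cod E f = Dom E m"
    "Cod E g = Dom E m" "m \<cdot> f = m \<cdot> g"
  then show "f = g" using category.monic_cancel[OF category_S assms, of f g] m by simp
qed (use class_subobject in simp_all)

lemma to_terminal_S: "X \<in> Q \<Longrightarrow> to_terminal S (One K) X = bang X"
  by (simp add: to_terminal_def)

lemma is_characteristic_S_iff:
  assumes m: "monic S m" and \<chi>: "\<chi> \<in> Hom E (Cod E m) (core \<Omega>)"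
  shows "is_characteristic S (One K) (core \<Omega>) (lift tru) m \<chi> \<longleftrightarrow> classifies (counit \<Omega> \<cdot> \<chi>) m"
proof -
  have mS: "m \<in> Ar E" "Dom E m \<in> Q" "Cod E m \<in> Q"
    using category.monic_arrow[OF category_S m] by simp_all
  note [simp] = mS
  have chi [simp]: "\<chi> \<in> Ar E" "Dom E \<chi> = Cod E m" "Cod E \<chi> = core \<Omega>" using \<chi> by (simp_all add: Hom_def)
  have "is_pullback E (Dom E m) m (bang (Dom E m)) (counit \<Omega> \<cdot> \<chi>) (counit \<Omega> \<cdot> lift tru) \<longleftrightarrow>
      is_pullback E (Dom E m) m (bang (Dom E m)) \<chi> (lift tru)"
    by (rule pullback_postcomp_monic[OF counit_props(1)]) simp_all
  moreover have "is_pullback S (Dom E m) m (bang (Dom E m)) \<chi> (lift tru) \<longleftrightarrow>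
      is_pullback E (Dom E m) m (bang (Dom E m)) \<chi> (lift tru)"
    using pullback_S_is_pullback is_pullback_S[of "Dom E m" m "bang (Dom E m)" \<chi> "lift tru"] by auto
  ultimately show ?thesis
    by (simp add: is_characteristic_def to_terminal_S Hom_def)
qed

text \<open>
  For the same reason the coreflection of \<open>\<Omega>\<close> classifies the subobjects in the subcategory, with the
  lift of \<open>true\<close> as its universal subobject.
\<close>

lemma subobject_classifier_S: "subobject_classifier S (One K) (core \<Omega>) (lift tru)"
proof -
  have "\<exists>!\<chi>. is_characteristic S (One K) (core \<Omega>) (lift tru) m \<chi>" if m: "monic S m" for m
  proof -
    have mS: "m \<in> Ar E" "Dom E m \<in> Q" "Cod E m \<in> Q"
      using category.monic_arrow[OF category_S m] by simp_all
    let ?c = "characteristic E (One K) \<Omega> tru m"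
    have c: "classifies ?c m" by (rule classifies_characteristic[OF monic_S[OF m]])
    note ca = classifies_arrow[OF c]
    have Hom: "\<chi> \<in> Hom E (Cod E m) (core \<Omega>)"
      if "is_characteristic S (One K) (core \<Omega>) (lift tru) m \<chi>" for \<chi>
      using that mS by (simp add: is_characteristic_def)
    show ?thesis
    proof (rule ex1I[of _ "lift ?c"])
      have "lift ?c \<in> Hom E (Cod E m) (core \<Omega>)" using ca mS by (simp add: Hom_def)
      then show "is_characteristic S (One K) (core \<Omega>) (lift tru) m (lift ?c)"
        using is_characteristic_S_iff[OF m] c ca mS by simp
      fix \<chi> assume ch: "is_characteristic S (One K) (core \<Omega>) (lift tru) m \<chi>"
      have "counit \<Omega> \<cdot> \<chi> = ?c"
        using is_characteristic_S_iff[OF m Hom[OF ch]] ch c classifies_unique[OF monic_S[OF m]] by blast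
      then show "\<chi> = lift ?c"
        using lift_eqI[of \<chi> ?c] Hom[OF ch] ca mS by (simp add: Hom_def)
    qed
  qed
  moreover have "lift tru \<in> Hom E (One K) (core \<Omega>)" by (simp add: Hom_def)
  ultimately show ?thesis
    unfolding subobject_classifier_def using is_terminal_S_One by simp
qed

lemma elementary_topos_S: "elementary_topos S"
  unfolding elementary_topos_def
  using category_S finitely_complete_S has_exponentials_S subobject_classifier_S by blast

abbreviation core_functor :: "('o, 'm, 'o, 'm) cfunctor" where
  "core_functor \<equiv> \<lparr>OMap = core, AMap = (\<lambda>g. lift (g \<cdot> counit (Dom E g)))\<rparr>"

definition geom :: "('o, 'm, 'o, 'm) geom" where
  "geom = \<lparr>Codomain = S, Inverse_Image = inclusion_functor,
     Direct_Image = core_functor,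
     Unit = (\<lambda>X. lift (Ident E X)), Counit = counit\<rparr>"

lemma geom_simps [simp]:
  "Codomain geom = S" "Inverse_Image geom = inclusion_functor"
  "Direct_Image geom = core_functor"
  "Unit geom = (\<lambda>X. lift (Ident E X))" "Counit geom = counit"
  by (simp_all add: geom_def)

lemma inclusion_simps [simp]: "OMap inclusion_functor X = X" "AMap inclusion_functor f = f"
  by (simp_all add: inclusion_functor_def)

lemma category_E: "category E" ..

lemma is_functor_inclusion: "is_functor S E inclusion_functor"
proof (intro is_functor.intro is_functor_axioms.intro)
qed (auto simp: category_S category_E Hom_def)

lemma is_functor_core: "is_functor E S core_functor"
proof (intro is_functor.intro is_functor_axioms.intro)
  fix f g X Y Z
  assume "f \<in> Hom E X Y" "g \<in> Hom E Y Z"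
  then have fg: "f \<in> Ar E" "Dom E f = X" "Cod E f = Y" "g \<in> Ar E" "Dom E g = Y" "Cod E g = Z"
    by (simp_all add: Hom_def)
  then have [simp]: "X \<in> Ob E" "Y \<in> Ob E" "Z \<in> Ob E" by auto
  have "counit Z \<cdot> (lift (g \<cdot> counit Y) \<cdot> lift (f \<cdot> counit X)) =
      (counit Z \<cdot> lift (g \<cdot> counit Y)) \<cdot> lift (f \<cdot> counit X)"
    using fg by (simp del: lift_props(4))
  also have "\<dots> = g \<cdot> (counit Y \<cdot> lift (f \<cdot> counit X))" using fg by (simp del: lift_props(4) add: lift_props(4)[of "g \<cdot> counit Y"])
  also have "\<dots> = (g \<cdot> f) \<cdot> counit X" using fg by simp
  finally show "AMap core_functor (g \<cdot> f) =
      AMap core_functor g \<cdot>\<^bsub>S\<^esub>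
      AMap core_functor f"
    using fg by (simp add: lift_eqI)
next
  fix X assume "X \<in> Ob E"
  then show "AMap core_functor (Ident E X) =
      Ident S (OMap core_functor X)"
    by (simp add: lift_eqI)
qed (auto simp: category_S category_E Hom_def)

lemma adjunction_geom:
  "adjunction S E inclusion_functor (Direct_Image geom) (Unit geom) (Counit geom)"
  unfolding adjunction_def geom_simps
proof (intro conjI ballI)
  show "is_functor S E inclusion_functor" by (rule is_functor_inclusion)
  show "is_functor E S core_functor" by (rule is_functor_core)
next
  fix f assume "f \<in> Ar S"
  then have [simp]: "f \<in> Ar E" "Dom E f \<in> Q" "Cod E f \<in> Q" by simp_all
  have c: "counit (Cod E f) \<cdot> (a \<cdot> b) = (counit (Cod E f) \<cdot> a) \<cdot> b"
    if "a \<in> Ar E" "b \<in> Ar E" "Cod E a = core (Cod E f)" "Dom E a = Cod E b" for a b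
    using that by simp
  show "lift (Ident E (Cod S f)) \<cdot>\<^bsub>S\<^esub> f =
      AMap core_functor (AMap inclusion_functor f) \<cdot>\<^bsub>S\<^esub>
      lift (Ident E (Dom S f))"
    by (rule counit_cancel[of "Cod E f"]) (simp_all add: c del: comp_assoc_arrow, simp)
next
  fix Y assume [simp]: "Y \<in> Ob E"
  have "counit Y \<cdot> (lift (counit Y \<cdot> counit (core Y)) \<cdot> lift (Ident E (core Y))) =
      (counit Y \<cdot> lift (counit Y \<cdot> counit (core Y))) \<cdot> lift (Ident E (core Y))"
    by (simp del: lift_props(4))
  also have "\<dots> = counit Y \<cdot> (counit (core Y) \<cdot> lift (Ident E (core Y)))"
    by (simp del: lift_props(4) add: lift_props(4)[of "counit Y \<cdot> counit (core Y)"])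
  also have "\<dots> = counit Y \<cdot> Ident E (core Y)" by simp
  finally have "lift (counit Y \<cdot> counit (core Y)) \<cdot> lift (Ident E (core Y)) = Ident E (core Y)"
    by (rule counit_cancel[rotated 6]) simp_all
  then show "AMap core_functor (counit Y) \<cdot>\<^bsub>S\<^esub>
      lift (Ident E (OMap core_functor Y)) =
      Ident S (OMap core_functor Y)"
    by simp
qed (auto simp: Hom_def)

lemma isomorphic_in_class:
  assumes "isomorphic E X Y" "X \<in> Q"
  shows "Y \<in> Q"
proof -
  obtain f g where fg: "f \<in> Hom E X Y" "g \<in> Hom E Y X" "f \<cdot> g = Ident E Y"
    using assms(1) by (auto simp: isomorphic_def)
  have "monic E g" by (rule split_monic[of g f]) (use fg in \<open>simp_all add: Hom_def\<close>)
  then show ?thesis using class_subobject[of g] fg(2) assms(2) by (simp add: Hom_def)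
qed

lemma inv_image_objects_geom: "inv_image_objects E geom = Q"
proof -
  have "isomorphic E X X" if "X \<in> Q" for X
    unfolding isomorphic_def using that by (intro bexI[of _ "Ident E X"]) (simp_all add: Hom_def)
  then show ?thesis
    using isomorphic_in_class by (auto simp: inv_image_objects_def ess_image_def)
qed

lemma hyperconnected_geom: "hyperconnected E geom"
proof -
  have "left_exact S E inclusion_functor"
    using terminal_S_is_terminal pullback_S_is_pullback by (simp add: left_exact_def)
  moreover have "full S E inclusion_functor" "faithful S inclusion_functor"
    by (auto simp: full_def faithful_def inj_on_def)
  ultimately show ?thesis
    using elementary_topos elementary_topos_S adjunction_geom class_subobject
    by (simp add: hyperconnected_def geometric_morphism_def inv_image_objects_geom)
qed

end

section \<open>From a hyperconnected geometric morphism to a class of objects\<close>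

context topos
begin

text \<open>
  By left exactness of \<open>L\<close> the terminal object and the products of objects of the essential image
  \<open>Q\<close> embed into objects of \<open>Q\<close>, and \<open>Q\<close> is closed under subobjects.  For the coreflection the counit
  \<open>\<epsilon> Y : L (R Y) \<rightarrow> Y\<close> is used.  Maps from \<open>Q\<close> factor through it by transposition; they do so
  uniquely since \<open>L\<close> is full and a map \<open>a : A \<rightarrow> R Y\<close> is recovered from \<open>\<epsilon> Y \<cdot> L a\<close>.  So \<open>\<epsilon> Y\<close> is monic
  on \<open>Q\<close> and hence monic.
\<close>

lemma hyperconnected_class_inv_image:
  fixes g :: "('o, 'm, 'p, 'n) geom"
  assumes hyp: "hyperconnected E g"
  shows "hyperconnected_class E K \<Omega> tru (inv_image_objects E g)"
proof -
  define F L R \<eta> \<epsilon> where "F = Codomain g" "L = Inverse_Image g" "R = Direct_Image g"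
    "\<eta> = Unit g" "\<epsilon> = Counit g"
  note defs = this
  define Q where "Q = inv_image_objects E g"
  have adj: "adjunction F E L R \<eta> \<epsilon>" and topF: "elementary_topos F" and lex: "left_exact F E L"
    and full: "full F E L"
    and sub: "\<And>m. \<lbrakk>monic E m; Cod E m \<in> Q\<rbrakk> \<Longrightarrow> Dom E m \<in> Q"
    using hyp by (auto simp: hyperconnected_def geometric_morphism_def defs Q_def)
  have funL: "is_functor F E L" and funR: "is_functor E F R" using adj by (simp_all add: adjunction_def)
  have unit: "\<eta> X \<in> Hom F X (OMap R (OMap L X))" if "X \<in> Ob F" for X
    using adj that by (simp add: adjunction_def)
  have unit_nat: "\<eta> (Cod F f) \<cdot>\<^bsub>F\<^esub> f = AMap R (AMap L f) \<cdot>\<^bsub>F\<^esub> \<eta> (Dom F f)" if "f \<in> Ar F" for f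
    using adj that by (simp add: adjunction_def)
  have counit: "\<epsilon> Y \<in> Hom E (OMap L (OMap R Y)) Y" if "Y \<in> Ob E" for Y
    using adj that by (simp add: adjunction_def)
  have counit_nat: "\<epsilon> (Cod E f) \<cdot> AMap L (AMap R f) = f \<cdot> \<epsilon> (Dom E f)" if "f \<in> Ar E" for f
    using adj that by (simp add: adjunction_def)
  have tri1: "\<epsilon> (OMap L X) \<cdot> AMap L (\<eta> X) = Ident E (OMap L X)" if "X \<in> Ob F" for X
    using adj that by (simp add: adjunction_def)
  have tri2: "AMap R (\<epsilon> Y) \<cdot>\<^bsub>F\<^esub> \<eta> (OMap R Y) = Ident F (OMap R Y)" if "Y \<in> Ob E" for Y
    using adj that by (simp add: adjunction_def)
  have catF: "category F" using topF by (simp add: elementary_topos_def)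
  note LOb [simp] = is_functor.OMap_in_Ob[OF funL] and LHom = is_functor.AMap_in_Hom[OF funL]
    and Lcomp = is_functor.AMap_comp[OF funL]
  note ROb [simp] = is_functor.OMap_in_Ob[OF funR] and RHom = is_functor.AMap_in_Hom[OF funR]
    and Rcomp = is_functor.AMap_comp[OF funR]
  have Q_eq: "Q = {Y \<in> Ob E. \<exists>X \<in> Ob F. isomorphic E (OMap L X) Y}"
    by (simp add: Q_def inv_image_objects_def ess_image_def defs)
  have LQ: "OMap L A \<in> Q" if "A \<in> Ob F" for A
  proof -
    have "isomorphic E (OMap L A) (OMap L A)"
      unfolding isomorphic_def using that by (intro bexI[of _ "Ident E (OMap L A)"]) (simp_all add: Hom_def)
    then show ?thesis using that by (auto simp: Q_eq)
  qed
  have isoQ: "\<exists>A i j. A \<in> Ob F \<and> i \<in> Ar E \<and> Dom E i = OMap L A \<and> Cod E i = X \<and>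
      j \<in> Ar E \<and> Dom E j = X \<and> Cod E j = OMap L A \<and> i \<cdot> j = Ident E X" if "X \<in> Q" for X
    using that by (auto simp: Q_eq isomorphic_def Hom_def)
  obtain t where t: "is_terminal F t" using topF by (auto simp: elementary_topos_def finitely_complete_def)
  have tOb: "t \<in> Ob F" using t by (simp add: is_terminal_def)
  have Lt: "is_terminal E (OMap L t)" using lex t by (simp add: left_exact_def)
  have One: "One K \<in> Q"
  proof -
    obtain b where "b \<in> Hom E (One K) (OMap L t)" by (rule terminal_arrow_exists[OF Lt One_Ob])
    then have b: "b \<in> Ar E" "Dom E b = One K" "Cod E b = OMap L t" by (simp_all add: Hom_def)
    then show ?thesis using sub[OF from_One_monic[of b]] LQ[OF tOb] by simp
  qed
  have prod: "Prod K X Y \<in> Q" if "X \<in> Q" "Y \<in> Q" for X Y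
  proof -
    obtain A i j where A: "A \<in> Ob F" and i: "i \<in> Ar E" "Dom E i = OMap L A" "Cod E i = X"
      and j: "j \<in> Ar E" "Dom E j = X" "Cod E j = OMap L A" and ij: "i \<cdot> j = Ident E X"
      using isoQ[OF \<open>X \<in> Q\<close>] by blast
    obtain B i' j' where B: "B \<in> Ob F" and i': "i' \<in> Ar E" "Dom E i' = OMap L B" "Cod E i' = Y"
      and j': "j' \<in> Ar E" "Dom E j' = Y" "Cod E j' = OMap L B" and ij': "i' \<cdot> j' = Ident E Y"
      using isoQ[OF \<open>Y \<in> Q\<close>] by blast
    have XY [simp]: "X \<in> Ob E" "Y \<in> Ob E" using that by (simp_all add: Q_eq)
    have jm: "monic E j" "monic E j'"
      using split_monic[of j i] split_monic[of j' i'] i j ij i' j' ij' by simp_all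
    obtain a where "a \<in> Hom F A t" by (rule terminal_arrow_exists[OF t A])
    moreover obtain b where "b \<in> Hom F B t" by (rule terminal_arrow_exists[OF t B])
    ultimately
    have ab: "a \<in> Ar F" "Dom F a = A" "Cod F a = t" "b \<in> Ar F" "Dom F b = B" "Cod F b = t"
      and La: "AMap L a \<in> Hom E (OMap L A) (OMap L t)" and Lb: "AMap L b \<in> Hom E (OMap L B) (OMap L t)"
      using LHom by (simp_all add: Hom_def)
    have "\<exists>P p q. is_pullback F P p q a b"
      using topF ab unfolding elementary_topos_def finitely_complete_def by simp
    then obtain P p q where pb: "is_pullback F P p q a b" by blast
    have POb: "P \<in> Ob F" using category.pullback_arrows(4)[OF catF pb] .
    have pbL: "is_pullback E (OMap L P) (AMap L p) (AMap L q) (AMap L a) (AMap L b)"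
      using lex pb by (simp add: left_exact_def)
    note ar = pullback_arrows[OF pbL]
    note Lar = La[unfolded Hom_def, simplified] Lb[unfolded Hom_def, simplified]
    have eq: "AMap L a \<cdot> (j \<cdot> Fst K X Y) = AMap L b \<cdot> (j' \<cdot> Snd K X Y)"
      by (rule terminal_unique[OF Lt]) (use Lar j j' in simp_all)
    obtain u where u: "u \<in> Ar E" "Dom E u = Prod K X Y" "Cod E u = OMap L P"
      "AMap L p \<cdot> u = j \<cdot> Fst K X Y" "AMap L q \<cdot> u = j' \<cdot> Snd K X Y"
      using pullback_lift[OF pbL _ _ _ _ _ eq] Lar j j' by auto
    have "\<langle>AMap L p, AMap L q\<rangle> \<cdot> u = j \<otimes> j'"
      using u ar j j' by (simp add: prod_map_def)
    then have "monic E (\<langle>AMap L p, AMap L q\<rangle> \<cdot> u)" using prod_map_monic[OF jm] by simp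
    then have "monic E u" by (rule monic_if_comp_monic) (use u ar in simp_all)
    then show ?thesis using sub[of u] u LQ[OF POb] by simp
  qed
  have corefl: "\<exists>m. monic E m \<and> Cod E m = Y \<and> Dom E m \<in> Q \<and>
      (\<forall>f \<in> Ar E. Dom E f \<in> Q \<and> Cod E f = Y \<longrightarrow> factors_through E f m)" if Y: "Y \<in> Ob E" for Y
  proof (intro exI[of _ "\<epsilon> Y"] conjI ballI impI)
    have e: "\<epsilon> Y \<in> Ar E" "Dom E (\<epsilon> Y) = OMap L (OMap R Y)" "Cod E (\<epsilon> Y) = Y"
      using counit[OF Y] by (simp_all add: Hom_def)
    show "Cod E (\<epsilon> Y) = Y" by (rule e)
    show eQ: "Dom E (\<epsilon> Y) \<in> Q" using LQ[of "OMap R Y"] e Y by simp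
    \<comment> \<open>A map is recovered from its transpose: naturality of the unit and a triangle identity.\<close>
    have transpose: "a = AMap R (\<epsilon> Y \<cdot> AMap L a) \<cdot>\<^bsub>F\<^esub> \<eta> A" if a: "a \<in> Hom F A (OMap R Y)" for a A
    proof -
      have a': "a \<in> Ar F" "Dom F a = A" "Cod F a = OMap R Y" "A \<in> Ob F"
        using a category.arrow_ends[OF catF] by (auto simp: Hom_def)
      have RL: "AMap R (AMap L a) \<in> Hom F (OMap R (OMap L A)) (OMap R (OMap L (OMap R Y)))"
        by (intro RHom LHom a)
      have Re: "AMap R (\<epsilon> Y) \<in> Hom F (OMap R (OMap L (OMap R Y))) (OMap R Y)"
        by (intro RHom counit Y)
      have "a = Ident F (OMap R Y) \<cdot>\<^bsub>F\<^esub> a"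
        using category.comp_ident_left[OF catF a] by simp
      also have "\<dots> = AMap R (\<epsilon> Y) \<cdot>\<^bsub>F\<^esub> (\<eta> (OMap R Y) \<cdot>\<^bsub>F\<^esub> a)"
        unfolding tri2[OF Y, symmetric]
        by (rule category.comp_assoc[OF catF a unit Re]) (simp add: Y)
      also have "\<dots> = AMap R (\<epsilon> Y) \<cdot>\<^bsub>F\<^esub> (AMap R (AMap L a) \<cdot>\<^bsub>F\<^esub> \<eta> A)"
        using unit_nat[OF a'(1)] a' by simp
      also have "\<dots> = (AMap R (\<epsilon> Y) \<cdot>\<^bsub>F\<^esub> AMap R (AMap L a)) \<cdot>\<^bsub>F\<^esub> \<eta> A"
        by (rule category.comp_assoc[OF catF unit[OF a'(4)] RL Re, symmetric])
      also have "\<dots> = AMap R (\<epsilon> Y \<cdot> AMap L a) \<cdot>\<^bsub>F\<^esub> \<eta> A"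
        using Rcomp[OF LHom[OF a] counit[OF Y]] by simp
      finally show ?thesis .
    qed
    show "monic E (\<epsilon> Y)"
    proof (rule monic_if_monic_on_class[of Q])
      show "\<epsilon> Y \<in> Ar E" "Dom E (\<epsilon> Y) \<in> Q" by fact+
      fix u v
      assume uv: "u \<in> Ar E" "v \<in> Ar E" "Dom E u \<in> Q" "Dom E u = Dom E v" "Cod E u = Dom E (\<epsilon> Y)"
        "Cod E v = Dom E (\<epsilon> Y)" "\<epsilon> Y \<cdot> u = \<epsilon> Y \<cdot> v"
      obtain A i j where A: "A \<in> Ob F" and i: "i \<in> Ar E" "Dom E i = OMap L A" "Cod E i = Dom E v"
        and j: "j \<in> Ar E" "Dom E j = Dom E v" "Cod E j = OMap L A" and ij: "i \<cdot> j = Ident E (Dom E v)"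
        using isoQ[OF uv(3)] uv(4) by metis
      have "u \<cdot> i \<in> Hom E (OMap L A) (OMap L (OMap R Y))" "v \<cdot> i \<in> Hom E (OMap L A) (OMap L (OMap R Y))"
        using uv i e by (simp_all add: Hom_def)
      then obtain a b where a: "a \<in> Hom F A (OMap R Y)" "AMap L a = u \<cdot> i"
        and b: "b \<in> Hom F A (OMap R Y)" "AMap L b = v \<cdot> i"
        using full A ROb[OF Y] unfolding full_def by metis
      have "\<epsilon> Y \<cdot> (u \<cdot> i) = \<epsilon> Y \<cdot> (v \<cdot> i)"
        by (rule comp_eq_precomp[OF uv(7)]) (use uv e i in simp_all)
      then have "a = b" using transpose[OF a(1)] transpose[OF b(1)] a(2) b(2) by simp
      then have ui: "u \<cdot> i = v \<cdot> i" using a b by simp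
      have "u \<cdot> (i \<cdot> j) = v \<cdot> (i \<cdot> j)"
        by (rule comp_eq_precomp[OF ui]) (use uv i j in simp_all)
      then show "u = v" using ij uv by simp
    qed (use sub prod in simp_all)
    fix f assume f: "f \<in> Ar E" and fQ: "Dom E f \<in> Q \<and> Cod E f = Y"
    then obtain A i j where A: "A \<in> Ob F" and i: "i \<in> Ar E" "Dom E i = OMap L A" "Cod E i = Dom E f"
      and j: "j \<in> Ar E" "Dom E j = Dom E f" "Cod E j = OMap L A" and ij: "i \<cdot> j = Ident E (Dom E f)"
      using isoQ by metis
    have [simp]: "Cod E f = Y" using fQ by simp
    have fi: "f \<cdot> i \<in> Hom E (OMap L A) Y" "f \<cdot> i \<in> Ar E" using f i by (simp_all add: Hom_def)
    have Rfi: "AMap R (f \<cdot> i) \<in> Hom F (OMap R (OMap L A)) (OMap R Y)" by (rule RHom[OF fi(1)])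
    let ?h = "AMap L (AMap R (f \<cdot> i)) \<cdot> AMap L (\<eta> A)"
    have LR: "AMap L (AMap R (f \<cdot> i)) \<in> Ar E" "Dom E (AMap L (AMap R (f \<cdot> i))) = OMap L (OMap R (OMap L A))"
      "Cod E (AMap L (AMap R (f \<cdot> i))) = OMap L (OMap R Y)"
      using LHom[OF Rfi] by (simp_all add: Hom_def)
    have Le: "AMap L (\<eta> A) \<in> Ar E" "Dom E (AMap L (\<eta> A)) = OMap L A"
      "Cod E (AMap L (\<eta> A)) = OMap L (OMap R (OMap L A))"
      using LHom[OF unit[OF A]] by (simp_all add: Hom_def)
    have eLA: "\<epsilon> (OMap L A) \<in> Ar E" "Dom E (\<epsilon> (OMap L A)) = OMap L (OMap R (OMap L A))"
      "Cod E (\<epsilon> (OMap L A)) = OMap L A"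
      using counit[OF LOb[OF A]] by (simp_all add: Hom_def)
    have nat: "\<epsilon> Y \<cdot> AMap L (AMap R (f \<cdot> i)) = (f \<cdot> i) \<cdot> \<epsilon> (OMap L A)"
      using counit_nat[OF fi(2)] f i by simp
    have "\<epsilon> Y \<cdot> ?h = (f \<cdot> i) \<cdot> (\<epsilon> (OMap L A) \<cdot> AMap L (\<eta> A))"
      by (rule comp_eq_precomp[OF nat]) (use e LR Le eLA f i in simp_all)
    also have "\<dots> = f \<cdot> i" unfolding tri1[OF A] using f i A by simp
    finally have h: "\<epsilon> Y \<cdot> ?h = f \<cdot> i" .
    have "\<epsilon> Y \<cdot> (?h \<cdot> j) = f \<cdot> (i \<cdot> j)"
      by (rule comp_eq_precomp[OF h]) (use e LR Le f i j in simp_all)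
    also have "\<dots> = f" unfolding ij using f by simp
    finally show "factors_through E f (\<epsilon> Y)"
      by (rule factors_throughI[rotated 3]) (use e LR Le f i j in simp_all)
  qed
  show ?thesis
  proof (fold Q_def, unfold_locales)
    show "Q \<subseteq> Ob E" by (auto simp: Q_eq)
  qed (fact sub One prod corefl)+
qed

end

section \<open>Filters of local states and classes of objects\<close>

context local_states
begin

definition filter_class :: "'m \<Rightarrow> 'o set" where
  "filter_class k = {X \<in> Ob E. factors_through E (\<xi> X) k}"

text \<open>
  This is where upward closure enters.  For any \<open>f : X \<rightarrow> Y\<close> the graph \<open>\<langle>id, f\<rangle> : X \<rightarrow> X \<times> Y\<close> is monic,
  so \<open>\<xi> X = \<xi> (X \<times> Y) \<cdot> \<langle>id, f\<rangle> = \<xi> X \<and> (\<xi> Y \<cdot> f)\<close>, that is, \<open>\<xi> X \<le> \<xi> Y \<cdot> f\<close>.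
\<close>

lemma filter_arrow_from_class:
  assumes F: "internal_filter E K Xi_slat k" and f: "f \<in> Ar E" "Dom E f \<in> filter_class k"
  shows "factors_through E (\<xi> (Cod E f) \<cdot> f) k"
proof -
  let ?X = "Dom E f"
  have m: "monic E \<langle>Ident E ?X, f\<rangle>" by (intro tuple_monic_left ident_monic) (use f in simp_all)
  have "Xi_meet \<cdot> \<langle>\<xi> ?X \<cdot> Ident E ?X, \<xi> (Cod E f) \<cdot> f\<rangle> = \<xi> (Prod K ?X (Cod E f)) \<cdot> \<langle>Ident E ?X, f\<rangle>"
    by (rule Xi_meet_tuple) (use f in simp_all)
  also have "\<dots> = \<xi> ?X" using xi_monic[OF m] f by simp
  finally have "factors_through E (Xi_meet \<cdot> \<langle>\<xi> ?X, \<xi> (Cod E f) \<cdot> f\<rangle>) k"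
    using f by (simp add: filter_class_def)
  then show ?thesis
    using filter_meet_iff[OF F, of "\<xi> ?X" "\<xi> (Cod E f) \<cdot> f"] f(1) by simp
qed

text \<open>
  The coreflection of \<open>Y\<close> is the inverse image of the filter along \<open>\<xi> Y\<close>; maps from the class factor
  through it by \<open>filter_arrow_from_class\<close>.
\<close>

lemma hyperconnected_class_of_filter:
  assumes F: "internal_filter E K Xi_slat k"
  shows "hyperconnected_class E K \<Omega> tru (filter_class k)"
proof unfold_locales
  have k: "monic E k" and Codk [simp]: "Cod E k = \<Xi>" and top: "factors_through E (\<xi> (One K)) k"
    using F by (auto simp: internal_filter_def)
  note [simp] = monic_arrow[OF k]
  show "filter_class k \<subseteq> Ob E" by (auto simp: filter_class_def)
  show "One K \<in> filter_class k" using top by (simp add: filter_class_def)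
  show "Dom E m \<in> filter_class k" if m: "monic E m" "Cod E m \<in> filter_class k" for m
    using factors_through_precomp[of "\<xi> (Cod E m)" k m] m monic_arrow[OF m(1)] xi_monic[OF m(1)]
    by (simp add: filter_class_def)
  show "Prod K X Y \<in> filter_class k" if XY: "X \<in> filter_class k" "Y \<in> filter_class k" for X Y
  proof -
    have [simp]: "X \<in> Ob E" "Y \<in> Ob E" using XY by (simp_all add: filter_class_def)
    have fac: "factors_through E (\<xi> X \<cdot> Fst K X Y) k" "factors_through E (\<xi> Y \<cdot> Snd K X Y) k"
      using XY by (auto simp: filter_class_def intro!: factors_through_precomp)
    have "Xi_meet \<cdot> \<langle>\<xi> X \<cdot> Fst K X Y, \<xi> Y \<cdot> Snd K X Y\<rangle> = \<xi> (Prod K X Y) \<cdot> \<langle>Fst K X Y, Snd K X Y\<rangle>"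
      by (rule Xi_meet_tuple) simp_all
    also have "\<dots> = \<xi> (Prod K X Y)" by (simp add: tuple_projections_ident)
    finally show ?thesis
      using fac filter_meet_iff[OF F, of "\<xi> X \<cdot> Fst K X Y" "\<xi> Y \<cdot> Snd K X Y"] by (simp add: filter_class_def)
  qed
  show "\<exists>m. monic E m \<and> Cod E m = Y \<and> Dom E m \<in> filter_class k \<and>
      (\<forall>f \<in> Ar E. Dom E f \<in> filter_class k \<and> Cod E f = Y \<longrightarrow> factors_through E f m)" if Y: "Y \<in> Ob E" for Y
  proof -
    obtain P m q where pb: "is_pullback E P m q (\<xi> Y) k"
      using pullback_exists[of "\<xi> Y" k] Y by auto
    note ar = pullback_arrows[OF pb]
    have m: "monic E m" by (rule pullback_monic[OF pb k])
    have "\<xi> P = k \<cdot> q" using xi_monic[OF m] ar Y by simp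
    then have "factors_through E (\<xi> P) k"
      using ar by (intro factors_throughI[of q]) simp_all
    moreover have "factors_through E f m" if f: "f \<in> Ar E" "Dom E f \<in> filter_class k" "Cod E f = Y" for f
    proof -
      have "factors_through E (\<xi> Y \<cdot> f) k" using filter_arrow_from_class[OF F f(1,2)] f(3) by simp
      then obtain h where h: "h \<in> Ar E" "Dom E h = Dom E (\<xi> Y \<cdot> f)" "Cod E h = Dom E k" "k \<cdot> h = \<xi> Y \<cdot> f"
        by (rule factors_throughE)
      obtain u where "u \<in> Ar E" "Dom E u = Dom E f" "Cod E u = P" "m \<cdot> u = f"
        by (rule pullback_lift[OF pb f(1) h(1) _ _ h(3) h(4)[symmetric]]) (use f h Y in simp_all)
      then show ?thesis using ar by (intro factors_throughI[of u]) simp_all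
    qed
    ultimately show ?thesis using m ar Y by (intro exI[of _ m]) (simp add: filter_class_def)
  qed
qed

text \<open>
  A filter is recovered from its class: a generalized element \<open>x\<close> of \<open>X\<close> satisfies \<open>\<xi> X \<cdot> x \<in> k\<close> exactly
  when \<open>x\<close> factors through a subobject of \<open>X\<close> that belongs to the class of \<open>k\<close>, and the elements
  \<open>\<xi> X \<cdot> x\<close> suffice to determine the characteristic morphism.
\<close>

lemma filter_class_inject:
  assumes k: "internal_filter E K Xi_slat k" and l: "internal_filter E K Xi_slat l"
    and sub: "filter_class k = filter_class l"
  shows "characteristic E (One K) \<Omega> tru k = characteristic E (One K) \<Omega> tru l"
proof -
  have le: "factors_through E (\<xi> X \<cdot> x) l"
    if k: "monic E k" "Cod E k = \<Xi>" and l: "monic E l" and sub: "filter_class k = filter_class l"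
      and x: "x \<in> Ar E" "Cod E x = X" "factors_through E (\<xi> X \<cdot> x) k" for X x k l
  proof -
    have X [simp]: "X \<in> Ob E" using x by auto
    obtain h where h: "h \<in> Ar E" "Dom E h = Dom E (\<xi> X \<cdot> x)" "Cod E h = Dom E k" "k \<cdot> h = \<xi> X \<cdot> x"
      using x(3) by (rule factors_throughE)
    obtain P m q where pb: "is_pullback E P m q (\<xi> X) k"
      using pullback_exists[of "\<xi> X" k] k monic_arrow by auto
    note ar = pullback_arrows[OF pb]
    have m: "monic E m" by (rule pullback_monic[OF pb k(1)])
    have xiP: "\<xi> P = \<xi> X \<cdot> m" using xi_monic[OF m] ar by simp
    then have "factors_through E (\<xi> P) k"
      using ar by (intro factors_throughI[of q]) simp_all
    then have "P \<in> filter_class l" using ar sub by (auto simp: filter_class_def)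
    then have P: "factors_through E (\<xi> P) l" by (simp add: filter_class_def)
    obtain u where u: "u \<in> Ar E" "Dom E u = Dom E x" "Cod E u = P" "m \<cdot> u = x"
      by (rule pullback_lift[OF pb x(1) h(1) _ _ h(3) h(4)[symmetric]]) (use x h in simp_all)
    have "\<xi> P \<cdot> u = \<xi> X \<cdot> (m \<cdot> u)" unfolding xiP using u(1-3) ar(1-10) by simp
    also have "\<dots> = \<xi> X \<cdot> x" unfolding u(4) ..
    finally show ?thesis
      using factors_through_precomp[OF P, of u] monic_arrow[OF l] u ar(4) by simp
  qed
  have km: "monic E k" "Cod E k = \<Xi>" and lm: "monic E l" "Cod E l = \<Xi>"
    using k l by (auto simp: internal_filter_def)
  note ck = classifies_characteristic[OF km(1)] and cl = classifies_characteristic[OF lm(1)]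
  note [simp] = classifies_arrow[OF ck] classifies_arrow[OF cl] km(2) lm(2)
  show ?thesis
  proof (rule xi_eqI)
    fix X assume [simp]: "X \<in> Ob E"
    show "characteristic E (One K) \<Omega> tru k \<cdot> \<xi> X = characteristic E (One K) \<Omega> tru l \<cdot> \<xi> X"
    proof (rule omega_eqI)
      fix x assume "x \<in> Ar E" "Cod E x = Dom E (characteristic E (One K) \<Omega> tru k \<cdot> \<xi> X)"
      then have x: "x \<in> Ar E" "Cod E x = X" by simp_all
      then show "(characteristic E (One K) \<Omega> tru k \<cdot> \<xi> X) \<cdot> x = true_at (Dom E x) \<longleftrightarrow>
          (characteristic E (One K) \<Omega> tru l \<cdot> \<xi> X) \<cdot> x = true_at (Dom E x)"
        using classifies_iff[OF ck km(1), of "\<xi> X \<cdot> x"] classifies_iff[OF cl lm(1), of "\<xi> X \<cdot> x"]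
          le[OF km lm(1) sub x] le[OF lm km(1) sub[symmetric] x] by auto
    qed simp_all
  qed simp_all
qed

text \<open>
  The largest subobjects in the class are stable under pullback along monomorphisms, so their
  characteristic morphisms \<open>c X\<close> form a cocone.  The induced \<open>\<chi> : \<Xi> \<rightarrow> \<Omega>\<close> preserves the top element
  because the terminal object is in the class, and meets because the largest subobject of \<open>X \<times> Y\<close> in
  the class is the product of those of \<open>X\<close> and \<open>Y\<close>.  The filter is the subobject that \<open>\<chi>\<close> classifies.
\<close>

lemma filter_of_hyperconnected_class:
  assumes "hyperconnected_class E K \<Omega> tru Q"
  obtains k where "internal_filter E K Xi_slat k" "filter_class k = Q"
proof -
  interpret hyperconnected_class E K \<Omega> tru Q by fact
  define c where "c X = characteristic E (One K) \<Omega> tru (counit X)" for X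
  have c: "classifies (c X) (counit X)" if "X \<in> Ob E" for X
    unfolding c_def by (rule classifies_characteristic[OF counit_props(1)[OF that]])
  have c_arrow [simp]: "c X \<in> Ar E" "Dom E (c X) = X" "Cod E (c X) = \<Omega>" if "X \<in> Ob E" for X
    using classifies_arrow[OF c[OF that]] that by simp_all
  have c_iff: "c X \<cdot> x = true_at (Dom E x) \<longleftrightarrow> factors_through E x (counit X)"
    if "x \<in> Ar E" "Cod E x = X" for X x
  proof -
    have "X \<in> Ob E" using that by auto
    then show ?thesis using classifies_iff[OF c counit_props(1), of X x] that by simp
  qed
  \<comment> \<open>Maps preserve membership in the largest subobject in the class.\<close>
  have natural: "factors_through E (f \<cdot> x) (counit Y)"
    if nat: "factors_through E x (counit X)" "x \<in> Ar E" "Cod E x = X" "f \<in> Ar E" "Dom E f = X" "Cod E f = Y" for f x X Y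
  proof -
    have [simp]: "X \<in> Ob E" "Y \<in> Ob E" using nat by auto
    obtain h where h: "h \<in> Ar E" "Dom E h = Dom E x" "Cod E h = core X" "counit X \<cdot> h = x"
      using nat(1) by (rule factors_throughE)
    have "factors_through E (f \<cdot> counit X) (counit Y)"
      using nat by (intro counit_props(4)) simp_all
    then have "factors_through E ((f \<cdot> counit X) \<cdot> h) (counit Y)"
      by (rule factors_through_precomp) (use nat h in simp_all)
    then show ?thesis using nat h by simp
  qed
  have "\<exists>!h. h \<in> Hom E \<Xi> \<Omega> \<and> (\<forall>X \<in> Ob E. h \<cdot> \<xi> X = c X)"
  proof (rule xi_ex1)
    fix m assume m: "monic E m"
    note [simp] = monic_arrow[OF m]
    show "c (Cod E m) \<cdot> m = c (Dom E m)"
    proof (rule omega_eqI)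
      fix x assume "x \<in> Ar E" "Cod E x = Dom E (c (Cod E m) \<cdot> m)"
      then have x: "x \<in> Ar E" "Cod E x = Dom E m" by simp_all
      have "factors_through E (m \<cdot> x) (counit (Cod E m)) \<longleftrightarrow> factors_through E x (counit (Dom E m))"
      proof
        assume "factors_through E x (counit (Dom E m))"
        then show "factors_through E (m \<cdot> x) (counit (Cod E m))"
          using natural[of x "Dom E m" m "Cod E m"] x by simp
      next
        assume "factors_through E (m \<cdot> x) (counit (Cod E m))"
        then obtain h where h: "h \<in> Ar E" "Dom E h = Dom E (m \<cdot> x)" "Cod E h = core (Cod E m)"
          "counit (Cod E m) \<cdot> h = m \<cdot> x"
          by (rule factors_throughE)
        obtain P p q where pb: "is_pullback E P p q (counit (Cod E m)) m"
          using pullback_exists[of "counit (Cod E m)" m] by auto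
        note ar = pullback_arrows[OF pb]
        \<comment> \<open>The intersection \<open>P\<close> of \<open>Dom m\<close> with the core of \<open>Cod m\<close> is a subobject of that core, so it is in the class.\<close>
        have "monic E p" by (rule pullback_monic[OF pb m])
        then have PQ: "P \<in> Q" using class_subobject[of p] ar by simp
        obtain u where u: "u \<in> Ar E" "Dom E u = Dom E h" "Cod E u = P" "q \<cdot> u = x"
          by (rule pullback_lift[OF pb h(1) x(1) _ h(3) x(2) h(4)]) (use x h in simp_all)
        have "factors_through E q (counit (Dom E m))"
          using ar PQ by (intro counit_props(4)) simp_all
        then have "factors_through E (q \<cdot> u) (counit (Dom E m))"
          by (rule factors_through_precomp) (use u ar in simp_all)
        then show "factors_through E x (counit (Dom E m))" using u(4) by simp
      qed
      then show "(c (Cod E m) \<cdot> m) \<cdot> x = true_at (Dom E x) \<longleftrightarrow> c (Dom E m) \<cdot> x = true_at (Dom E x)"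
        using c_iff[of "m \<cdot> x" "Cod E m"] c_iff[of x "Dom E m"] x by simp
    qed simp_all
  qed simp_all
  then obtain \<chi> where \<chi> [simp]: "\<chi> \<in> Ar E" "Dom E \<chi> = \<Xi>" "Cod E \<chi> = \<Omega>"
    and \<chi>_xi: "\<And>X. X \<in> Ob E \<Longrightarrow> \<chi> \<cdot> \<xi> X = c X"
    by (auto simp: Hom_def)
  \<comment> \<open>An object is in the class exactly when it is its own largest subobject in the class.\<close>
  have self: "c X = true_at X \<longleftrightarrow> X \<in> Q" if [simp]: "X \<in> Ob E" for X
  proof -
    have "c X = true_at X \<longleftrightarrow> factors_through E (Ident E X) (counit X)"
      using c_iff[of "Ident E X" X] by simp
    also have "\<dots> \<longleftrightarrow> X \<in> Q"
    proof
      assume "factors_through E (Ident E X) (counit X)"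
      then obtain h where h: "h \<in> Ar E" "Dom E h = Dom E (Ident E X)" "Cod E h = core X"
        "counit X \<cdot> h = Ident E X"
        by (rule factors_throughE)
      then have "monic E h" by (intro split_monic[of h "counit X"]) simp_all
      then show "X \<in> Q" using class_subobject[of h] h by simp
    qed (use counit_props(4) in simp)
    finally show ?thesis .
  qed
  have "\<chi> \<cdot> \<xi> (One K) = tru"
    using \<chi>_xi[of "One K"] self[of "One K"] to_One_unique[of "bang (One K)" "Ident E (One K)"] by simp
  moreover have "\<chi> \<cdot> Xi_meet = omega_meet \<cdot> (\<chi> \<otimes> \<chi>)"
  proof (rule xi_pair_eqI)
    fix X Y assume XY [simp]: "X \<in> Ob E" "Y \<in> Ob E"
    have "c (Prod K X Y) = omega_meet \<cdot> (c X \<otimes> c Y)"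
    proof (rule omega_eqI_pairs[of _ _ X Y])
      fix a b T
      assume ab [simp]: "T \<in> Ob E" "a \<in> Ar E" "b \<in> Ar E" "Dom E a = T" "Dom E b = T" "Cod E a = X" "Cod E b = Y"
      have "factors_through E \<langle>a, b\<rangle> (counit (Prod K X Y)) \<longleftrightarrow>
          factors_through E a (counit X) \<and> factors_through E b (counit Y)"
      proof
        assume "factors_through E \<langle>a, b\<rangle> (counit (Prod K X Y))"
        then show "factors_through E a (counit X) \<and> factors_through E b (counit Y)"
          using natural[of "\<langle>a, b\<rangle>" "Prod K X Y" "Fst K X Y" X] natural[of "\<langle>a, b\<rangle>" "Prod K X Y" "Snd K X Y" Y]
          by simp
      next
        assume "factors_through E a (counit X) \<and> factors_through E b (counit Y)"
        then have fa: "factors_through E a (counit X)" and fb: "factors_through E b (counit Y)" by simp_all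
        obtain h where h: "h \<in> Ar E" "Dom E h = Dom E a" "Cod E h = core X" "counit X \<cdot> h = a"
          using fa by (rule factors_throughE)
        obtain h' where h': "h' \<in> Ar E" "Dom E h' = Dom E b" "Cod E h' = core Y" "counit Y \<cdot> h' = b"
          using fb by (rule factors_throughE)
        have "factors_through E (counit X \<otimes> counit Y) (counit (Prod K X Y))"
          by (rule counit_props(4)) simp_all
        then have "factors_through E ((counit X \<otimes> counit Y) \<cdot> \<langle>h, h'\<rangle>) (counit (Prod K X Y))"
          by (rule factors_through_precomp) (use h h' in simp_all)
        moreover have "(counit X \<otimes> counit Y) \<cdot> \<langle>h, h'\<rangle> = \<langle>a, b\<rangle>" using h h' by simp
        ultimately show "factors_through E \<langle>a, b\<rangle> (counit (Prod K X Y))" by simp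
      qed
      then show "c (Prod K X Y) \<cdot> \<langle>a, b\<rangle> = true_at T \<longleftrightarrow> (omega_meet \<cdot> (c X \<otimes> c Y)) \<cdot> \<langle>a, b\<rangle> = true_at T"
        using c_iff[of "\<langle>a, b\<rangle>" "Prod K X Y"] c_iff[of a X] c_iff[of b Y] by (simp add: omega_meet_true_iff)
    qed simp_all
    then show "(\<chi> \<cdot> Xi_meet) \<cdot> (\<xi> X \<otimes> \<xi> Y) = (omega_meet \<cdot> (\<chi> \<otimes> \<chi>)) \<cdot> (\<xi> X \<otimes> \<xi> Y)"
      by (simp add: Xi_meet_xi \<chi>_xi)
  qed simp_all
  ultimately have hom: "\<chi> \<in> semilattice_homs E K Xi_slat (Omega_semilattice E K \<Omega> tru)"
    using Xi_is_semilattice Omega_is_semilattice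
    by (simp add: semilattice_homs_def Omega_semilattice_def Hom_def flip: omega_meet_def)
  obtain k where k: "monic E k" "Cod E k = Dom E \<chi>" "classifies \<chi> k"
    by (rule classified_exists[of \<chi>]) simp_all
  have "filter_class k = Q"
  proof -
    have "factors_through E (\<xi> X) k \<longleftrightarrow> X \<in> Q" if "X \<in> Ob E" for X
      using classifies_iff[OF k(3,1), of "\<xi> X"] k(2) that \<chi>_xi[OF that] self[OF that] by simp
    then show ?thesis by (auto simp: filter_class_def)
  qed
  then show ?thesis by (rule that[OF hom_classifies_filter[OF hom k(1,3)]])
qed

end

section \<open>The correspondence\<close>

context local_states
begin

definition quotient_of_filter :: "'m \<Rightarrow> ('o, 'm, 'o, 'm) geom set" where
  "quotient_of_filter k = {f. hyperconnected E f \<and> inv_image_objects E f = filter_class k}"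

lemma filter_class_realized:
  assumes "internal_filter E K Xi_slat k"
  obtains f :: "('o, 'm, 'o, 'm) geom" where "hyperconnected E f" "inv_image_objects E f = filter_class k"
proof -
  interpret hyperconnected_class E K \<Omega> tru "filter_class k"
    by (rule hyperconnected_class_of_filter[OF assms])
  show ?thesis using that hyperconnected_geom inv_image_objects_geom by blast
qed

lemma inv_image_is_filter_class:
  fixes g :: "('o, 'm, 'p, 'n) geom"
  assumes "hyperconnected E g"
  obtains k where "internal_filter E K Xi_slat k" "filter_class k = inv_image_objects E g"
  using filter_of_hyperconnected_class[OF hyperconnected_class_inv_image[OF assms]] by blast

lemma quotient_of_filter_image:
  "quotient_of_filter ` {k. internal_filter E K Xi_slat k} = hyperconnected_quotients E"
proof -
  let ?r = "{(f :: ('o, 'm, 'o, 'm) geom, g :: ('o, 'm, 'o, 'm) geom). hyperconnected E f \<and> hyperconnected E g \<and>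
    inv_image_objects E f = inv_image_objects E g}"
  have quot: "quotient_of_filter k = ?r `` {f}"
    if "hyperconnected E f" "inv_image_objects E f = filter_class k" for k and f :: "('o, 'm, 'o, 'm) geom"
    using that by (auto simp: quotient_of_filter_def)
  show ?thesis
  proof (intro equalityI subsetI)
    fix c assume "c \<in> quotient_of_filter ` {k. internal_filter E K Xi_slat k}"
    then obtain k where k: "internal_filter E K Xi_slat k" "c = quotient_of_filter k" by auto
    obtain f :: "('o, 'm, 'o, 'm) geom" where f: "hyperconnected E f" "inv_image_objects E f = filter_class k"
      by (rule filter_class_realized[OF k(1)])
    show "c \<in> hyperconnected_quotients E"
      unfolding hyperconnected_quotients_def k(2) quot[OF f] by (rule quotientI) (simp add: f)
  next
    fix c :: "('o, 'm, 'o, 'm) geom set"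
    assume "c \<in> hyperconnected_quotients E"
    then have "c \<in> {f. hyperconnected E f} // ?r" by (simp only: hyperconnected_quotients_def)
    then obtain f :: "('o, 'm, 'o, 'm) geom" where "c = ?r `` {f}" "f \<in> {f. hyperconnected E f}" by (rule quotientE)
    then have f: "hyperconnected E f" "c = ?r `` {f}" by simp_all
    obtain k where k: "internal_filter E K Xi_slat k" "filter_class k = inv_image_objects E f"
      by (rule inv_image_is_filter_class[OF f(1)])
    then have "c = quotient_of_filter k" using quot[OF f(1)] f(2) by simp
    then show "c \<in> quotient_of_filter ` {k. internal_filter E K Xi_slat k}" using k(1) by simp
  qed
qed

lemma characteristic_image:
  "characteristic E (One K) \<Omega> tru ` {k. internal_filter E K Xi_slat k} =
    semilattice_homs E K Xi_slat (Omega_semilattice E K \<Omega> tru)"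
proof (intro equalityI subsetI)
  fix h assume h: "h \<in> semilattice_homs E K Xi_slat (Omega_semilattice E K \<Omega> tru)"
  then have "h \<in> Ar E" "Cod E h = \<Omega>"
    by (simp_all add: semilattice_homs_def Omega_semilattice_def Hom_def)
  then obtain k where k: "monic E k" "classifies h k" by (rule classified_exists)
  then show "h \<in> characteristic E (One K) \<Omega> tru ` {k. internal_filter E K Xi_slat k}"
    using hom_classifies_filter[OF h k] characteristic_eq[OF k] by auto
qed (auto intro: characteristic_of_filter_is_hom)

lemma filter_subobject_rel_iff:
  assumes "internal_filter E K Xi_slat k" "internal_filter E K Xi_slat l"
  shows "(k, l) \<in> subobject_rel E \<longleftrightarrow>
    characteristic E (One K) \<Omega> tru k = characteristic E (One K) \<Omega> tru l"
  using assms by (intro subobject_rel_iff_characteristic) (auto simp: internal_filter_def)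

lemma subobject_rel_invariants:
  assumes k: "Cod E k = \<Xi>" and kl: "(k, l) \<in> subobject_rel E"
  shows "characteristic E (One K) \<Omega> tru l = characteristic E (One K) \<Omega> tru k"
    "filter_class l = filter_class k"
proof -
  have kl': "monic E k" "monic E l" "Cod E k = Cod E l" "factors_through E k l" "factors_through E l k"
    using kl by (auto simp: subobject_rel_def)
  show "characteristic E (One K) \<Omega> tru l = characteristic E (One K) \<Omega> tru k"
    using subobject_rel_iff_characteristic[OF kl'(1-3)] kl by simp
  show "filter_class l = filter_class k"
    using kl' factors_through_trans monic_arrow unfolding filter_class_def by blast
qed

lemma subobject_classes_eq:
  assumes "(k, l) \<in> subobject_rel E"
  shows "subobject_rel E `` {k} = subobject_rel E `` {l}"
proof -
  have sym: "(b, a) \<in> subobject_rel E" if "(a, b) \<in> subobject_rel E" for a b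
    using that by (simp add: subobject_rel_def)
  have trans: "(a, c) \<in> subobject_rel E"
    if "(a, b) \<in> subobject_rel E" "(b, c) \<in> subobject_rel E" for a b c
    using that factors_through_trans[of a b c] factors_through_trans[of c b a] monic_arrow
    by (simp add: subobject_rel_def)
  show ?thesis using trans[OF assms] trans[OF sym[OF assms]] by blast
qed

lemma filter_bijections:
  "\<exists>\<Phi> \<Psi>. bij_betw \<Phi> (internal_filters E K Xi_slat)
        (semilattice_homs E K Xi_slat (Omega_semilattice E K \<Omega> tru)) \<and>
      bij_betw \<Psi> (internal_filters E K Xi_slat) (hyperconnected_quotients E) \<and>
      (\<forall>k. internal_filter E K Xi_slat k \<longrightarrow>
         \<Phi> (subobject_rel E `` {k}) = characteristic E (One K) \<Omega> tru k \<and>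
         (\<forall>f \<in> \<Psi> (subobject_rel E `` {k}). inv_image_objects E f = {X \<in> Ob E. factors_through E (\<xi> X) k}))"
proof -
  let ?P = "{k. internal_filter E K Xi_slat k}"
  have Cod: "Cod E k = \<Xi>" and refl: "(k, k) \<in> subobject_rel E" if "k \<in> ?P" for k
    using that factors_through_self monic_arrow by (auto simp: internal_filter_def subobject_rel_def)
  obtain \<Phi> where \<Phi>: "bij_betw \<Phi> (?P // subobject_rel E) (semilattice_homs E K Xi_slat (Omega_semilattice E K \<Omega> tru))"
    "\<And>k. k \<in> ?P \<Longrightarrow> \<Phi> (subobject_rel E `` {k}) = characteristic E (One K) \<Omega> tru k"
  proof (rule bij_betw_quotient)
    show "characteristic E (One K) \<Omega> tru ` ?P = semilattice_homs E K Xi_slat (Omega_semilattice E K \<Omega> tru)"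
      by (rule characteristic_image)
    show "subobject_rel E `` {k} = subobject_rel E `` {l}"
      if "k \<in> ?P" "l \<in> ?P" "characteristic E (One K) \<Omega> tru k = characteristic E (One K) \<Omega> tru l" for k l
      using that filter_subobject_rel_iff[of k l] by (intro subobject_classes_eq) simp
  qed (use refl Cod subobject_rel_invariants(1) in blast)+
  obtain \<Psi> where \<Psi>: "bij_betw \<Psi> (?P // subobject_rel E) (hyperconnected_quotients E)"
    "\<And>k. k \<in> ?P \<Longrightarrow> \<Psi> (subobject_rel E `` {k}) = quotient_of_filter k"
  proof (rule bij_betw_quotient)
    show "quotient_of_filter ` ?P = hyperconnected_quotients E" by (rule quotient_of_filter_image)
    show "subobject_rel E `` {k} = subobject_rel E `` {l}"
      if kl: "k \<in> ?P" "l \<in> ?P" "quotient_of_filter k = quotient_of_filter l" for k l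
    proof -
      obtain f :: "('o, 'm, 'o, 'm) geom" where f: "hyperconnected E f" "inv_image_objects E f = filter_class k"
        using filter_class_realized kl(1) by blast
      then have "f \<in> quotient_of_filter l" unfolding kl(3)[symmetric] by (simp add: quotient_of_filter_def)
      then have "filter_class k = filter_class l" using f(2) by (simp add: quotient_of_filter_def)
      then show ?thesis
        using kl filter_class_inject[of k l] filter_subobject_rel_iff[of k l] by (intro subobject_classes_eq) simp
    qed
    show "quotient_of_filter l = quotient_of_filter k" if "k \<in> ?P" "(k, l) \<in> subobject_rel E" for k l
      using subobject_rel_invariants(2)[OF Cod[OF that(1)] that(2)] by (simp add: quotient_of_filter_def)
  qed (use refl in blast)+
  show ?thesis
    using \<Phi> \<Psi> by (intro exI[of _ \<Phi>] exI[of _ \<Psi>])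
      (simp add: internal_filters_def quotient_of_filter_def filter_class_def)
qed

end

theorem theorem4p1:
  fixes E :: "('o, 'm) cat"
    and K :: "('o, 'm) cartesian"
    and \<Omega> \<Xi> :: 'o
    and tru :: 'm
    and \<xi> :: "'o \<Rightarrow> 'm"
  assumes "elementary_topos E"
    and "cartesian_structure E K"
    and "subobject_classifier E (One K) \<Omega> tru"
    and "local_state_classifier E \<Xi> \<xi>"
  shows "(\<exists>\<Phi> \<Psi>.
      bij_betw \<Phi> (internal_filters E K (Xi_semilattice E K \<Xi> \<xi>))
        (semilattice_homs E K (Xi_semilattice E K \<Xi> \<xi>) (Omega_semilattice E K \<Omega> tru)) \<and>
      bij_betw \<Psi> (internal_filters E K (Xi_semilattice E K \<Xi> \<xi>))
        (hyperconnected_quotients E) \<and>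
      (\<forall>k. internal_filter E K (Xi_semilattice E K \<Xi> \<xi>) k \<longrightarrow>
         \<Phi> (subobject_rel E `` {k}) = characteristic E (One K) \<Omega> tru k \<and>
         (\<forall>f \<in> \<Psi> (subobject_rel E `` {k}).
            inv_image_objects E f = {X \<in> Ob E. factors_through E (\<xi> X) k})))
    \<and> (\<forall>g :: ('o, 'm, 'p, 'n) geom. hyperconnected E g \<longrightarrow>
      (\<exists>f :: ('o, 'm, 'o, 'm) geom.
        hyperconnected E f \<and> inv_image_objects E f = inv_image_objects E g))"
proof -
  interpret category E using assms(1) by (simp add: elementary_topos_def)
  interpret local_states E K \<Omega> tru \<Xi> \<xi>
    by unfold_locales (fact assms)+
  have "\<exists>f :: ('o, 'm, 'o, 'm) geom. hyperconnected E f \<and> inv_image_objects E f = inv_image_objects E g"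
    if "hyperconnected E g" for g :: "('o, 'm, 'p, 'n) geom"
    using inv_image_is_filter_class[OF that] filter_class_realized by metis
  then show ?thesis using filter_bijections by blast
qed

end
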